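(* There is a primitive recursive function $k_1:\omega\to\omega$ such that for all $e,m\in\omega$ and all $X\in{}^{\omega}\omega$, $$\langle e\rangle^X(m)\;\simeq\;\{k_1(e)\}^{\mathsf{E}}(m,X).$$ Here $\simeq$ means that either both sides converge and have the same value in $\omega$, or neither side converges.
   Context: Finite sequences of integers are coded by integers in a fixed recursive way, so single integer inputs may stand for tuples. **The functional $\mathsf{E}={}^2\mathsf{E}$.** $\mathsf{E}:{}^{\omega}\omega\to\{0,1\}$ is defined by $\mathsf{E}(y)=0$ if $\exists n\; y(n)=0$, and $\mathsf{E}(y)=1$ if $\forall n\; y(n)\neq 0$. **Kleene recursion in $\mathsf{E}$ (Turing machine model).** Programs are ordinary oracle Turing machine programs (with oracle $X$), indexed by $e\in\omega$ in a standard way, with an additional instruction allowing the machine at any stage to issue a query $Q(e',m',X)$, with $e',m'$ integers computed by the machine and the oracle $X$ held fixed. The query asks for the $\omega$-sequence of computations of program $e'$ on inputs $(m',k)$, $k=0,1,2,\dots$, with oracle $X$; if all of them converge, with values $y(k)$, then the integer $\mathsf{E}(y)$, $y=\lambda k.y(k)$, is returned to the calling computation in one step. Formally, for a set $C$ of pairs let $\Gamma(C)$ be the set of pairs $\langle\langle e,m,X\rangle,n\rangle$ such that program $e$ run on input $m$ with oracle $X$ halts with output $n$, where it makes only queries $Q(e',m',X)$ for which there is $y\in{}^{\omega}\omega$ with $\langle\langle e',(m',k),X\rangle,y(k)\rangle\in C$ for all $k\in\omega$, and each such query is answered by $\mathsf{E}(y)$. Let $\Gamma_\infty$ be the least fixed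 point of the monotone operator $\Gamma$, obtained by iteration from $\emptyset$. Then $\{e\}^{\mathsf{E}}(m,X)$ converges with value $n$ iff $\langle\langle e,m,X\rangle,n\rangle\in\Gamma_\infty$; it is undefined (divergent) if there is no such $n$. **Feedback computation.** Programs are ordinary oracle Turing machine programs (with oracle $X$), indexed by $e\in\omega$ in a standard way, with an additional instruction allowing the machine at any stage to issue a query $Q^X(e',m')$, with $e',m'$ integers computed by the machine, asking whether the feedback computation $\langle e'\rangle^X(m')$ converges or diverges, and receiving (in one step) an answer in $\{\downarrow,\uparrow\}$. Formally, for a partial function $C$ let $I(C)$ be the set of pairs $\langle\langle e,m,X\rangle,\langle j,k\rangle\rangle$ such that program $e$, run on input $m$ with oracle $X$, makes only queries $Q^X(e',m')$ for which $C(\langle e',m',X\rangle)=\langle j',k'\rangle$ is defined, each such query being answered by $j'$, and either this run halts with output $k\in\omega$ and $j=\,\downarrow$, or it runs forever and $j=\,\uparrow$, $k=\omega$. Let $I_\infty$ be the least fixed point of the monotone operator $I$, obtained by iteration from $\emptyset$. Then $\langle e\rangle^X(m)$ converges with value $k$ iff $I_\infty(\langle e,m,X\rangle)=\langle\downarrow,k\rangle$; it diverges iff $I_\infty(\langle e,m,X\rangle)=\langle\uparrow,\omega\rangle$; and it is freezing (undefined) iff $\langle e,m,X\rangle\notin\mathrm{dom}(I_\infty)$. Both the divergent and the freezing case count as "not converging" in $\simeq$. *)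

theory Defs
  imports "HOL-Library.Nat_Bijection" "HOL-Library.Extended_Nat"
begin

section \<open>Primitive recursive functions\<close>

(* "primrec_fun n f": f restricted to argument lists of length n is an n-ary primitive recursive
   function.  The value of f on lists of any other length carries no meaning. *)
inductive primrec_fun :: "nat \<Rightarrow> (nat list \<Rightarrow> nat) \<Rightarrow> bool" where
  pr_zero: "primrec_fun n (\<lambda>_. 0)"
| pr_suc: "primrec_fun 1 (\<lambda>xs. Suc (xs ! 0))"
| pr_proj: "i < n \<Longrightarrow> primrec_fun n (\<lambda>xs. xs ! i)"
| pr_comp: "primrec_fun (length gs) f \<Longrightarrow> (\<forall>g\<in>set gs. primrec_fun n g) \<Longrightarrow>
    primrec_fun n (\<lambda>xs. f (map (\<lambda>g. g xs) gs))"
| pr_rec: "primrec_fun n f \<Longrightarrow> primrec_fun (Suc (Suc n)) g \<Longrightarrow>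
    primrec_fun (Suc n) (\<lambda>xs. rec_nat (f (tl xs)) (\<lambda>y r. g (y # r # tl xs)) (hd xs))"

definition primitive_recursive :: "(nat \<Rightarrow> nat) \<Rightarrow> bool" where
  "primitive_recursive k \<longleftrightarrow> (\<exists>f. primrec_fun 1 f \<and> (\<forall>x. k x = f [x]))"


section \<open>Oracle Turing machines with queries\<close>

(* Multi-tape machines.  A tape consists of the cells to the left of the head, nearest first,
   and the scanned cell together with the cells to its right; all further cells are blank.
   Symbol 0 is the blank and symbol 1 is the tally mark. *)
type_synonym tape = "nat list \<times> nat list"

datatype dir = MoveL | MoveR | Stay

definition scanned :: "tape \<Rightarrow> nat" where
  "scanned tp = (case snd tp of [] \<Rightarrow> 0 | s # _ \<Rightarrow> s)"

definition write_sym :: "nat \<Rightarrow> tape \<Rightarrow> tape" where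
  "write_sym s tp = (fst tp, s # tl (snd tp))"

fun move_head :: "dir \<Rightarrow> tape \<Rightarrow> tape" where
  "move_head MoveL ([], r) = ([], 0 # r)"
| "move_head MoveL (s # l, r) = (l, s # r)"
| "move_head MoveR (l, []) = (0 # l, [])"
| "move_head MoveR (l, s # r) = (s # l, r)"
| "move_head Stay tp = tp"

(* Numbers are written in unary; the number read off a tape is its number of tally marks. *)
definition tape_of :: "nat \<Rightarrow> tape" where
  "tape_of n = ([], replicate n 1)"

definition num_of :: "tape \<Rightarrow> nat" where
  "num_of tp = count_list (fst tp) 1 + count_list (snd tp) 1"

(* Each instruction starts with the state in which it applies and ends with the next state.
     Act q t s s' d q':      if tape t scans s, write s' on tape t and move its head by d;
     Oracle q t q':          replace the number n on tape t by X n;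
     Query q te tm ta q':    for the numbers e', m' on tapes te, tm, issue the query (e', m')
                             and write the answer on tape ta.
   Tapes and symbols are named by natural numbers; a program mentions only finitely many. *)
datatype instr =
    Act nat nat nat nat dir nat
  | Oracle nat nat nat
  | Query nat nat nat nat nat

type_synonym program = "instr list"

definition dir_of :: "nat \<Rightarrow> dir" where
  "dir_of d = (if d = 0 then MoveL else if d = 1 then MoveR else Stay)"

(* An instruction is coded by a list of seven numbers with an initial tag; fields that the tagged
   instruction does not need are ignored. *)
definition instr_of :: "nat \<Rightarrow> instr option" where
  "instr_of c = (case list_decode c of
       [tag, q, a, b, s, d, q'] \<Rightarrow>
         Some (if tag = 0 then Act q a b s (dir_of d) q'
               else if tag = 1 then Oracle q a q'
               else Query q a b s q')
     | _ \<Rightarrow> None)"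

(* The program with index e.  Numbers in the list that do not code an instruction are skipped. *)
definition program_of :: "nat \<Rightarrow> program" where
  "program_of e = List.map_filter instr_of (list_decode e)"

lemma program_of_surj: "\<exists>e. program_of e = P"
proof -
  have "\<exists>c. instr_of c = Some i" for i
  proof (cases i)
    case (Act q t s s' d q')
    have "\<exists>n. dir_of n = d"
      by (cases d) (auto simp: dir_of_def intro: exI[of _ 0] exI[of _ 1] exI[of _ 2])
    then obtain n where "dir_of n = d" by blast
    then show ?thesis
      using Act by (intro exI[of _ "list_encode [0, q, t, s, s', n, q']"]) (simp add: instr_of_def)
  next
    case (Oracle q t q')
    then show ?thesis
      by (intro exI[of _ "list_encode [1, q, t, 0, 0, 0, q']"]) (simp add: instr_of_def)
  next
    case (Query q te tm ta q')
    then show ?thesis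
      by (intro exI[of _ "list_encode [2, q, te, tm, ta, 0, q']"]) (simp add: instr_of_def)
  qed
  then obtain f where f: "\<And>i. instr_of (f i) = Some i" by metis
  have "program_of (list_encode (map f P)) = P"
    by (induction P) (simp_all add: program_of_def List.map_filter_simps f)
  then show ?thesis by blast
qed

(* A configuration consists of a state and the contents of all tapes. *)
type_synonym config = "nat \<times> (nat \<Rightarrow> tape)"

fun applicable :: "config \<Rightarrow> instr \<Rightarrow> bool" where
  "applicable (p, T) (Act q t s s' d q') \<longleftrightarrow> p = q \<and> scanned (T t) = s"
| "applicable (p, T) (Oracle q t q') \<longleftrightarrow> p = q"
| "applicable (p, T) (Query q te tm ta q') \<longleftrightarrow> p = q"

(* Among several applicable instructions the first one is executed; the machine halts when
   no instruction is applicable. *)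
definition next_instr :: "program \<Rightarrow> config \<Rightarrow> instr option" where
  "next_instr P c = find (applicable c) P"

(* A e' m' is the answer to the query (e', m'). *)
fun exec :: "(nat \<Rightarrow> nat) \<Rightarrow> (nat \<Rightarrow> nat \<Rightarrow> nat) \<Rightarrow> instr \<Rightarrow> config \<Rightarrow> config" where
  "exec X A (Act q t s s' d q') (p, T) = (q', T(t := move_head d (write_sym s' (T t))))"
| "exec X A (Oracle q t q') (p, T) = (q', T(t := tape_of (X (num_of (T t)))))"
| "exec X A (Query q te tm ta q') (p, T) =
     (q', T(ta := tape_of (A (num_of (T te)) (num_of (T tm)))))"

definition step :: "(nat \<Rightarrow> nat) \<Rightarrow> (nat \<Rightarrow> nat \<Rightarrow> nat) \<Rightarrow> program \<Rightarrow> config \<Rightarrow> config" where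
  "step X A P c = (case next_instr P c of None \<Rightarrow> c | Some i \<Rightarrow> exec X A i c)"

definition init_config :: "nat \<Rightarrow> config" where
  "init_config m = (0, (\<lambda>_. tape_of 0)(0 := tape_of m))"

definition config_at ::
    "(nat \<Rightarrow> nat) \<Rightarrow> (nat \<Rightarrow> nat \<Rightarrow> nat) \<Rightarrow> program \<Rightarrow> nat \<Rightarrow> nat \<Rightarrow> config" where
  "config_at X A P m t = (step X A P ^^ t) (init_config m)"

definition halts_with ::
    "(nat \<Rightarrow> nat) \<Rightarrow> (nat \<Rightarrow> nat \<Rightarrow> nat) \<Rightarrow> program \<Rightarrow> nat \<Rightarrow> nat \<Rightarrow> bool" where
  "halts_with X A P m n \<longleftrightarrow>
     (\<exists>t. next_instr P (config_at X A P m t) = None \<and> num_of (snd (config_at X A P m t) 0) = n)"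

fun queried :: "instr \<Rightarrow> config \<Rightarrow> (nat \<times> nat) option" where
  "queried (Query q te tm ta q') (p, T) = Some (num_of (T te), num_of (T tm))"
| "queried _ _ = None"

definition queries ::
    "(nat \<Rightarrow> nat) \<Rightarrow> (nat \<Rightarrow> nat \<Rightarrow> nat) \<Rightarrow> program \<Rightarrow> nat \<Rightarrow> (nat \<times> nat) set" where
  "queries X A P m =
     {em. \<exists>t i. next_instr P (config_at X A P m t) = Some i \<and>
                queried i (config_at X A P m t) = Some em}"


section \<open>Kleene recursion in E\<close>

definition E2 :: "(nat \<Rightarrow> nat) \<Rightarrow> nat" where
  "E2 y = (if \<exists>n. y n = 0 then 0 else 1)"

type_synonym input = "nat \<times> nat \<times> (nat \<Rightarrow> nat)"

(* The function A ranges over all conceivable assignments of answers; only its values on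
   the queries issued in the run matter, and those are required to be the prescribed ones. *)
definition Gamma :: "(input \<times> nat) set \<Rightarrow> (input \<times> nat) set" where
  "Gamma C = {((e, m, X), n) | e m X n. \<exists>A.
     (\<forall>(e', m') \<in> queries X A (program_of e) m.
        \<exists>y. (\<forall>k. ((e', list_encode [m', k], X), y k) \<in> C) \<and> A e' m' = E2 y) \<and>
     halts_with X A (program_of e) m n}"

definition Gamma_inf :: "(input \<times> nat) set" where
  "Gamma_inf = lfp Gamma"

definition E_converges :: "nat \<Rightarrow> nat \<Rightarrow> (nat \<Rightarrow> nat) \<Rightarrow> nat \<Rightarrow> bool" where
  "E_converges e m X n \<longleftrightarrow> ((e, m, X), n) \<in> Gamma_inf"


section \<open>Feedback computation\<close>

datatype answer = Conv | Div

(* The number written on the answer tape. *)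
fun answer_code :: "answer \<Rightarrow> nat" where
  "answer_code Conv = 0"
| "answer_code Div = 1"

(* Partial functions are represented by their graphs.  The second component of an outcome is
   the output, or infinity in place of omega. *)
definition Feedback :: "(input \<times> answer \<times> enat) set \<Rightarrow> (input \<times> answer \<times> enat) set" where
  "Feedback C = {((e, m, X), (j, k)) | e m X j k. \<exists>A.
     (\<forall>(e', m') \<in> queries X A (program_of e) m.
        \<exists>j' k'. ((e', m', X), (j', k')) \<in> C \<and> A e' m' = answer_code j') \<and>
     ((\<exists>n. halts_with X A (program_of e) m n \<and> j = Conv \<and> k = enat n) \<or>
      ((\<nexists>n. halts_with X A (program_of e) m n) \<and> j = Div \<and> k = \<infinity>))}"

definition Feedback_inf :: "(input \<times> answer \<times> enat) set" where
  "Feedback_inf = lfp Feedback"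

definition feedback_converges :: "nat \<Rightarrow> nat \<Rightarrow> (nat \<Rightarrow> nat) \<Rightarrow> nat \<Rightarrow> bool" where
  "feedback_converges e m X n \<longleftrightarrow> ((e, m, X), (Conv, enat n)) \<in> Feedback_inf"


section \<open>Monotonicity and single-valuedness\<close>

lemma mono_Gamma: "mono Gamma"
proof (rule monoI, rule subsetI)
  fix C D :: "(input \<times> nat) set" and z
  assume "C \<subseteq> D" "z \<in> Gamma C"
  then obtain e m X n A where z: "z = ((e, m, X), n)"
    and q: "\<And>e' m'. (e', m') \<in> queries X A (program_of e) m \<Longrightarrow>
        \<exists>y. (\<forall>k. ((e', list_encode [m', k], X), y k) \<in> D) \<and> A e' m' = E2 y"
    and h: "halts_with X A (program_of e) m n"
    unfolding Gamma_def by fast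
  show "z \<in> Gamma D"
    unfolding Gamma_def z using q h by blast
qed

lemma mono_Feedback: "mono Feedback"
proof (rule monoI, rule subsetI)
  fix C D :: "(input \<times> answer \<times> enat) set" and z
  assume "C \<subseteq> D" "z \<in> Feedback C"
  then obtain e m X j k A where z: "z = ((e, m, X), (j, k))"
    and q: "\<And>e' m'. (e', m') \<in> queries X A (program_of e) m \<Longrightarrow>
        \<exists>j' k'. ((e', m', X), (j', k')) \<in> D \<and> A e' m' = answer_code j'"
    and h: "(\<exists>n. halts_with X A (program_of e) m n \<and> j = Conv \<and> k = enat n) \<or>
      ((\<nexists>n. halts_with X A (program_of e) m n) \<and> j = Div \<and> k = \<infinity>)"
    unfolding Feedback_def by fast
  show "z \<in> Feedback D"
    unfolding Feedback_def z using q h by blast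
qed

lemma exec_cong:
  assumes "\<And>e m. queried i c = Some (e, m) \<Longrightarrow> A e m = B e m"
  shows "exec X A i c = exec X B i c"
  using assms by (cases c; cases i) auto

lemma config_at_cong:
  assumes "\<And>e m. (e, m) \<in> queries X A P n \<Longrightarrow> (e, m) \<in> queries X B P n \<Longrightarrow> A e m = B e m"
  shows "config_at X A P n t = config_at X B P n t"
proof (induction t)
  case 0
  show ?case by (simp add: config_at_def)
next
  case (Suc t)
  let ?c = "config_at X A P n t"
  have "exec X A i ?c = exec X B i ?c" if i: "next_instr P ?c = Some i" for i
  proof (rule exec_cong)
    fix e m
    assume "queried i ?c = Some (e, m)"
    with i Suc.IH have "(e, m) \<in> queries X A P n" "(e, m) \<in> queries X B P n"
      unfolding queries_def by (simp_all, metis+)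
    then show "A e m = B e m" by (rule assms)
  qed
  then have "step X A P ?c = step X B P ?c"
    by (simp add: step_def split: option.split)
  with Suc.IH show ?case by (simp add: config_at_def)
qed

lemma halts_with_cong:
  assumes "\<And>e m. (e, m) \<in> queries X A P n \<Longrightarrow> (e, m) \<in> queries X B P n \<Longrightarrow> A e m = B e m"
  shows "halts_with X A P n = halts_with X B P n"
  using config_at_cong[of X A P n B, OF assms] unfolding halts_with_def by presburger

lemma config_at_halted:
  "next_instr P (config_at X A P m t) = None \<Longrightarrow> config_at X A P m (t + d) = config_at X A P m t"
  by (induction d) (simp_all add: config_at_def step_def)

lemma halts_with_unique:
  assumes "halts_with X A P m n" "halts_with X A P m n'"
  shows "n = n'"
proof -
  obtain t t' where
    t: "next_instr P (config_at X A P m t) = None" "num_of (snd (config_at X A P m t) 0) = n" and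
    t': "next_instr P (config_at X A P m t') = None" "num_of (snd (config_at X A P m t') 0) = n'"
    using assms unfolding halts_with_def by blast
  have "config_at X A P m (t + t') = config_at X A P m t"
    "config_at X A P m (t' + t) = config_at X A P m t'"
    using t t' by (simp_all only: config_at_halted)
  with t t' show ?thesis by (simp add: add.commute)
qed

lemma Gamma_inf_unfold: "Gamma_inf = Gamma Gamma_inf"
  unfolding Gamma_inf_def by (rule lfp_unfold[OF mono_Gamma])

lemma Feedback_inf_unfold: "Feedback_inf = Feedback Feedback_inf"
  unfolding Feedback_inf_def by (rule lfp_unfold[OF mono_Feedback])

lemma Gamma_inf_unique:
  assumes "(x, n) \<in> Gamma_inf" "(x, n') \<in> Gamma_inf"
  shows "n = n'"
proof -
  let ?U = "{(x, n). \<forall>n'. (x, n') \<in> Gamma_inf \<longrightarrow> n = n'}"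
  have "Gamma ?U \<subseteq> ?U"
  proof clarify
    fix e m X n n'
    assume "((e, m, X), n) \<in> Gamma ?U"
    then obtain A where
      A: "\<And>e' m'. (e', m') \<in> queries X A (program_of e) m \<Longrightarrow>
            \<exists>y. (\<forall>k. ((e', list_encode [m', k], X), y k) \<in> ?U) \<and> A e' m' = E2 y"
      and n: "halts_with X A (program_of e) m n"
      unfolding Gamma_def by fast
    assume "((e, m, X), n') \<in> Gamma_inf"
    then have "((e, m, X), n') \<in> Gamma Gamma_inf" by (subst (asm) Gamma_inf_unfold)
    then obtain B where
      B: "\<And>e' m'. (e', m') \<in> queries X B (program_of e) m \<Longrightarrow>
            \<exists>y. (\<forall>k. ((e', list_encode [m', k], X), y k) \<in> Gamma_inf) \<and> B e' m' = E2 y"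
      and n': "halts_with X B (program_of e) m n'"
      unfolding Gamma_def by fast
    have "A e' m' = B e' m'"
      if q: "(e', m') \<in> queries X A (program_of e) m" "(e', m') \<in> queries X B (program_of e) m"
      for e' m'
    proof -
      obtain y where y: "\<And>k. ((e', list_encode [m', k], X), y k) \<in> ?U" "A e' m' = E2 y"
        using A[OF q(1)] by blast
      obtain z where z: "\<And>k. ((e', list_encode [m', k], X), z k) \<in> Gamma_inf" "B e' m' = E2 z"
        using B[OF q(2)] by blast
      have "y = z" using y(1) z(1) by fast
      with y z show ?thesis by simp
    qed
    from halts_with_cong[of X A "program_of e" m B, OF this] n n' show "n = n'"
      using halts_with_unique by metis
  qed
  then have "Gamma_inf \<subseteq> ?U" unfolding Gamma_inf_def by (rule lfp_lowerbound)
  with assms show ?thesis by blast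
qed

lemma Feedback_inf_unique:
  assumes "(x, v) \<in> Feedback_inf" "(x, v') \<in> Feedback_inf"
  shows "v = v'"
proof -
  let ?U = "{(x, v). \<forall>v'. (x, v') \<in> Feedback_inf \<longrightarrow> v = v'}"
  have "Feedback ?U \<subseteq> ?U"
  proof (intro subsetI, clarify)
    fix e m X j k j' k'
    assume "((e, m, X), (j, k)) \<in> Feedback ?U"
    then obtain A where
      A: "\<And>e' m'. (e', m') \<in> queries X A (program_of e) m \<Longrightarrow>
            \<exists>j k. ((e', m', X), (j, k)) \<in> ?U \<and> A e' m' = answer_code j"
      and v: "(\<exists>n. halts_with X A (program_of e) m n \<and> j = Conv \<and> k = enat n) \<or>
              ((\<nexists>n. halts_with X A (program_of e) m n) \<and> j = Div \<and> k = \<infinity>)"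
      unfolding Feedback_def by fast
    assume "((e, m, X), (j', k')) \<in> Feedback_inf"
    then have "((e, m, X), (j', k')) \<in> Feedback Feedback_inf" by (subst (asm) Feedback_inf_unfold)
    then obtain B where
      B: "\<And>e' m'. (e', m') \<in> queries X B (program_of e) m \<Longrightarrow>
            \<exists>j k. ((e', m', X), (j, k)) \<in> Feedback_inf \<and> B e' m' = answer_code j"
      and v': "(\<exists>n. halts_with X B (program_of e) m n \<and> j' = Conv \<and> k' = enat n) \<or>
              ((\<nexists>n. halts_with X B (program_of e) m n) \<and> j' = Div \<and> k' = \<infinity>)"
      unfolding Feedback_def by fast
    have "A e' m' = B e' m'"
      if q: "(e', m') \<in> queries X A (program_of e) m" "(e', m') \<in> queries X B (program_of e) m"
      for e' m'
      using A[OF q(1)] B[OF q(2)] by fastforce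
    from halts_with_cong[of X A "program_of e" m B, OF this] v v'
    show "j = j' \<and> k = k'"
      using halts_with_unique by metis
  qed
  then have "Feedback_inf \<subseteq> ?U" unfolding Feedback_inf_def by (rule lfp_lowerbound)
  with assms show ?thesis by blast
qed


section \<open>Equality of partial values\<close>

(* A partial value is given by the predicate "converges with value n". *)
definition kleene_eq :: "(nat \<Rightarrow> bool) \<Rightarrow> (nat \<Rightarrow> bool) \<Rightarrow> bool"  (infix "\<simeq>" 50) where
  "a \<simeq> b \<longleftrightarrow> (\<exists>n. a n \<and> b n) \<or> ((\<nexists>n. a n) \<and> (\<nexists>n. b n))"

end

theory Submission
  imports Defs
begin

text \<open>
  One E-program u simulates feedback computations with a clock: on input ((u, e, m), k) it runs
  program e on m for k steps, returns 0 iff e has halted by then, and answers every feedback query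
  (e', m') by the E-query (u, (u, e', m')).  The values of that query for k = 0, 1, ... are 0 from
  some k on iff the computation of e' on m' converges, so E returns exactly the code of the
  feedback answer.  As u is handed down as data, no recursion theorem is needed.  Since the queries
  of u on ((u, e, m), k) mirror those of e on m in its first k steps, definedness is transferred by
  induction along the feedback fixed point, and back by induction along the fixed point for E.  The
  program with index k1(e) first asks (u, (u, e, m)), loops if the answer is 1, and otherwise
  simulates e on m without clock.  Only the instructions that load e depend on e.
\<close>

section \<open>A counter language compiled to Turing machines\<close>

text \<open>An E-query is answered only if its whole sequence converges, so recursion in E has no
  outcome that corresponds to a divergent feedback computation. The clock turns such a computation
  into a total sequence of ones, while a freezing query leaves the sequence undefined from some k
  on; this is how the two cases stay apart. Both operators speak of an answer function A that is
  constrained only on the queries of the run that it produces itself. Both inductions therefore work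
  with one canonical answer function for each X and compare runs only as far as their queries are
  known to be answered alike. The opening query of k1(e) settles the converse direction: if k1(e)
  converges, that query was answered by 0, and the correctness of u on it yields feedback
  convergence. Hence the unclocked simulation is analysed for halting runs only, and a big-step
  semantics of terminating commands suffices; the one intended infinite loop is
  \<open>Stall\<close>.\<close>

datatype com =
    Inc nat
  | Dec nat
  | Orc nat
  | Qry nat nat nat
  | Stall nat
  | Seq com com  (infixr ";;" 60)
  | While nat com

text \<open>Only terminating executions have a derivation, and the set argument collects the queries
  issued on the way. \<open>Stall\<close> has a rule for register value 0 alone; its infinite loop
  is treated directly on machine configurations.\<close>

inductive runs :: "(nat \<Rightarrow> nat) \<Rightarrow> (nat \<Rightarrow> nat \<Rightarrow> nat) \<Rightarrow> com \<Rightarrow> (nat \<Rightarrow> nat) \<Rightarrow>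
    (nat \<times> nat) set \<Rightarrow> (nat \<Rightarrow> nat) \<Rightarrow> bool"
  for X A where
  Inc: "runs X A (Inc r) \<sigma> {} (\<sigma>(r := Suc (\<sigma> r)))"
| Dec: "runs X A (Dec r) \<sigma> {} (\<sigma>(r := \<sigma> r - 1))"
| Orc: "runs X A (Orc r) \<sigma> {} (\<sigma>(r := X (\<sigma> r)))"
| Qry: "runs X A (Qry a b r) \<sigma> {(\<sigma> a, \<sigma> b)} (\<sigma>(r := A (\<sigma> a) (\<sigma> b)))"
| Stall: "\<sigma> r = 0 \<Longrightarrow> runs X A (Stall r) \<sigma> {} \<sigma>"
| Seq: "runs X A c \<sigma> Q \<sigma>' \<Longrightarrow> runs X A d \<sigma>' Q' \<sigma>'' \<Longrightarrow> runs X A (c ;; d) \<sigma> (Q \<union> Q') \<sigma>''"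
| While_exit: "\<sigma> r = 0 \<Longrightarrow> runs X A (While r c) \<sigma> {} \<sigma>"
| While_iter: "\<sigma> r \<noteq> 0 \<Longrightarrow> runs X A c \<sigma> Q \<sigma>' \<Longrightarrow> runs X A (While r c) \<sigma>' Q' \<sigma>'' \<Longrightarrow>
    runs X A (While r c) \<sigma> (Q \<union> Q') \<sigma>''"

fun len :: "com \<Rightarrow> nat" where
  "len (Inc r) = 2"
| "len (Seq c d) = len c + len d"
| "len (While r c) = len c + 2"
| "len _ = 1"

text \<open>Tape r holds register r in unary. The code occupies the states from p to
  \<open>p + len c - 1\<close> and leaves through \<open>p + len c\<close>. Both \<open>Inc\<close>
  and \<open>Dec\<close> work at the left end of the number, adding or erasing its first mark. Since
  \<open>Act\<close> fires on one scanned symbol, an unconditional jump takes two instructions; the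
  last state of \<open>While\<close> is such a jump back to the test.\<close>

fun compile :: "com \<Rightarrow> nat \<Rightarrow> program" where
  "compile (Inc r) p =
     [Act p r 0 1 Stay (p + 2), Act p r 1 1 MoveL (p + 1), Act (p + 1) r 0 1 Stay (p + 2)]"
| "compile (Dec r) p = [Act p r 0 0 Stay (p + 1), Act p r 1 0 MoveR (p + 1)]"
| "compile (Orc r) p = [Oracle p r (p + 1)]"
| "compile (Qry a b r) p = [Query p a b r (p + 1)]"
| "compile (Stall r) p = [Act p r 0 0 Stay (p + 1), Act p r 1 1 Stay p]"
| "compile (c ;; d) p = compile c p @ compile d (p + len c)"
| "compile (While r c) p =
     [Act p r 0 0 Stay (p + len c + 2), Act p r 1 1 Stay (p + 1)] @ compile c (p + 1) @
     [Act (p + len c + 1) r 0 0 Stay p, Act (p + len c + 1) r 1 1 Stay p]"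

section \<open>Code blocks inside larger programs\<close>

fun src :: "instr \<Rightarrow> nat" where
  "src (Act q t s s' d q') = q"
| "src (Oracle q t q') = q"
| "src (Query q te tm ta q') = q"

lemma applicable_src: "applicable (q, T) i \<Longrightarrow> src i = q"
  by (cases i) auto

lemma next_instr_filter:
  "next_instr P (q, T) = find (applicable (q, T)) (filter (\<lambda>i. src i = q) P)"
  unfolding next_instr_def by (induction P) (auto dest: applicable_src)

lemma src_compile: "i \<in> set (compile c p) \<Longrightarrow> p \<le> src i \<and> src i < p + len c"
  by (induction c arbitrary: p) fastforce+

lemma filter_compile_outside:
  "q < p \<or> p + len c \<le> q \<Longrightarrow> filter (\<lambda>i. src i = q) (compile c p) = []"
  using src_compile[of _ c p] by (fastforce simp: filter_empty_conv)

text \<open>Only instructions whose source is the current state can apply, and the first applicable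
  one is taken. A block therefore behaves as in isolation as soon as each of its states has the same
  instructions in the same order; their position in the program and the code around them are left
  open.\<close>

definition loaded :: "program \<Rightarrow> nat \<Rightarrow> com \<Rightarrow> bool" where
  "loaded P p c \<longleftrightarrow> (\<forall>q. p \<le> q \<and> q < p + len c \<longrightarrow>
     filter (\<lambda>i. src i = q) P = filter (\<lambda>i. src i = q) (compile c p))"

lemma loaded_compile: "loaded (compile c p) p c"
  by (simp add: loaded_def)

lemma loaded_Seq:
  assumes "loaded P p (c ;; d)"
  shows "loaded P p c" "loaded P (p + len c) d"
  using assms by (auto simp: loaded_def filter_compile_outside)

lemma loaded_While:
  assumes "loaded P p (While r c)"
  shows "loaded P (p + 1) c"
  using assms by (auto simp: loaded_def)

lemma next_instr_loaded:
  assumes "loaded P p c" "p \<le> q" "q < p + len c"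
  shows "next_instr P (q, T) = next_instr (compile c p) (q, T)"
  using assms by (simp add: loaded_def next_instr_filter)

lemma next_instr_While_end:
  assumes "loaded P p (While r c)"
  shows "next_instr P (p + len c + 1, T) = next_instr
    [Act (p + len c + 1) r 0 0 Stay p, Act (p + len c + 1) r 1 1 Stay p] (p + len c + 1, T)"
proof -
  have "filter (\<lambda>i. src i = p + len c + 1) P =
      [Act (p + len c + 1) r 0 0 Stay p, Act (p + len c + 1) r 1 1 Stay p]"
    using assms by (simp add: loaded_def filter_compile_outside)
  then show ?thesis by (simp add: next_instr_filter)
qed

section \<open>Machine runs with their query sets\<close>

definition qset :: "program \<Rightarrow> config \<Rightarrow> (nat \<times> nat) set" where
  "qset P c = {em. \<exists>i. next_instr P c = Some i \<and> queried i c = Some em}"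

text \<open>The query of the end configuration is not counted: it belongs to the run that continues
  from there, so that composition of runs is union of query sets.\<close>

definition steps :: "(nat \<Rightarrow> nat) \<Rightarrow> (nat \<Rightarrow> nat \<Rightarrow> nat) \<Rightarrow> program \<Rightarrow> config \<Rightarrow>
    (nat \<times> nat) set \<Rightarrow> config \<Rightarrow> bool" where
  "steps X A P c Q c' \<longleftrightarrow>
     (\<exists>t. c' = (step X A P ^^ t) c \<and> Q = (\<Union>s<t. qset P ((step X A P ^^ s) c)))"

lemma steps_step: "next_instr P c = Some i \<Longrightarrow>
    steps X A P c {em. queried i c = Some em} (exec X A i c)"
  unfolding steps_def by (rule exI[of _ 1]) (auto simp: qset_def step_def lessThan_Suc)

lemma steps_trans:
  assumes "steps X A P c Q c'" "steps X A P c' Q' c''"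
  shows "steps X A P c (Q \<union> Q') c''"
proof -
  let ?f = "step X A P"
  obtain t t' where t: "c' = (?f ^^ t) c" "Q = (\<Union>s<t. qset P ((?f ^^ s) c))"
    and t': "c'' = (?f ^^ t') c'" "Q' = (\<Union>s<t'. qset P ((?f ^^ s) c'))"
    using assms unfolding steps_def by blast
  have "{..<t' + t} = {..<t} \<union> (\<lambda>s. s + t) ` {..<t'}"
  proof (intro set_eqI iffI)
    fix s
    assume "s \<in> {..<t' + t}"
    then have "s < t \<or> s - t < t' \<and> s = (s - t) + t" by auto
    then show "s \<in> {..<t} \<union> (\<lambda>s. s + t) ` {..<t'}" by blast
  qed auto
  then have "(\<Union>s<t' + t. qset P ((?f ^^ s) c)) = Q \<union> Q'"
    using t t' by (simp add: funpow_add)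
  with t t' show ?thesis
    unfolding steps_def by (intro exI[of _ "t' + t"]) (simp add: funpow_add)
qed

section \<open>Registers as unary tapes\<close>

definition represents :: "tape \<Rightarrow> nat \<Rightarrow> bool" where
  "represents tp n \<longleftrightarrow>
     set (fst tp) \<subseteq> {0} \<and> (\<exists>k. snd tp = replicate n 1 @ replicate k 0)"

lemma represents_tape_of: "represents (tape_of n) n"
  by (simp add: represents_def tape_of_def)

lemma represents_num_of: "represents tp n \<Longrightarrow> num_of tp = n"
proof -
  have "count_list (replicate a (b::nat)) 1 = (if b = 1 then a else 0)" for a b
    by (induction a) auto
  moreover have "set l \<subseteq> {0} \<Longrightarrow> count_list l (1::nat) = 0" for l
    by (induction l) auto
  moreover assume "represents tp n"
  ultimately show ?thesis by (auto simp: represents_def num_of_def)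
qed

lemma represents_scanned: "represents tp n \<Longrightarrow> scanned tp = (if n = 0 then 0 else 1)"
  by (cases n; cases "snd tp") (auto simp: represents_def scanned_def Cons_replicate_eq)

text \<open>Every test of a register rewrites the symbol that it scans. Beyond the written cells
  this adds an explicit blank, which the trailing zeros in \<open>represents\<close> absorb;
  \<open>Suc (k - 1)\<close> counts them, also for k = 0.\<close>

lemma represents_write_scanned:
  assumes "represents tp n"
  shows "represents (write_sym (if n = 0 then 0 else 1) tp) n"
proof (cases n)
  case 0
  with assms obtain k where "snd tp = replicate k 0" "set (fst tp) \<subseteq> {0}"
    by (auto simp: represents_def)
  with 0 show ?thesis
    by (auto simp: represents_def write_sym_def intro!: exI[of _ "Suc (k - 1)"])
next
  case (Suc n)
  with assms show ?thesis by (auto simp: represents_def write_sym_def)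
qed

lemma represents_0_inc: "represents tp 0 \<Longrightarrow> represents (write_sym (Suc 0) tp) (Suc 0)"
  by (auto simp: represents_def write_sym_def)

text \<open>Left of the number there are only blanks, written or not, so a step to the left of the
  first mark finds room for one more.\<close>

lemma represents_Suc_inc:
  assumes "represents tp (Suc n)"
  shows "scanned (move_head MoveL (write_sym 1 tp)) = 0"
    "represents (write_sym 1 (move_head MoveL (write_sym 1 tp))) (Suc (Suc n))"
  using assms
  by (cases "fst tp"; auto simp: represents_def write_sym_def scanned_def)+

lemma represents_dec: "represents tp (Suc n) \<Longrightarrow> represents (move_head MoveR (write_sym 0 tp)) n"
  by (auto simp: represents_def write_sym_def)

definition represents_all :: "(nat \<Rightarrow> tape) \<Rightarrow> (nat \<Rightarrow> nat) \<Rightarrow> bool" where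
  "represents_all T \<sigma> \<longleftrightarrow> (\<forall>r. represents (T r) (\<sigma> r))"

lemma represents_all_upd:
  "represents_all T \<sigma> \<Longrightarrow> represents tp n \<Longrightarrow> represents_all (T(r := tp)) (\<sigma>(r := n))"
  by (simp add: represents_all_def)

lemma represents_all_upd_same:
  "represents_all T \<sigma> \<Longrightarrow> represents tp (\<sigma> r) \<Longrightarrow> represents_all (T(r := tp)) \<sigma>"
  by (simp add: represents_all_def)

lemma move_head_Stay [simp]: "move_head Stay tp = tp"
  by (cases tp) simp

text \<open>The induction follows the derivation of \<open>runs\<close> and not the command: a
  derivation for \<open>While\<close> contains the one for the remaining rounds, so no separate
  induction on the number of rounds arises.\<close>

lemma compile_correct:
  assumes "runs X A c \<sigma> Q \<sigma>'" "loaded P p c" "represents_all T \<sigma>"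
  shows "\<exists>T'. steps X A P (p, T) Q (p + len c, T') \<and> represents_all T' \<sigma>'"
  using assms
proof (induction arbitrary: p T)
  case (Inc r \<sigma>)
  note n = next_instr_loaded[OF Inc(1)]
  have rep: "represents (T r) (\<sigma> r)" using Inc by (simp add: represents_all_def)
  show ?case
  proof (cases "\<sigma> r")
    case 0
    then have "next_instr P (p, T) = Some (Act p r 0 1 Stay (p + 2))"
      using n[of p T] represents_scanned[OF rep] by (simp add: next_instr_def)
    from steps_step[OF this] have "steps X A P (p, T) {} (p + 2, T(r := write_sym 1 (T r)))" by simp
    moreover have "represents_all (T(r := write_sym 1 (T r))) (\<sigma>(r := Suc (\<sigma> r)))"
      using Inc rep 0 by (auto intro!: represents_all_upd represents_0_inc)
    ultimately show ?thesis unfolding len.simps Un_empty_left by blast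
  next
    case (Suc k)
    let ?T = "T(r := move_head MoveL (write_sym 1 (T r)))"
    have rep': "represents (T r) (Suc k)" using rep Suc by simp
    have "next_instr P (p, T) = Some (Act p r 1 1 MoveL (p + 1))"
      using n[of p T] represents_scanned[OF rep'] by (simp add: next_instr_def)
    from steps_step[OF this] have 1: "steps X A P (p, T) {} (p + 1, ?T)" by simp
    have "next_instr P (p + 1, ?T) = Some (Act (p + 1) r 0 1 Stay (p + 2))"
      using n[of "p + 1" ?T] represents_Suc_inc(1)[OF rep'] by (simp add: next_instr_def)
    from steps_step[OF this] have
      "steps X A P (p + 1, ?T) {} (p + 2, ?T(r := write_sym 1 (?T r)))" by simp
    with 1 have "steps X A P (p, T) ({} \<union> {}) (p + 2, ?T(r := write_sym 1 (?T r)))"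
      by (rule steps_trans)
    moreover have "represents_all (?T(r := write_sym 1 (?T r))) (\<sigma>(r := Suc (\<sigma> r)))"
      using Inc represents_Suc_inc(2)[OF rep'] Suc by (auto intro!: represents_all_upd)
    ultimately show ?thesis unfolding len.simps Un_empty_left by blast
  qed
next
  case (Dec r \<sigma>)
  note n = next_instr_loaded[OF Dec(1)]
  have rep: "represents (T r) (\<sigma> r)" using Dec by (simp add: represents_all_def)
  show ?case
  proof (cases "\<sigma> r")
    case 0
    then have "next_instr P (p, T) = Some (Act p r 0 0 Stay (p + 1))"
      using n[of p T] represents_scanned[OF rep] by (simp add: next_instr_def)
    from steps_step[OF this] have "steps X A P (p, T) {} (p + 1, T(r := write_sym 0 (T r)))" by simp
    moreover have "represents_all (T(r := write_sym 0 (T r))) (\<sigma>(r := \<sigma> r - 1))"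
      using Dec represents_write_scanned[OF rep] 0 by (auto intro!: represents_all_upd)
    ultimately show ?thesis unfolding len.simps Un_empty_left by blast
  next
    case (Suc k)
    have rep': "represents (T r) (Suc k)" using rep Suc by simp
    have "next_instr P (p, T) = Some (Act p r 1 0 MoveR (p + 1))"
      using n[of p T] represents_scanned[OF rep'] by (simp add: next_instr_def)
    from steps_step[OF this] have
      "steps X A P (p, T) {} (p + 1, T(r := move_head MoveR (write_sym 0 (T r))))" by simp
    moreover have
      "represents_all (T(r := move_head MoveR (write_sym 0 (T r)))) (\<sigma>(r := \<sigma> r - 1))"
      using Dec represents_dec[OF rep'] Suc by (auto intro!: represents_all_upd)
    ultimately show ?thesis unfolding len.simps Un_empty_left by blast
  qed
next
  case (Orc r \<sigma>)
  have "next_instr P (p, T) = Some (Oracle p r (p + 1))"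
    using next_instr_loaded[OF Orc(1), of p T] by (simp add: next_instr_def)
  from steps_step[OF this] have
    "steps X A P (p, T) {} (p + 1, T(r := tape_of (X (num_of (T r)))))" by simp
  moreover have "num_of (T r) = \<sigma> r"
    using Orc by (simp add: represents_all_def represents_num_of)
  ultimately show ?case
    using represents_all_upd[OF Orc(2) represents_tape_of] unfolding len.simps by metis
next
  case (Qry a b r \<sigma>)
  have "next_instr P (p, T) = Some (Query p a b r (p + 1))"
    using next_instr_loaded[OF Qry(1), of p T] by (simp add: next_instr_def)
  from steps_step[OF this] have
    "steps X A P (p, T) {(num_of (T a), num_of (T b))}
      (p + 1, T(r := tape_of (A (num_of (T a)) (num_of (T b)))))" by simp
  moreover have "num_of (T a) = \<sigma> a" "num_of (T b) = \<sigma> b"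
    using Qry by (simp_all add: represents_all_def represents_num_of)
  ultimately show ?case
    using represents_all_upd[OF Qry(2) represents_tape_of] unfolding len.simps by metis
next
  case (Stall \<sigma> r)
  have rep: "represents (T r) 0" using Stall by (metis represents_all_def)
  have "next_instr P (p, T) = Some (Act p r 0 0 Stay (p + 1))"
    using next_instr_loaded[OF Stall(2), of p T] represents_scanned[OF rep]
    by (simp add: next_instr_def)
  from steps_step[OF this] have "steps X A P (p, T) {} (p + 1, T(r := write_sym 0 (T r)))" by simp
  moreover have "represents_all (T(r := write_sym 0 (T r))) \<sigma>"
    using Stall represents_write_scanned[OF rep] by (auto intro!: represents_all_upd_same)
  ultimately show ?case unfolding len.simps by blast
next
  case (Seq c \<sigma> Q \<sigma>' d Q' \<sigma>'')
  obtain T' where T': "steps X A P (p, T) Q (p + len c, T')" "represents_all T' \<sigma>'"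
    using Seq.IH(1)[OF loaded_Seq(1)[OF Seq.prems(1)] Seq.prems(2)] by blast
  obtain T'' where "steps X A P (p + len c, T') Q' (p + len c + len d, T'')"
    "represents_all T'' \<sigma>''"
    using Seq.IH(2)[OF loaded_Seq(2)[OF Seq.prems(1)] T'(2)] by blast
  with T' show ?case by (auto intro: steps_trans simp: add.assoc)
next
  case (While_exit \<sigma> r c)
  have rep: "represents (T r) 0" using While_exit by (metis represents_all_def)
  have "next_instr P (p, T) = Some (Act p r 0 0 Stay (p + len c + 2))"
    using next_instr_loaded[OF While_exit(2), of p T] represents_scanned[OF rep]
    by (simp add: next_instr_def)
  from steps_step[OF this] have
    "steps X A P (p, T) {} (p + len c + 2, T(r := write_sym 0 (T r)))" by simp
  moreover have "represents_all (T(r := write_sym 0 (T r))) \<sigma>"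
    using While_exit represents_write_scanned[OF rep] by (auto intro!: represents_all_upd_same)
  ultimately show ?case by (auto simp: add.assoc)
next
  case (While_iter \<sigma> r c Q \<sigma>' Q' \<sigma>'')
  have rep: "represents (T r) (\<sigma> r)" using While_iter by (simp add: represents_all_def)
  let ?T = "T(r := write_sym 1 (T r))"
  have "next_instr P (p, T) = Some (Act p r 1 1 Stay (p + 1))"
    using next_instr_loaded[OF While_iter.prems(1), of p T] represents_scanned[OF rep]
      While_iter.hyps(1)
    by (simp add: next_instr_def)
  from steps_step[OF this] have 1: "steps X A P (p, T) {} (p + 1, ?T)" by simp
  have "represents_all ?T \<sigma>"
    using While_iter.prems represents_write_scanned[OF rep] While_iter.hyps(1)
    by (auto intro!: represents_all_upd_same)
  from While_iter.IH(1)[OF loaded_While[OF While_iter.prems(1)] this]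
  obtain T' where T': "steps X A P (p + 1, ?T) Q (p + 1 + len c, T')" "represents_all T' \<sigma>'"
    by blast
  \<comment> \<open>The jump back has one instruction for each scanned symbol. \<open>?s\<close> is
    the symbol found after the body, and it is written back unchanged.\<close>
  let ?s = "if \<sigma>' r = 0 then 0 else 1"
  let ?T' = "T'(r := write_sym ?s (T' r))"
  have rep': "represents (T' r) (\<sigma>' r)" using T' by (simp add: represents_all_def)
  have "next_instr P (p + len c + 1, T') = Some (Act (p + len c + 1) r ?s ?s Stay p)"
    using next_instr_While_end[OF While_iter.prems(1)] represents_scanned[OF rep']
    by (simp add: next_instr_def)
  from steps_step[OF this] have 2: "steps X A P (p + 1 + len c, T') {} (p, ?T')" by simp
  have "represents_all ?T' \<sigma>'"
    using T'(2) represents_write_scanned[OF rep'] by (intro represents_all_upd_same)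
  from While_iter.IH(2)[OF While_iter.prems(1) this]
  obtain T'' where "steps X A P (p, ?T') Q' (p + len (While r c), T'')" "represents_all T'' \<sigma>''"
    by blast
  with steps_trans[OF steps_trans[OF 1 T'(1)] steps_trans[OF 2]] show ?case by fastforce
qed

text \<open>Overwriting a mark by a mark without moving gives the very same tape, so the
  configuration is a fixed point of \<open>step\<close> although an instruction applies to
  it.\<close>

lemma stalled:
  assumes "loaded P p (Stall r)" "represents (T r) (Suc n)"
  shows "step X A P (p, T) = (p, T)" "next_instr P (p, T) \<noteq> None"
proof -
  have *: "next_instr P (p, T) = Some (Act p r 1 1 Stay p)"
    using next_instr_loaded[OF assms(1), of p T] represents_scanned[OF assms(2)]
    by (simp add: next_instr_def)
  have "write_sym 1 (T r) = T r"
    using assms(2) by (cases "T r") (auto simp: represents_def write_sym_def)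
  with * show "step X A P (p, T) = (p, T)" "next_instr P (p, T) \<noteq> None"
    by (simp_all add: step_def)
qed

text \<open>From the halting time on the configuration is constant and issues no query, so the
  queries collected up to that time are all queries of the run.\<close>

lemma halts_with_steps:
  assumes "steps X A P (init_config m) Q c" "next_instr P c = None"
  shows "halts_with X A P m n \<longleftrightarrow> n = num_of (snd c 0)" "queries X A P m = Q"
proof -
  obtain t where t: "c = config_at X A P m t"
    and Q: "Q = (\<Union>s<t. qset P (config_at X A P m s))"
    using assms(1) unfolding steps_def config_at_def by blast
  have "halts_with X A P m (num_of (snd c 0))"
    using assms(2) t unfolding halts_with_def by blast
  then show "halts_with X A P m n \<longleftrightarrow> n = num_of (snd c 0)"
    using halts_with_unique by blast
  have "s < t" if "next_instr P (config_at X A P m s) = Some i" for s i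
  proof (rule ccontr)
    assume "\<not> s < t"
    then have "config_at X A P m s = c"
      using config_at_halted[of P X A m t "s - t"] assms(2) t by simp
    with that assms(2) show False by simp
  qed
  then show "queries X A P m = Q"
    unfolding Q queries_def qset_def by fastforce
qed

lemma steps_queries: "steps X A P (init_config m) Q c \<Longrightarrow> Q \<subseteq> queries X A P m"
  unfolding steps_def queries_def qset_def config_at_def by blast

lemma not_halts_with_stationary:
  assumes "steps X A P (init_config m) Q c" "step X A P c = c" "next_instr P c \<noteq> None"
  shows "\<not> halts_with X A P m n"
proof
  assume "halts_with X A P m n"
  then obtain s where s: "next_instr P (config_at X A P m s) = None"
    unfolding halts_with_def by blast
  obtain t where t: "c = config_at X A P m t"
    using assms(1) unfolding steps_def config_at_def by blast
  have "(step X A P ^^ s) c = c" using assms(2) by (induction s) simp_all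
  then have "config_at X A P m (s + t) = c" using t by (simp add: config_at_def funpow_add)
  with config_at_halted[OF s, of t] s assms(3) show False by simp
qed

lemma represents_all_init:
  "represents_all (snd (init_config m)) ((\<lambda>_. 0)(0 := m))"
  by (simp add: represents_all_def init_config_def represents_tape_of)

lemma next_instr_compile_exit: "next_instr (compile c p) (p + len c, T) = None"
  by (simp add: next_instr_filter filter_compile_outside)

section \<open>The pairing function\<close>

abbreviation npair :: "nat \<Rightarrow> nat \<Rightarrow> nat" where
  "npair a b \<equiv> prod_encode (a, b)"

definition nfst :: "nat \<Rightarrow> nat" where
  "nfst n = fst (prod_decode n)"

definition nsnd :: "nat \<Rightarrow> nat" where
  "nsnd n = snd (prod_decode n)"

lemma nfst_npair [simp]: "nfst (npair a b) = a"
  and nsnd_npair [simp]: "nsnd (npair a b) = b"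
  and npair_collapse [simp]: "npair (nfst n) (nsnd n) = n"
  by (simp_all add: nfst_def nsnd_def)

lemma nsnd_le: "nsnd n \<le> n"
  using le_prod_encode_2[of "nsnd n" "nfst n"] by simp

lemma nfst_0 [simp]: "nfst 0 = 0" and nsnd_0 [simp]: "nsnd 0 = 0"
  by (simp_all add: nfst_def nsnd_def prod_decode_def prod_decode_aux.simps)

text \<open>Together with \<open>npair_0_Suc\<close> this gives the two moves of the enumeration of
  pairs: along a diagonal, and from the end of a diagonal to the start of the next. The two inner
  loops of \<open>Unpair\<close> are these moves.\<close>

lemma npair_Suc_right: "npair (Suc a) b = Suc (npair a (Suc b))"
  by (simp add: prod_encode_def)

lemma npair_0_Suc: "npair 0 (Suc a) = Suc (npair a 0)"
  by (simp add: prod_encode_def)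

text \<open>The final registers are fixed before X and A are chosen, so a command verified once can
  be inserted into every run without changing its query set.\<close>

definition does :: "com \<Rightarrow> (nat \<Rightarrow> nat) \<Rightarrow> (nat \<Rightarrow> nat) \<Rightarrow> bool" where
  "does c \<sigma> \<sigma>' \<longleftrightarrow> (\<forall>X A. runs X A c \<sigma> {} \<sigma>')"

lemma does_Inc: "does (Inc r) \<sigma> (\<sigma>(r := Suc (\<sigma> r)))"
  and does_Dec: "does (Dec r) \<sigma> (\<sigma>(r := \<sigma> r - 1))"
  unfolding does_def by (blast intro: runs.Inc runs.Dec)+

lemma does_Seq: "does c \<sigma> \<sigma>' \<Longrightarrow> does d \<sigma>' \<sigma>'' \<Longrightarrow> does (c ;; d) \<sigma> \<sigma>''"
  unfolding does_def using runs.Seq[of _ _ c \<sigma> "{}" \<sigma>' d "{}" \<sigma>''] by simp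

lemma does_eq: "does c \<sigma> \<sigma>' \<Longrightarrow> \<sigma>' = \<sigma>'' \<Longrightarrow> does c \<sigma> \<sigma>''"
  by simp

lemma does_While_exit: "\<sigma> r = 0 \<Longrightarrow> does (While r c) \<sigma> \<sigma>"
  unfolding does_def by (blast intro: runs.While_exit)

lemma does_While_iter:
  "\<sigma> r \<noteq> 0 \<Longrightarrow> does c \<sigma> \<sigma>' \<Longrightarrow> does (While r c) \<sigma>' \<sigma>'' \<Longrightarrow> does (While r c) \<sigma> \<sigma>''"
  unfolding does_def using runs.While_iter[of \<sigma> r _ _ c "{}" \<sigma>' "{}" \<sigma>''] by simp

text \<open>The loop register is its own variant, by strong induction on its value; each loop then
  needs only an invariant.\<close>

lemma does_While:
  assumes body: "\<And>\<sigma>. I \<sigma> \<Longrightarrow> \<sigma> r \<noteq> 0 \<Longrightarrow> \<exists>\<sigma>'. does c \<sigma> \<sigma>' \<and> I \<sigma>' \<and> \<sigma>' r < \<sigma> r"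
    and "I \<sigma>"
  shows "\<exists>\<sigma>'. does (While r c) \<sigma> \<sigma>' \<and> I \<sigma>' \<and> \<sigma>' r = 0"
  using \<open>I \<sigma>\<close>
proof (induction "\<sigma> r" arbitrary: \<sigma> rule: less_induct)
  case less
  show ?case
  proof (cases "\<sigma> r = 0")
    case True
    with less.prems show ?thesis by (blast intro: does_While_exit)
  next
    case False
    with body less.prems obtain \<sigma>' where "does c \<sigma> \<sigma>'" "I \<sigma>'" "\<sigma>' r < \<sigma> r" by blast
    with less.hyps False show ?thesis by (blast intro: does_While_iter)
  qed
qed

section \<open>Counter arithmetic\<close>

definition Clear :: "nat \<Rightarrow> com" where
  "Clear x = While x (Dec x)"

lemma does_Clear: "does (Clear x) \<sigma> (\<sigma>(x := 0))"
proof -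
  have "\<exists>\<sigma>'. does (While x (Dec x)) \<sigma> \<sigma>' \<and> (\<forall>i. i \<noteq> x \<longrightarrow> \<sigma>' i = \<sigma> i) \<and> \<sigma>' x = 0"
    by (rule does_While) (auto intro!: exI does_Dec)
  then obtain \<sigma>' where \<sigma>': "does (While x (Dec x)) \<sigma> \<sigma>'" "\<forall>i. i \<noteq> x \<longrightarrow> \<sigma>' i = \<sigma> i" "\<sigma>' x = 0"
    by blast
  then have "\<sigma>' = \<sigma>(x := 0)" by auto
  with \<sigma>' show ?thesis by (simp add: Clear_def)
qed

definition Add :: "nat \<Rightarrow> nat \<Rightarrow> com" where
  "Add x y = While x (Dec x ;; Inc y)"

lemma does_Add:
  assumes "x \<noteq> y"
  shows "does (Add x y) \<sigma> (\<sigma>(x := 0, y := \<sigma> y + \<sigma> x))"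
proof -
  have "\<exists>\<sigma>'. does (Add x y) \<sigma> \<sigma>' \<and>
      ((\<forall>i. i \<noteq> x \<and> i \<noteq> y \<longrightarrow> \<sigma>' i = \<sigma> i) \<and> \<sigma>' y + \<sigma>' x = \<sigma> y + \<sigma> x) \<and> \<sigma>' x = 0"
    unfolding Add_def
    by (rule does_While) (use assms in \<open>auto intro!: exI does_Seq does_Dec does_Inc\<close>)
  then obtain \<sigma>' where \<sigma>': "does (Add x y) \<sigma> \<sigma>'" "\<forall>i. i \<noteq> x \<and> i \<noteq> y \<longrightarrow> \<sigma>' i = \<sigma> i"
    "\<sigma>' y + \<sigma>' x = \<sigma> y + \<sigma> x" "\<sigma>' x = 0"
    by blast
  then have "\<sigma>' = \<sigma>(x := 0, y := \<sigma> y + \<sigma> x)" by auto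
  with \<sigma>' show ?thesis by simp
qed

definition Distribute :: "nat \<Rightarrow> nat \<Rightarrow> nat \<Rightarrow> com" where
  "Distribute x y z = While x (Dec x ;; Inc y ;; Inc z)"

lemma does_Distribute:
  assumes "x \<noteq> y" "x \<noteq> z" "y \<noteq> z"
  shows "does (Distribute x y z) \<sigma> (\<sigma>(x := 0, y := \<sigma> y + \<sigma> x, z := \<sigma> z + \<sigma> x))"
proof -
  have "\<exists>\<sigma>'. does (Distribute x y z) \<sigma> \<sigma>' \<and>
      ((\<forall>i. i \<noteq> x \<and> i \<noteq> y \<and> i \<noteq> z \<longrightarrow> \<sigma>' i = \<sigma> i) \<and>
        \<sigma>' y + \<sigma>' x = \<sigma> y + \<sigma> x \<and> \<sigma>' z + \<sigma>' x = \<sigma> z + \<sigma> x) \<and> \<sigma>' x = 0"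
    unfolding Distribute_def
    by (rule does_While) (use assms in \<open>auto intro!: exI does_Seq does_Dec does_Inc\<close>)
  then obtain \<sigma>' where \<sigma>': "does (Distribute x y z) \<sigma> \<sigma>'"
    "\<forall>i. i \<noteq> x \<and> i \<noteq> y \<and> i \<noteq> z \<longrightarrow> \<sigma>' i = \<sigma> i"
    "\<sigma>' y + \<sigma>' x = \<sigma> y + \<sigma> x" "\<sigma>' z + \<sigma>' x = \<sigma> z + \<sigma> x" "\<sigma>' x = 0"
    by blast
  then have "\<sigma>' = \<sigma>(x := 0, y := \<sigma> y + \<sigma> x, z := \<sigma> z + \<sigma> x)" by auto
  with \<sigma>' show ?thesis by simp
qed

text \<open>Reading a register destroys it. So x is drained into y and the scratch register y + 1 at
  once and restored from the latter, which ends as 0; live data have to lie below y.\<close>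

definition Copy :: "nat \<Rightarrow> nat \<Rightarrow> com" where
  "Copy x y = Clear y ;; Clear (Suc y) ;; Distribute x y (Suc y) ;; Add (Suc y) x"

lemma does_Copy:
  assumes "x < y"
  shows "does (Copy x y) \<sigma> (\<sigma>(y := \<sigma> x, Suc y := 0))"
proof -
  define \<tau> where "\<tau> = \<sigma>(y := 0, Suc y := 0)"
  define \<tau>' where "\<tau>' = \<tau>(x := 0, y := \<tau> y + \<tau> x, Suc y := \<tau> (Suc y) + \<tau> x)"
  have "does (Copy x y) \<sigma> (\<tau>'(Suc y := 0, x := \<tau>' x + \<tau>' (Suc y)))"
    unfolding Copy_def \<tau>_def \<tau>'_def
    by (rule does_Seq does_Clear does_Distribute does_Add | use assms in simp)+
  moreover have "\<tau>'(Suc y := 0, x := \<tau>' x + \<tau>' (Suc y)) = \<sigma>(y := \<sigma> x, Suc y := 0)"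
    using assms by (auto simp: \<tau>_def \<tau>'_def fun_eq_iff)
  ultimately show ?thesis by simp
qed

text \<open>\<open>prod_encode (a, b)\<close> is \<open>triangle (a + b) + a\<close>. The sum goes
  to r + 1 and the summand a to r + 2; adding r + 1 to r + 2 while r + 1 is counted down contributes
  the triangular number.\<close>

definition Pair_up :: "nat \<Rightarrow> com" where
  "Pair_up r = Clear (r + 2) ;; Distribute r (r + 1) (r + 2) ;;
     While (r + 1) (Copy (r + 1) (r + 3) ;; Add (r + 3) (r + 2) ;; Dec (r + 1)) ;;
     Add (r + 2) r"

lemma does_Pair_up:
  "\<exists>\<sigma>'. does (Pair_up r) \<sigma> \<sigma>' \<and> \<sigma>' r = npair (\<sigma> r) (\<sigma> (r + 1)) \<and> (\<forall>i<r. \<sigma>' i = \<sigma> i)"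
proof -
  define \<sigma>1 where "\<sigma>1 = \<sigma>(r + 2 := 0)"
  define \<sigma>2 where "\<sigma>2 = \<sigma>1(r := 0, r + 1 := \<sigma>1 (r + 1) + \<sigma>1 r, r + 2 := \<sigma>1 (r + 2) + \<sigma>1 r)"
  have 1: "does (Clear (r + 2)) \<sigma> \<sigma>1" unfolding \<sigma>1_def by (rule does_Clear)
  have 2: "does (Distribute r (r + 1) (r + 2)) \<sigma>1 \<sigma>2"
    unfolding \<sigma>2_def by (rule does_Distribute) auto
  let ?c = "Copy (r + 1) (r + 3) ;; Add (r + 3) (r + 2) ;; Dec (r + 1)"
  let ?I = "\<lambda>\<sigma>'. \<sigma>' (r + 2) + triangle (\<sigma>' (r + 1)) = npair (\<sigma> r) (\<sigma> (r + 1)) \<and>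
    \<sigma>' r = 0 \<and> (\<forall>i<r. \<sigma>' i = \<sigma> i)"
  have "\<exists>\<sigma>'. does (While (r + 1) ?c) \<sigma>2 \<sigma>' \<and> ?I \<sigma>' \<and> \<sigma>' (r + 1) = 0"
  proof (rule does_While)
    show "?I \<sigma>2" by (simp add: \<sigma>1_def \<sigma>2_def prod_encode_def add.commute)
  next
    fix \<tau>
    assume I: "?I \<tau>" and nz: "\<tau> (r + 1) \<noteq> 0"
    define \<tau>1 where "\<tau>1 = \<tau>(r + 3 := \<tau> (r + 1), Suc (r + 3) := 0)"
    define \<tau>2 where "\<tau>2 = \<tau>1(r + 3 := 0, r + 2 := \<tau>1 (r + 2) + \<tau>1 (r + 3))"
    define \<tau>3 where "\<tau>3 = \<tau>2(r + 1 := \<tau>2 (r + 1) - 1)"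
    have "does ?c \<tau> \<tau>3"
      unfolding \<tau>1_def \<tau>2_def \<tau>3_def
      by (rule does_Seq does_Copy does_Add does_Dec | simp)+
    moreover obtain n where "\<tau> (r + 1) = Suc n" using nz not0_implies_Suc by blast
    with I have "?I \<tau>3" "\<tau>3 (r + 1) < \<tau> (r + 1)" by (auto simp: \<tau>1_def \<tau>2_def \<tau>3_def)
    ultimately show "\<exists>\<sigma>'. does ?c \<tau> \<sigma>' \<and> ?I \<sigma>' \<and> \<sigma>' (r + 1) < \<tau> (r + 1)" by blast
  qed
  then obtain \<sigma>3 where 3: "does (While (r + 1) ?c) \<sigma>2 \<sigma>3" and I: "?I \<sigma>3" "\<sigma>3 (r + 1) = 0" by blast
  define \<sigma>4 where "\<sigma>4 = \<sigma>3(r + 2 := 0, r := \<sigma>3 r + \<sigma>3 (r + 2))"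
  have "does (Add (r + 2) r) \<sigma>3 \<sigma>4" unfolding \<sigma>4_def by (rule does_Add) simp
  with 1 2 3 have "does (Pair_up r) \<sigma> \<sigma>4" unfolding Pair_up_def by (blast intro: does_Seq)
  moreover have "\<sigma>4 r = npair (\<sigma> r) (\<sigma> (r + 1))" "\<forall>i<r. \<sigma>4 i = \<sigma> i"
    using I by (auto simp: \<sigma>4_def)
  ultimately show ?thesis by blast
qed

text \<open>Counts up to the given code along the diagonals of the pairing function.\<close>

definition Unpair :: "nat \<Rightarrow> com" where
  "Unpair r = (Clear (r + 1) ;; Clear (r + 2)) ;; While r
     ((Dec r ;; Clear (r + 3) ;; Inc (r + 3) ;; Copy (r + 2) (r + 4)) ;;
      While (r + 4) (Clear (r + 4) ;; Clear (r + 3) ;; Dec (r + 2) ;; Inc (r + 1)) ;;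
      While (r + 3) (Dec (r + 3) ;; Add (r + 1) (r + 2) ;; Inc (r + 2)))"

text \<open>The two inner loops form one case distinction. Register r + 3 is a flag set to 1, and r
  + 4 is a copy of the second component. If the copy is nonzero, the first loop runs once and clears
  both its guard and the flag; otherwise the flag survives and the second loop runs once. The
  invariant of the outer loop is that the current pair has the code counted so far.\<close>

lemma does_Unpair:
  "\<exists>\<sigma>'. does (Unpair r) \<sigma> \<sigma>' \<and> \<sigma>' r = 0 \<and> \<sigma>' (r + 1) = nfst (\<sigma> r) \<and> \<sigma>' (r + 2) = nsnd (\<sigma> r) \<and>
    (\<forall>i<r. \<sigma>' i = \<sigma> i)"
proof -
  define \<sigma>1 where "\<sigma>1 = \<sigma>(r + 1 := 0, r + 2 := 0)"
  have 1: "does (Clear (r + 1) ;; Clear (r + 2)) \<sigma> \<sigma>1"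
    unfolding \<sigma>1_def by (rule does_Seq does_Clear)+
  let ?dec = "While (r + 4) (Clear (r + 4) ;; Clear (r + 3) ;; Dec (r + 2) ;; Inc (r + 1))"
  let ?mov = "While (r + 3) (Dec (r + 3) ;; Add (r + 1) (r + 2) ;; Inc (r + 2))"
  let ?c = "(Dec r ;; Clear (r + 3) ;; Inc (r + 3) ;; Copy (r + 2) (r + 4)) ;; ?dec ;; ?mov"
  let ?I = "\<lambda>\<sigma>'. npair (\<sigma>' (r + 1)) (\<sigma>' (r + 2)) + \<sigma>' r = \<sigma> r \<and> (\<forall>i<r. \<sigma>' i = \<sigma> i)"
  have "\<exists>\<sigma>'. does (While r ?c) \<sigma>1 \<sigma>' \<and> ?I \<sigma>' \<and> \<sigma>' r = 0"
  proof (rule does_While)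
    show "?I \<sigma>1" by (simp add: \<sigma>1_def prod_encode_def)
  next
    fix \<tau>
    assume I: "?I \<tau>" and nz: "\<tau> r \<noteq> 0"
    define \<tau>1 where "\<tau>1 = \<tau>(r := \<tau> r - 1, r + 3 := 1, r + 4 := \<tau> (r + 2), r + 5 := 0)"
    have "does (Dec r ;; Clear (r + 3) ;; Inc (r + 3) ;; Copy (r + 2) (r + 4)) \<tau> \<tau>1"
      by (rule does_eq, (rule does_Seq does_Dec does_Clear does_Inc does_Copy | simp)+)
        (auto simp: \<tau>1_def fun_eq_iff)
    then have step: "does (?dec ;; ?mov) \<tau>1 \<sigma>' \<Longrightarrow> does ?c \<tau> \<sigma>'" for \<sigma>'
      by (blast intro: does_Seq)
    show "\<exists>\<sigma>'. does ?c \<tau> \<sigma>' \<and> ?I \<sigma>' \<and> \<sigma>' r < \<tau> r"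
    proof (cases "\<tau> (r + 2)")
      case zero: 0
      then have 0: "\<tau> (Suc (Suc r)) = 0" by simp
      define \<tau>2 where "\<tau>2 = \<tau>1(r + 3 := 0, r + 1 := 0, r + 2 := Suc (\<tau> (r + 1)))"
      have d: "does ?dec \<tau>1 \<tau>1" by (rule does_While_exit) (simp add: \<tau>1_def 0)
      have "does (Dec (r + 3) ;; Add (r + 1) (r + 2) ;; Inc (r + 2)) \<tau>1 \<tau>2"
        by (rule does_eq, (rule does_Seq does_Dec does_Add does_Inc | simp)+)
          (auto simp: \<tau>1_def \<tau>2_def 0 fun_eq_iff)
      from does_While_iter[OF _ this does_While_exit] have "does ?mov \<tau>1 \<tau>2"
        by (simp add: \<tau>1_def \<tau>2_def)
      with d have "does ?c \<tau> \<tau>2" by (intro step does_Seq)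
      moreover have "?I \<tau>2" "\<tau>2 r < \<tau> r"
        using I nz by (auto simp: \<tau>1_def \<tau>2_def 0 npair_0_Suc)
      ultimately show ?thesis by blast
    next
      case succ: (Suc b)
      then have Suc: "\<tau> (Suc (Suc r)) = Suc b" by simp
      define \<tau>2 where "\<tau>2 = \<tau>1(r + 4 := 0, r + 3 := 0, r + 2 := b, r + 1 := Suc (\<tau> (r + 1)))"
      have "does (Clear (r + 4) ;; Clear (r + 3) ;; Dec (r + 2) ;; Inc (r + 1)) \<tau>1 \<tau>2"
        by (rule does_eq, (rule does_Seq does_Dec does_Clear does_Inc)+)
          (auto simp: \<tau>1_def \<tau>2_def Suc fun_eq_iff)
      from does_While_iter[OF _ this does_While_exit] have d: "does ?dec \<tau>1 \<tau>2"
        by (simp add: \<tau>1_def \<tau>2_def Suc)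
      have "does ?mov \<tau>2 \<tau>2" by (rule does_While_exit) (simp add: \<tau>2_def)
      with d have "does ?c \<tau> \<tau>2" by (intro step does_Seq)
      moreover have "?I \<tau>2" "\<tau>2 r < \<tau> r"
        using I nz by (auto simp: \<tau>1_def \<tau>2_def Suc npair_Suc_right)
      ultimately show ?thesis by blast
    qed
  qed
  then obtain \<sigma>2 where "does (While r ?c) \<sigma>1 \<sigma>2" and I: "?I \<sigma>2" "\<sigma>2 r = 0" by blast
  with 1 have "does (Unpair r) \<sigma> \<sigma>2"
    unfolding Unpair_def by (blast intro: does_Seq)
  moreover have "\<sigma> r = npair (\<sigma>2 (r + 1)) (\<sigma>2 (r + 2))" using I by simp
  ultimately show ?thesis using I by auto
qed

section \<open>Functions computable without queries\<close>

text \<open>Registers are used as a stack: argument and result sit at r, everything above is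
  scratch, everything below is preserved. The base r is quantified before the command because nested
  computations have to be shifted above the data that are still in use.\<close>

definition computable :: "(nat \<Rightarrow> nat) \<Rightarrow> bool" where
  "computable f \<longleftrightarrow>
     (\<forall>r. \<exists>c. \<forall>\<sigma>. \<exists>\<sigma>'. does c \<sigma> \<sigma>' \<and> \<sigma>' r = f (\<sigma> r) \<and> (\<forall>i<r. \<sigma>' i = \<sigma> i))"

lemma computableI:
  assumes "\<And>r \<sigma>. \<exists>\<sigma>'. does (c r) \<sigma> \<sigma>' \<and> \<sigma>' r = f (\<sigma> r) \<and> (\<forall>i<r. \<sigma>' i = \<sigma> i)"
  shows "computable f"
  unfolding computable_def using assms by blast

lemma computableD:
  assumes "computable f"
  shows "\<exists>c. \<forall>r \<sigma>. \<exists>\<sigma>'. does (c r) \<sigma> \<sigma>' \<and> \<sigma>' r = f (\<sigma> r) \<and> (\<forall>i<r. \<sigma>' i = \<sigma> i)"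
  using assms unfolding computable_def by metis

lemma computable_id: "computable (\<lambda>x. x)"
  by (rule computableI[of "\<lambda>r. Clear (Suc r)"]) (auto intro!: exI does_Clear)

lemma computable_zero: "computable (\<lambda>x. 0)"
  by (rule computableI[of Clear]) (auto intro!: exI does_Clear)

lemma computable_comp:
  assumes "computable f" "computable g"
  shows "computable (\<lambda>x. f (g x))"
proof -
  obtain c d where
    c: "\<forall>r \<sigma>. \<exists>\<sigma>'. does (c r) \<sigma> \<sigma>' \<and> \<sigma>' r = f (\<sigma> r) \<and> (\<forall>i<r. \<sigma>' i = \<sigma> i)" and
    d: "\<forall>r \<sigma>. \<exists>\<sigma>'. does (d r) \<sigma> \<sigma>' \<and> \<sigma>' r = g (\<sigma> r) \<and> (\<forall>i<r. \<sigma>' i = \<sigma> i)"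
    using computableD[OF assms(1)] computableD[OF assms(2)] by blast
  show ?thesis
  proof (rule computableI[of "\<lambda>r. d r ;; c r"])
    fix r and \<sigma> :: "nat \<Rightarrow> nat"
    obtain \<sigma>1 where 1: "does (d r) \<sigma> \<sigma>1" "\<sigma>1 r = g (\<sigma> r)" "\<forall>i<r. \<sigma>1 i = \<sigma> i"
      using d by blast
    obtain \<sigma>2 where "does (c r) \<sigma>1 \<sigma>2" "\<sigma>2 r = f (\<sigma>1 r)" "\<forall>i<r. \<sigma>2 i = \<sigma>1 i"
      using c by blast
    with 1 show "\<exists>\<sigma>'. does (d r ;; c r) \<sigma> \<sigma>' \<and> \<sigma>' r = f (g (\<sigma> r)) \<and> (\<forall>i<r. \<sigma>' i = \<sigma> i)"
      by (intro exI[of _ \<sigma>2]) (auto intro: does_Seq)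
  qed
qed

lemma computable_Suc: "computable g \<Longrightarrow> computable (\<lambda>x. Suc (g x))"
  by (rule computable_comp[of Suc], rule computableI[of Inc]) (auto intro!: exI does_Inc)

lemma computable_pred: "computable g \<Longrightarrow> computable (\<lambda>x. g x - 1)"
  by (rule computable_comp[of "\<lambda>x. x - 1"], rule computableI[of Dec]) (auto intro!: exI does_Dec)

lemma computable_const: "computable (\<lambda>_. n)"
  by (induction n) (auto intro: computable_zero computable_Suc)

lemma computable_nfst: "computable g \<Longrightarrow> computable (\<lambda>x. nfst (g x))"
proof (rule computable_comp[of nfst], rule computableI[of "\<lambda>r. Unpair r ;; Add (r + 1) r"])
  fix r and \<sigma> :: "nat \<Rightarrow> nat"
  obtain \<sigma>' where "does (Unpair r) \<sigma> \<sigma>'" "\<sigma>' r = 0" "\<sigma>' (r + 1) = nfst (\<sigma> r)" "\<forall>i<r. \<sigma>' i = \<sigma> i"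
    using does_Unpair by blast
  moreover have "does (Add (r + 1) r) \<sigma>' (\<sigma>'(r + 1 := 0, r := \<sigma>' r + \<sigma>' (r + 1)))"
    by (rule does_Add) simp
  ultimately show
    "\<exists>\<sigma>'. does (Unpair r ;; Add (r + 1) r) \<sigma> \<sigma>' \<and> \<sigma>' r = nfst (\<sigma> r) \<and> (\<forall>i<r. \<sigma>' i = \<sigma> i)"
    by (intro exI conjI) (erule (1) does_Seq, auto)
qed

lemma computable_nsnd: "computable g \<Longrightarrow> computable (\<lambda>x. nsnd (g x))"
proof (rule computable_comp[of nsnd], rule computableI[of "\<lambda>r. Unpair r ;; Add (r + 2) r"])
  fix r and \<sigma> :: "nat \<Rightarrow> nat"
  obtain \<sigma>' where "does (Unpair r) \<sigma> \<sigma>'" "\<sigma>' r = 0" "\<sigma>' (r + 2) = nsnd (\<sigma> r)" "\<forall>i<r. \<sigma>' i = \<sigma> i"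
    using does_Unpair by blast
  moreover have "does (Add (r + 2) r) \<sigma>' (\<sigma>'(r + 2 := 0, r := \<sigma>' r + \<sigma>' (r + 2)))"
    by (rule does_Add) simp
  ultimately show
    "\<exists>\<sigma>'. does (Unpair r ;; Add (r + 2) r) \<sigma> \<sigma>' \<and> \<sigma>' r = nsnd (\<sigma> r) \<and> (\<forall>i<r. \<sigma>' i = \<sigma> i)"
    by (intro exI conjI) (erule (1) does_Seq, auto)
qed

lemma computable_npair:
  assumes "computable f" "computable g"
  shows "computable (\<lambda>x. npair (f x) (g x))"
proof -
  obtain c d where
    c: "\<forall>r \<sigma>. \<exists>\<sigma>'. does (c r) \<sigma> \<sigma>' \<and> \<sigma>' r = f (\<sigma> r) \<and> (\<forall>i<r. \<sigma>' i = \<sigma> i)" and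
    d: "\<forall>r \<sigma>. \<exists>\<sigma>'. does (d r) \<sigma> \<sigma>' \<and> \<sigma>' r = g (\<sigma> r) \<and> (\<forall>i<r. \<sigma>' i = \<sigma> i)"
    using computableD[OF assms(1)] computableD[OF assms(2)] by blast
  let ?c = "\<lambda>r. Copy r (r + 1) ;; d (r + 1) ;; Copy r (r + 2) ;; c (r + 2) ;; Clear r ;;
    Add (r + 2) r ;; Pair_up r"
  show ?thesis
  proof (rule computableI[of ?c])
    fix r and \<sigma> :: "nat \<Rightarrow> nat"
    define \<sigma>1 where "\<sigma>1 = \<sigma>(r + 1 := \<sigma> r, Suc (r + 1) := 0)"
    obtain \<sigma>2 where 2: "does (d (r + 1)) \<sigma>1 \<sigma>2" "\<sigma>2 (r + 1) = g (\<sigma>1 (r + 1))"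
      "\<forall>i<r+1. \<sigma>2 i = \<sigma>1 i"
      using d by blast
    define \<sigma>3 where "\<sigma>3 = \<sigma>2(r + 2 := \<sigma>2 r, Suc (r + 2) := 0)"
    obtain \<sigma>4 where 4: "does (c (r + 2)) \<sigma>3 \<sigma>4" "\<sigma>4 (r + 2) = f (\<sigma>3 (r + 2))"
      "\<forall>i<r+2. \<sigma>4 i = \<sigma>3 i"
      using c by blast
    define \<sigma>5 where "\<sigma>5 = \<sigma>4(r := 0)"
    define \<sigma>6 where "\<sigma>6 = \<sigma>5(r + 2 := 0, r := \<sigma>5 r + \<sigma>5 (r + 2))"
    obtain \<sigma>7 where 7: "does (Pair_up r) \<sigma>6 \<sigma>7" "\<sigma>7 r = npair (\<sigma>6 r) (\<sigma>6 (r + 1))"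
      "\<forall>i<r. \<sigma>7 i = \<sigma>6 i"
      using does_Pair_up by blast
    have "does (Copy r (r + 1)) \<sigma> \<sigma>1" "does (Copy r (r + 2)) \<sigma>2 \<sigma>3" "does (Clear r) \<sigma>4 \<sigma>5"
      "does (Add (r + 2) r) \<sigma>5 \<sigma>6"
      unfolding \<sigma>1_def \<sigma>3_def \<sigma>5_def \<sigma>6_def
      by (rule does_Copy does_Clear does_Add | simp)+
    with 2 4 7 have "does (?c r) \<sigma> \<sigma>7" by (blast intro: does_Seq)
    moreover have "\<sigma>2 r = \<sigma> r" using 2 by (simp add: \<sigma>1_def)
    ultimately show "\<exists>\<sigma>'. does (?c r) \<sigma> \<sigma>' \<and> \<sigma>' r = npair (f (\<sigma> r)) (g (\<sigma> r)) \<and>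
        (\<forall>i<r. \<sigma>' i = \<sigma> i)"
      using 2 4 7 by (intro exI[of _ \<sigma>7]) (simp add: \<sigma>1_def \<sigma>3_def \<sigma>5_def \<sigma>6_def)
  qed
qed

text \<open>Iteration is the recursion scheme that is compiled. Addition, subtraction, case
  distinction and folds over coded lists are then iterations, with no further loops on the level of
  commands.\<close>

lemma computable_funpow_nsnd:
  assumes "computable f"
  shows "computable (\<lambda>x. (f ^^ nsnd x) (nfst x))"
proof -
  obtain c where
    c: "\<forall>r \<sigma>. \<exists>\<sigma>'. does (c r) \<sigma> \<sigma>' \<and> \<sigma>' r = f (\<sigma> r) \<and> (\<forall>i<r. \<sigma>' i = \<sigma> i)"
    using computableD[OF assms] by blast
  let ?w = "\<lambda>r. While r (Dec r ;; c (r + 1))"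
  let ?c = "\<lambda>r. Unpair r ;; Add (r + 2) r ;; ?w r ;; Add (r + 1) r"
  show ?thesis
  proof (rule computableI[of ?c])
    fix r and \<sigma> :: "nat \<Rightarrow> nat"
    obtain \<sigma>1 where 1: "does (Unpair r) \<sigma> \<sigma>1" "\<sigma>1 r = 0" "\<sigma>1 (r + 1) = nfst (\<sigma> r)"
      "\<sigma>1 (r + 2) = nsnd (\<sigma> r)" "\<forall>i<r. \<sigma>1 i = \<sigma> i"
      using does_Unpair by blast
    define \<sigma>2 where "\<sigma>2 = \<sigma>1(r + 2 := 0, r := \<sigma>1 r + \<sigma>1 (r + 2))"
    have 2: "does (Add (r + 2) r) \<sigma>1 \<sigma>2" unfolding \<sigma>2_def by (rule does_Add) simp
    \<comment> \<open>The counter is at r, below the base r + 1 at which f is computed, and so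
      survives each round. The invariant says that the rounds still due lead from the current value
      to the goal.\<close>
    let ?I = "\<lambda>\<tau>. (f ^^ \<tau> r) (\<tau> (r + 1)) = (f ^^ nsnd (\<sigma> r)) (nfst (\<sigma> r)) \<and> (\<forall>i<r. \<tau> i = \<sigma> i)"
    have "\<exists>\<tau>'. does (?w r) \<sigma>2 \<tau>' \<and> ?I \<tau>' \<and> \<tau>' r = 0"
    proof (rule does_While)
      show "?I \<sigma>2" using 1 by (simp add: \<sigma>2_def)
    next
      fix \<tau>
      assume I: "?I \<tau>" and nz: "\<tau> r \<noteq> 0"
      define \<tau>1 where "\<tau>1 = \<tau>(r := \<tau> r - 1)"
      have "does (Dec r) \<tau> \<tau>1" unfolding \<tau>1_def by (rule does_Dec)
      moreover obtain \<tau>2 where \<tau>2: "does (c (r + 1)) \<tau>1 \<tau>2" "\<tau>2 (r + 1) = f (\<tau>1 (r + 1))"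
        "\<forall>i<r+1. \<tau>2 i = \<tau>1 i"
        using c by blast
      moreover obtain n where n: "\<tau> r = Suc n" using nz not0_implies_Suc by blast
      have "?I \<tau>2" "\<tau>2 r < \<tau> r"
        using I \<tau>2 n by (auto simp: \<tau>1_def funpow_swap1)
      ultimately show "\<exists>\<tau>'. does (Dec r ;; c (r + 1)) \<tau> \<tau>' \<and> ?I \<tau>' \<and> \<tau>' r < \<tau> r"
        by (blast intro: does_Seq)
    qed
    then obtain \<sigma>3 where 3: "does (?w r) \<sigma>2 \<sigma>3" "?I \<sigma>3" "\<sigma>3 r = 0" by blast
    define \<sigma>4 where "\<sigma>4 = \<sigma>3(r + 1 := 0, r := \<sigma>3 r + \<sigma>3 (r + 1))"
    have "does (Add (r + 1) r) \<sigma>3 \<sigma>4" unfolding \<sigma>4_def by (rule does_Add) simp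
    with 1 2 3 have "does (?c r) \<sigma> \<sigma>4" by (blast intro: does_Seq)
    then show "\<exists>\<sigma>'. does (?c r) \<sigma> \<sigma>' \<and> \<sigma>' r = (f ^^ nsnd (\<sigma> r)) (nfst (\<sigma> r)) \<and>
        (\<forall>i<r. \<sigma>' i = \<sigma> i)"
      using 3 by (intro exI[of _ \<sigma>4]) (simp add: \<sigma>4_def)
  qed
qed

text \<open>The iterated function may depend on x because x rides along unchanged as the first
  component of an iterated pair.\<close>

lemma computable_funpow:
  assumes "computable (\<lambda>p. f (nfst p) (nsnd p))" "computable n" "computable s"
  shows "computable (\<lambda>x. (f x ^^ n x) (s x))"
proof -
  let ?g = "\<lambda>p. npair (nfst p) (f (nfst p) (nsnd p))"
  have *: "(?g ^^ k) (npair x a) = npair x ((f x ^^ k) a)" for k x a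
    by (induction k) simp_all
  have "computable (\<lambda>x. nsnd ((\<lambda>y. (?g ^^ nsnd y) (nfst y)) (npair (npair x (s x)) (n x))))"
    by (intro computable_nsnd computable_comp[OF computable_funpow_nsnd] computable_npair
        computable_nfst computable_id assms)
  then show ?thesis by (simp add: *)
qed

lemma computable_add: "computable a \<Longrightarrow> computable b \<Longrightarrow> computable (\<lambda>x. a x + b x)"
proof -
  have "(Suc ^^ n) m = n + m" for m n by (induction n) simp_all
  then show "computable a \<Longrightarrow> computable b \<Longrightarrow> computable (\<lambda>x. a x + b x)"
    using computable_funpow[of "\<lambda>_. Suc" a b] computable_Suc[OF computable_nsnd[OF computable_id]]
    by simp
qed

lemma computable_diff: "computable a \<Longrightarrow> computable b \<Longrightarrow> computable (\<lambda>x. a x - b x)"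
proof -
  have "((\<lambda>y. y - 1) ^^ n) m = m - n" for m n :: nat by (induction n) simp_all
  then show "computable a \<Longrightarrow> computable b \<Longrightarrow> computable (\<lambda>x. a x - b x)"
    using computable_funpow[of "\<lambda>_ y. y - 1" b a]
      computable_pred[OF computable_nsnd[OF computable_id]]
    by simp
qed

text \<open>A case distinction is the iteration of a constant function: no round keeps the start
  value, and any positive number of rounds yields the constant.\<close>

lemma computable_if_0:
  assumes "computable c" "computable a" "computable b"
  shows "computable (\<lambda>x. if c x = 0 then a x else b x)"
proof -
  have "((\<lambda>_. v) ^^ n) u = (if n = 0 then u else v)" for n and u v :: nat
    by (cases n) simp_all
  moreover have "computable (\<lambda>x. ((\<lambda>_. b x) ^^ c x) (a x))"
    by (intro computable_funpow computable_comp[OF assms(3)] computable_nfst computable_id assms)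
  ultimately show ?thesis by simp
qed

definition decidable :: "(nat \<Rightarrow> bool) \<Rightarrow> bool" where
  "decidable P \<longleftrightarrow> computable (\<lambda>x. of_bool (P x))"

lemma decidable_eq:
  assumes "computable a" "computable b"
  shows "decidable (\<lambda>x. a x = b x)"
proof -
  have "computable (\<lambda>x. if (a x - b x) + (b x - a x) = 0 then 1 else 0)"
    by (intro computable_if_0 computable_add computable_diff computable_const assms)
  moreover have "(\<lambda>x. if (a x - b x) + (b x - a x) = 0 then 1 else 0) = (\<lambda>x. of_bool (a x = b x) :: nat)"
    by (auto simp: fun_eq_iff)
  ultimately show ?thesis
    by (simp only: decidable_def)
qed

lemma computable_if:
  assumes "decidable P" "computable a" "computable b"
  shows "computable (\<lambda>x. if P x then a x else b x)"
proof -
  have "computable (\<lambda>x. if of_bool (P x) = (0 :: nat) then b x else a x)"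
    by (rule computable_if_0) (use assms in \<open>simp_all add: decidable_def\<close>)
  moreover have "(\<lambda>x. if of_bool (P x) = (0 :: nat) then b x else a x) =
      (\<lambda>x. if P x then a x else b x)"
    by auto
  ultimately show ?thesis by simp
qed

lemma decidable_not:
  assumes "decidable P"
  shows "decidable (\<lambda>x. \<not> P x)"
proof -
  have "computable (\<lambda>x. if P x then 0 else 1)"
    by (intro computable_if computable_const assms)
  moreover have "(\<lambda>x. if P x then 0 else 1) = (\<lambda>x. of_bool (\<not> P x) :: nat)" by auto
  ultimately show ?thesis by (simp only: decidable_def)
qed

lemma decidable_conj:
  assumes "decidable P" "decidable Q"
  shows "decidable (\<lambda>x. P x \<and> Q x)"
proof -
  have "computable (\<lambda>x. if P x then of_bool (Q x) else 0)"
    using assms(2) by (intro computable_if computable_const assms(1)) (simp add: decidable_def)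
  moreover have "(\<lambda>x. if P x then of_bool (Q x) else 0) = (\<lambda>x. of_bool (P x \<and> Q x) :: nat)" by auto
  ultimately show ?thesis by (simp only: decidable_def)
qed

section \<open>Coded lists\<close>

definition nhd :: "nat \<Rightarrow> nat" where
  "nhd c = nfst (c - 1)"

definition ntl :: "nat \<Rightarrow> nat" where
  "ntl c = nsnd (c - 1)"

definition ncons :: "nat \<Rightarrow> nat \<Rightarrow> nat" where
  "ncons a c = Suc (npair a c)"

lemma nhd_0 [simp]: "nhd 0 = 0" and ntl_0 [simp]: "ntl 0 = 0"
  by (simp_all add: nhd_def ntl_def)

lemma nhd_ncons [simp]: "nhd (ncons a c) = a" and ntl_ncons [simp]: "ntl (ncons a c) = c"
  by (simp_all add: nhd_def ntl_def ncons_def)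

lemma ncons_neq_0 [simp]: "ncons a c \<noteq> 0"
  by (simp add: ncons_def)

lemma ncons_collapse: "c \<noteq> 0 \<Longrightarrow> ncons (nhd c) (ntl c) = c"
  by (simp add: nhd_def ntl_def ncons_def)

lemma ntl_less: "c \<noteq> 0 \<Longrightarrow> ntl c < c"
  unfolding ntl_def using nsnd_le[of "c - 1"] by simp

lemma list_decode_0 [simp]: "list_decode 0 = []"
  and list_decode_ncons [simp]: "list_decode (ncons a c) = a # list_decode c"
  by (simp_all add: ncons_def)

lemma list_decode_nonzero: "c \<noteq> 0 \<Longrightarrow> list_decode c = nhd c # list_decode (ntl c)"
  by (metis ncons_collapse list_decode_ncons)

lemma computable_nhd: "computable g \<Longrightarrow> computable (\<lambda>x. nhd (g x))"
  and computable_ntl: "computable g \<Longrightarrow> computable (\<lambda>x. ntl (g x))"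
  and computable_ncons: "computable g \<Longrightarrow> computable h \<Longrightarrow> computable (\<lambda>x. ncons (g x) (h x))"
  unfolding nhd_def ntl_def ncons_def
  by (intro computable_nfst computable_nsnd computable_pred computable_Suc computable_npair; simp)+

lemmas computable_intros = computable_id computable_const computable_Suc computable_pred
  computable_npair computable_nfst computable_nsnd computable_nhd computable_ntl computable_ncons
  computable_add computable_diff computable_if decidable_eq decidable_not decidable_conj

text \<open>The code of a list bounds its length, since \<open>ntl\<close> decreases every nonzero
  code. So the code itself serves as the number of rounds, and the rounds left over find code 0 and
  change nothing.\<close>

lemma computable_fold:
  assumes "computable (\<lambda>p. g (nfst p) (nfst (nsnd p)) (nsnd (nsnd p)))" "computable l" "computable s"
  shows "computable (\<lambda>x. fold (g x) (list_decode (l x)) (s x))"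
proof -
  let ?f = "\<lambda>x p. if nfst p = 0 then p else npair (ntl (nfst p)) (g x (nhd (nfst p)) (nsnd p))"
  have *: "c \<le> n \<Longrightarrow> (?f x ^^ n) (npair c a) = npair 0 (fold (g x) (list_decode c) a)" for x n c a
  proof (induction n arbitrary: c a)
    case 0
    then show ?case by simp
  next
    case (Suc n)
    show ?case
    proof (cases "c = 0")
      case True
      then show ?thesis using Suc.IH[of 0 a] by (simp del: funpow.simps add: funpow_Suc_right)
    next
      case False
      with ntl_less[of c] Suc.prems have "ntl c \<le> n" by simp
      from Suc.IH[OF this] False show ?thesis
        by (simp del: funpow.simps add: funpow_Suc_right list_decode_nonzero)
    qed
  qed
  have "computable (\<lambda>p. g (nfst p) (nhd (nfst (nsnd p))) (nsnd (nsnd p)))"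
    using computable_comp[OF assms(1),
      of "\<lambda>p. npair (nfst p) (npair (nhd (nfst (nsnd p))) (nsnd (nsnd p)))"]
    by (simp add: computable_intros)
  then have "computable (\<lambda>x. nsnd ((?f x ^^ l x) (npair (l x) (s x))))"
    by (intro computable_funpow computable_intros assms)
  then show ?thesis by (simp add: *)
qed

section \<open>Simulation of one step on coded configurations\<close>

lemma computable_comp2:
  assumes "computable (\<lambda>p. f (nfst p) (nsnd p))" "computable a" "computable b"
  shows "computable (\<lambda>x. f (a x) (b x))"
  using computable_comp[OF assms(1) computable_npair[OF assms(2,3)]] by simp

lemma list_decode_ntl_funpow: "list_decode ((ntl ^^ i) c) = drop i (list_decode c)"
proof (induction i)
  case (Suc i)
  have "list_decode (ntl d) = tl (list_decode d)" for d
    by (cases "d = 0") (simp_all add: list_decode_nonzero)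
  with Suc show ?case by (simp add: drop_Suc tl_drop)
qed simp

lemma ntl_funpow_eq_0: "(ntl ^^ i) c = 0 \<longleftrightarrow> length (list_decode c) \<le> i"
  by (metis drop_eq_Nil list_decode_0 list_decode_ntl_funpow list_decode_nonzero list.distinct(1))

definition field :: "nat \<Rightarrow> nat \<Rightarrow> nat" where
  "field i c = nhd ((ntl ^^ i) c)"

lemma field_nth: "i < length (list_decode c) \<Longrightarrow> field i c = list_decode c ! i"
  unfolding field_def
  by (metis drop_eq_Nil hd_drop_conv_nth list.sel(1) list_decode_0 list_decode_nonzero
      list_decode_ntl_funpow not_le)

text \<open>By \<open>ntl_funpow_eq_0\<close> this means more than six and at most seven entries. It
  replaces the list pattern in \<open>instr_of\<close> by a condition that the closure rules can
  decide.\<close>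

definition is_instr_code :: "nat \<Rightarrow> bool" where
  "is_instr_code c \<longleftrightarrow> (ntl ^^ 6) c \<noteq> 0 \<and> (ntl ^^ 7) c = 0"

definition decoded_instr :: "nat \<Rightarrow> instr" where
  "decoded_instr c =
     (if field 0 c = 0
      then Act (field 1 c) (field 2 c) (field 3 c) (field 4 c) (dir_of (field 5 c)) (field 6 c)
      else if field 0 c = 1 then Oracle (field 1 c) (field 2 c) (field 6 c)
      else Query (field 1 c) (field 2 c) (field 3 c) (field 4 c) (field 6 c))"

lemma instr_of_eq: "instr_of c = (if is_instr_code c then Some (decoded_instr c) else None)"
proof -
  have len: "is_instr_code c \<longleftrightarrow> length (list_decode c) = 7"
    unfolding is_instr_code_def ntl_funpow_eq_0 by auto
  show ?thesis
  proof (cases "is_instr_code c")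
    case True
    with len have 7: "length (list_decode c) = 7" by simp
    then obtain a0 a1 a2 a3 a4 a5 a6 where "list_decode c = [a0, a1, a2, a3, a4, a5, a6]"
      by (auto simp: length_Suc_conv eval_nat_numeral)
    with True show ?thesis
      by (simp add: instr_of_def decoded_instr_def field_nth)
  next
    case False
    with len have "length (list_decode c) \<noteq> 7" by simp
    then have "instr_of c = None"
      unfolding instr_of_def by (auto split: list.split)
    with False show ?thesis by simp
  qed
qed

section \<open>Coded tapes and configurations\<close>

definition tape_decode :: "nat \<Rightarrow> tape" where
  "tape_decode c = (list_decode (nfst c), list_decode (nsnd c))"

definition nscanned :: "nat \<Rightarrow> nat" where
  "nscanned c = nhd (nsnd c)"

definition nwrite :: "nat \<Rightarrow> nat \<Rightarrow> nat" where
  "nwrite s c = npair (nfst c) (ncons s (ntl (nsnd c)))"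

text \<open>The defaults \<open>nhd 0 = 0\<close> and \<open>ntl 0 = 0\<close> supply the blank
  symbol beyond the written cells, so the two ends of the tape need no cases of their own.\<close>

definition nmove :: "nat \<Rightarrow> nat \<Rightarrow> nat" where
  "nmove d c =
     (if d = 0 then npair (ntl (nfst c)) (ncons (nhd (nfst c)) (nsnd c))
      else if d = 1 then npair (ncons (nhd (nsnd c)) (nfst c)) (ntl (nsnd c))
      else c)"

definition ncount :: "nat \<Rightarrow> nat" where
  "ncount l = fold (\<lambda>a n. if a = 1 then Suc n else n) (list_decode l) 0"

definition nnum :: "nat \<Rightarrow> nat" where
  "nnum c = ncount (nfst c) + ncount (nsnd c)"

definition nunary :: "nat \<Rightarrow> nat" where
  "nunary n = npair 0 ((ncons 1 ^^ n) 0)"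

lemma scanned_tape_decode: "scanned (tape_decode c) = nscanned c"
  by (cases "nsnd c = 0")
    (simp_all add: scanned_def tape_decode_def nscanned_def list_decode_nonzero)

lemma write_sym_tape_decode: "write_sym s (tape_decode c) = tape_decode (nwrite s c)"
  by (cases "nsnd c = 0")
    (simp_all add: write_sym_def tape_decode_def nwrite_def list_decode_nonzero)

lemma move_head_tape_decode: "move_head (dir_of d) (tape_decode c) = tape_decode (nmove d c)"
  by (cases "nfst c = 0"; cases "nsnd c = 0")
    (simp_all add: dir_of_def tape_decode_def nmove_def list_decode_nonzero)

lemma num_of_tape_decode: "num_of (tape_decode c) = nnum c"
proof -
  have "fold (\<lambda>a n. if a = 1 then Suc n else n) xs k = k + count_list xs (1::nat)" for xs k
    by (induction xs arbitrary: k) auto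
  then show ?thesis by (simp add: num_of_def tape_decode_def nnum_def ncount_def)
qed

lemma tape_of_eq: "tape_of n = tape_decode (nunary n)"
proof -
  have "list_decode ((ncons 1 ^^ n) 0) = replicate n 1" by (induction n) simp_all
  then show ?thesis by (simp add: tape_of_def tape_decode_def nunary_def)
qed

text \<open>The tapes form an association list in which newer entries shadow older ones, so an
  update is one \<open>ncons\<close>. The accumulator holds one more than the value found, with 0
  for nothing found yet; the final subtraction sends a missing entry to 0, which decodes to the
  blank tape.\<close>

definition nlookup :: "nat \<Rightarrow> nat \<Rightarrow> nat" where
  "nlookup st t =
     fold (\<lambda>a s. if s = 0 \<and> nfst a = t then Suc (nsnd a) else s) (list_decode st) 0 - 1"

lemma nlookup_0 [simp]: "nlookup 0 t = 0"
  by (simp add: nlookup_def)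

lemma nlookup_ncons [simp]:
  "nlookup (ncons (npair t v) st) t' = (if t' = t then v else nlookup st t')"
proof -
  have "fold (\<lambda>a s. if s = 0 \<and> nfst a = t then Suc (nsnd a) else s) xs (Suc v) = Suc v" for xs
    by (induction xs) simp_all
  then show ?thesis by (auto simp: nlookup_def)
qed

definition config_decode :: "nat \<Rightarrow> config" where
  "config_decode s = (nfst s, \<lambda>t. tape_decode (nlookup (nsnd s) t))"

lemma config_decode_upd:
  "config_decode (npair q (ncons (npair t v) st)) =
     (q, (\<lambda>t'. tape_decode (nlookup st t'))(t := tape_decode v))"
  by (auto simp: config_decode_def fun_eq_iff)

definition ninit :: "nat \<Rightarrow> nat" where
  "ninit m = npair 0 (ncons (npair 0 (nunary m)) 0)"

lemma config_decode_ninit: "config_decode (ninit m) = init_config m"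
proof -
  have "tape_decode 0 = tape_of 0" by (simp add: tape_decode_def tape_of_def)
  then show ?thesis
    by (auto simp: config_decode_def ninit_def init_config_def fun_eq_iff tape_of_eq[of m])
qed

definition napplicable :: "nat \<Rightarrow> nat \<Rightarrow> bool" where
  "napplicable c s \<longleftrightarrow> is_instr_code c \<and> field 1 c = nfst s \<and>
     \<not> (field 0 c = 0 \<and> nscanned (nlookup (nsnd s) (field 2 c)) \<noteq> field 3 c)"

lemma applicable_config_decode:
  "is_instr_code c \<Longrightarrow> applicable (config_decode s) (decoded_instr c) \<longleftrightarrow> napplicable c s"
  by (auto simp: config_decode_def decoded_instr_def napplicable_def scanned_tape_decode)

text \<open>One more than the code of the instruction to be executed, or 0 if there is none.\<close>

definition ncurrent :: "nat \<Rightarrow> nat \<Rightarrow> nat" where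
  "ncurrent e s =
     fold (\<lambda>c r. if r = 0 \<and> napplicable c s then Suc c else r) (list_decode e) 0"

lemma next_instr_config_decode:
  "next_instr (program_of e) (config_decode s) =
     (if ncurrent e s = 0 then None else Some (decoded_instr (ncurrent e s - 1)))"
proof -
  let ?f = "fold (\<lambda>c r. if r = 0 \<and> napplicable c s then Suc c else r)"
  have Suc: "?f cs (Suc c) = Suc c" for cs c
    by (induction cs) simp_all
  have "find (applicable (config_decode s)) (List.map_filter instr_of cs) =
      (if ?f cs 0 = 0 then None else Some (decoded_instr (?f cs 0 - 1)))" for cs
  proof (induction cs)
    case (Cons c cs)
    moreover have "napplicable c s \<Longrightarrow> is_instr_code c" by (simp add: napplicable_def)
    ultimately show ?case
      using applicable_config_decode[of c s]
      by (cases "is_instr_code c") (auto simp: List.map_filter_simps instr_of_eq Suc)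
  qed (simp add: List.map_filter_simps)
  then show ?thesis by (simp add: next_instr_def program_of_def ncurrent_def)
qed

text \<open>Every kind of instruction changes exactly one tape and continues in the state of
  \<open>field 6\<close>, so a step is one new association. The oracle value x and the query answer
  a are parameters because the simulator has to obtain them by its own \<open>Orc\<close> and
  \<open>Qry\<close>.\<close>

definition nexec :: "nat \<Rightarrow> nat \<Rightarrow> nat \<Rightarrow> nat \<Rightarrow> nat" where
  "nexec c x a s =
     (let st = nsnd s in npair (field 6 c) (ncons
       (if field 0 c = 0
        then npair (field 2 c) (nmove (field 5 c) (nwrite (field 4 c) (nlookup st (field 2 c))))
        else if field 0 c = 1 then npair (field 2 c) (nunary x)
        else npair (field 4 c) (nunary a)) st))"

text \<open>The answer a has to be right only if the instruction is a query; at other instructions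
  the register that supplies it may hold any value.\<close>

lemma exec_config_decode:
  assumes "x = X (nnum (nlookup (nsnd s) (field 2 c)))"
    and "\<And>e m. queried (decoded_instr c) (config_decode s) = Some (e, m) \<Longrightarrow> a = A e m"
  shows "exec X A (decoded_instr c) (config_decode s) = config_decode (nexec c x a s)"
proof -
  have d: "config_decode s = (nfst s, \<lambda>t. tape_decode (nlookup (nsnd s) t))"
    by (rule config_decode_def)
  show ?thesis
    using assms unfolding nexec_def Let_def
    by (auto simp: d decoded_instr_def config_decode_upd write_sym_tape_decode
        move_head_tape_decode num_of_tape_decode tape_of_eq)
qed

lemma queried_config_decode:
  "queried (decoded_instr c) (config_decode s) =
     (if field 0 c \<noteq> 0 \<and> field 0 c \<noteq> 1
      then Some (nnum (nlookup (nsnd s) (field 2 c)), nnum (nlookup (nsnd s) (field 3 c)))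
      else None)"
  by (simp add: decoded_instr_def config_decode_def num_of_tape_decode)

section \<open>Computability of the coded operations\<close>

lemma computable_field: "computable g \<Longrightarrow> computable (\<lambda>x. field i (g x))"
proof -
  assume g: "computable g"
  have "computable (\<lambda>x. (ntl ^^ i) (g x))"
    by (induction i) (simp_all add: g computable_ntl)
  then show ?thesis by (simp add: field_def computable_nhd)
qed

lemma decidable_is_instr_code: "computable g \<Longrightarrow> decidable (\<lambda>x. is_instr_code (g x))"
proof -
  assume g: "computable g"
  have "computable (\<lambda>x. (ntl ^^ i) (g x))" for i
    by (induction i) (simp_all add: g computable_ntl)
  then show ?thesis unfolding is_instr_code_def by (intro computable_intros)
qed

lemma computable_nmove:
  "computable a \<Longrightarrow> computable b \<Longrightarrow> computable (\<lambda>x. nmove (a x) (b x))"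
  unfolding nmove_def by (intro computable_intros)

lemma computable_nwrite:
  "computable a \<Longrightarrow> computable b \<Longrightarrow> computable (\<lambda>x. nwrite (a x) (b x))"
  unfolding nwrite_def by (intro computable_intros)

lemma computable_nscanned: "computable a \<Longrightarrow> computable (\<lambda>x. nscanned (a x))"
  unfolding nscanned_def by (intro computable_intros)

lemma computable_nnum: "computable a \<Longrightarrow> computable (\<lambda>x. nnum (a x))"
  unfolding nnum_def ncount_def by (intro computable_intros computable_fold)

lemma computable_nunary: "computable a \<Longrightarrow> computable (\<lambda>x. nunary (a x))"
  unfolding nunary_def by (intro computable_intros computable_funpow)

lemma computable_nlookup:
  assumes "computable a" "computable b"
  shows "computable (\<lambda>x. nlookup (a x) (b x))"
proof (rule computable_comp2[OF _ assms])
  show "computable (\<lambda>p. nlookup (nfst p) (nsnd p))"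
    unfolding nlookup_def by (intro computable_intros computable_fold)
qed

lemmas computable_tape_intros = computable_intros computable_field decidable_is_instr_code computable_nmove
  computable_nwrite computable_nscanned computable_nnum computable_nunary computable_nlookup

lemma computable_ncurrent:
  assumes "computable a" "computable b"
  shows "computable (\<lambda>x. ncurrent (a x) (b x))"
proof (rule computable_comp2[OF _ assms])
  show "computable (\<lambda>p. ncurrent (nfst p) (nsnd p))"
    unfolding ncurrent_def napplicable_def by (intro computable_tape_intros computable_fold)
qed

lemma computable_nexec:
  "computable c \<Longrightarrow> computable x \<Longrightarrow> computable a \<Longrightarrow> computable s \<Longrightarrow>
    computable (\<lambda>y. nexec (c y) (x y) (a y) (s y))"
  unfolding nexec_def Let_def by (intro computable_tape_intros)

lemma computable_ninit: "computable a \<Longrightarrow> computable (\<lambda>x. ninit (a x))"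
  unfolding ninit_def by (intro computable_tape_intros)

lemma runs_does: "does c \<sigma> \<sigma>' \<Longrightarrow> runs X A c \<sigma> {} \<sigma>'"
  by (simp add: does_def)

lemma runs_Seq_quiet:
  "does c \<sigma> \<sigma>' \<Longrightarrow> runs X A d \<sigma>' Q \<sigma>'' \<Longrightarrow> runs X A (c ;; d) \<sigma> Q \<sigma>''"
  using runs.Seq[OF runs_does] by fastforce

text \<open>The first component u is the index that receives the queries of the simulated program.\<close>

abbreviation sim :: "nat \<Rightarrow> nat \<Rightarrow> nat \<Rightarrow> nat" where
  "sim u e s \<equiv> npair u (npair e s)"

lemma simulate_step:
  "\<exists>c. \<forall>r X A \<sigma> u e s. \<sigma> r = sim u e s \<longrightarrow>
     (\<exists>\<sigma>' s'. runs X A (c r) \<sigma>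
        ((\<lambda>(e', m'). (u, sim u e' m')) ` qset (program_of e) (config_decode s)) \<sigma>' \<and>
      \<sigma>' r = sim u e s' \<and>
      config_decode s' =
        step X (\<lambda>e' m'. A u (sim u e' m')) (program_of e) (config_decode s) \<and>
      (\<forall>i<r. \<sigma>' i = \<sigma> i))"
proof -
  let ?st = "\<lambda>z. nsnd (nsnd (nsnd z))"
  let ?cur = "\<lambda>z. ncurrent (nfst (nsnd z)) (nsnd (nsnd z))"
  let ?num = "\<lambda>i z. nnum (nlookup (?st z) (field i (?cur z - 1)))"
  let ?isq = "\<lambda>z. of_bool (?cur z \<noteq> 0 \<and> field 0 (?cur z - 1) \<noteq> 0 \<and> field 0 (?cur z - 1) \<noteq> 1) :: nat"
  let ?arg = "\<lambda>z. sim (nfst z) (?num 2 z) (?num 3 z)"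
  \<comment> \<open>A halted configuration is kept, as \<open>step\<close> does; this lets the
    clocked simulation run past the halting time.\<close>
  let ?next = "\<lambda>y. if ?cur (nfst y) = 0 then nfst y
    else sim (nfst (nfst y)) (nfst (nsnd (nfst y)))
      (nexec (?cur (nfst y) - 1) (nfst (nsnd y)) (nsnd (nsnd y)) (nsnd (nsnd (nfst y))))"
  have cur: "computable g \<Longrightarrow> computable (\<lambda>y. ?cur (g y))" for g
    by (intro computable_ncurrent computable_intros)
  have num: "computable (?num i)" for i
    by (intro cur computable_tape_intros)
  have "decidable (\<lambda>z. ?cur z \<noteq> 0 \<and> field 0 (?cur z - 1) \<noteq> 0 \<and> field 0 (?cur z - 1) \<noteq> 1)"
    by (intro cur computable_tape_intros)
  then have isq: "computable ?isq" by (simp only: decidable_def)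
  have arg: "computable ?arg" by (intro num computable_intros)
  have "next": "computable ?next" by (intro cur computable_nexec computable_intros)
  obtain cnum where
    cnum: "\<forall>r \<sigma>. \<exists>\<sigma>'. does (cnum r) \<sigma> \<sigma>' \<and> \<sigma>' r = ?num 2 (\<sigma> r) \<and> (\<forall>i<r. \<sigma>' i = \<sigma> i)"
    using computableD[OF num] by blast
  obtain cisq where
    cisq: "\<forall>r \<sigma>. \<exists>\<sigma>'. does (cisq r) \<sigma> \<sigma>' \<and> \<sigma>' r = ?isq (\<sigma> r) \<and> (\<forall>i<r. \<sigma>' i = \<sigma> i)"
    using computableD[OF isq] by blast
  obtain carg where
    carg: "\<forall>r \<sigma>. \<exists>\<sigma>'. does (carg r) \<sigma> \<sigma>' \<and> \<sigma>' r = ?arg (\<sigma> r) \<and> (\<forall>i<r. \<sigma>' i = \<sigma> i)"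
    using computableD[OF arg] by blast
  obtain cnext where
    cnext: "\<forall>r \<sigma>. \<exists>\<sigma>'. does (cnext r) \<sigma> \<sigma>' \<and> \<sigma>' r = ?next (\<sigma> r) \<and> (\<forall>i<r. \<sigma>' i = \<sigma> i)"
    using computableD[OF "next"] by blast
  obtain cu where
    cu: "\<forall>r \<sigma>. \<exists>\<sigma>'. does (cu r) \<sigma> \<sigma>' \<and> \<sigma>' r = nfst (\<sigma> r) \<and> (\<forall>i<r. \<sigma>' i = \<sigma> i)"
    using computableD[OF computable_nfst[OF computable_id]] by blast
  let ?q = "\<lambda>r. Dec (r + 3) ;; Copy r (r + 4) ;; cu (r + 4) ;; Copy r (r + 5) ;; carg (r + 5) ;;
    Qry (r + 4) (r + 5) (r + 2)"
  \<comment> \<open>The oracle value is fetched into r + 1 in every step, which is harmless since X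
    is total. The query is guarded by the flag at r + 3; its loop decrements the flag from 1 to 0
    and so acts as a conditional. Its answer goes to r + 2, and the two pairings collect state,
    oracle value and answer as the argument of \<open>?next\<close>.\<close>
  let ?c = "\<lambda>r. Copy r (r + 1) ;; cnum (r + 1) ;; Orc (r + 1) ;; Copy r (r + 3) ;; cisq (r + 3) ;;
    While (r + 3) (?q r) ;; Pair_up (r + 1) ;; Pair_up r ;; cnext r"
  show ?thesis
  proof (intro exI[of _ ?c] allI impI)
    fix r X and A :: "nat \<Rightarrow> nat \<Rightarrow> nat" and \<sigma> :: "nat \<Rightarrow> nat" and u e s
    assume z: "\<sigma> r = sim u e s"
    define A' where "A' = (\<lambda>e' m'. A u (sim u e' m'))"
    define k where "k = ncurrent e s"
    define Q where "Q = (\<lambda>(e', m'). (u, sim u e' m')) ` qset (program_of e) (config_decode s)"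
    \<comment> \<open>\<open>field 2\<close> names the tape of an oracle instruction and also the
      index tape of a query, so the same number is the oracle argument in one case and e' in the
      other.\<close>
    define x where "x = nnum (nlookup (nsnd s) (field 2 (k - 1)))"
    define \<sigma>1 where "\<sigma>1 = \<sigma>(r + 1 := \<sigma> r, Suc (r + 1) := 0)"
    have 1: "does (Copy r (r + 1)) \<sigma> \<sigma>1"
      unfolding \<sigma>1_def by (rule does_Copy) simp
    obtain \<sigma>2 where 2: "does (cnum (r + 1)) \<sigma>1 \<sigma>2" "\<sigma>2 (r + 1) = ?num 2 (\<sigma>1 (r + 1))"
      "\<forall>i<r+1. \<sigma>2 i = \<sigma>1 i"
      using cnum by blast
    define \<sigma>3 where "\<sigma>3 = \<sigma>2(r + 1 := X (\<sigma>2 (r + 1)))"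
    define \<sigma>4 where "\<sigma>4 = \<sigma>3(r + 3 := \<sigma>3 r, Suc (r + 3) := 0)"
    have 3: "runs X A (Orc (r + 1)) \<sigma>2 {} \<sigma>3"
      unfolding \<sigma>3_def by (rule runs.Orc)
    have 4: "does (Copy r (r + 3)) \<sigma>3 \<sigma>4"
      unfolding \<sigma>4_def by (rule does_Copy) simp
    obtain \<sigma>5 where 5: "does (cisq (r + 3)) \<sigma>4 \<sigma>5" "\<sigma>5 (r + 3) = ?isq (\<sigma>4 (r + 3))"
      "\<forall>i<r+3. \<sigma>5 i = \<sigma>4 i"
      using cisq by blast
    have s5: "\<sigma>5 r = sim u e s" "\<sigma>5 (r + 1) = X x" "\<forall>i<r. \<sigma>5 i = \<sigma> i"
      "\<sigma>5 (r + 3) = of_bool (k \<noteq> 0 \<and> field 0 (k - 1) \<noteq> 0 \<and> field 0 (k - 1) \<noteq> 1)"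
      using z 2 5 by (simp_all add: \<sigma>1_def \<sigma>3_def \<sigma>4_def x_def k_def)
    have Q: "Q = (if \<sigma>5 (r + 3) = 0 then {}
        else {(u, sim u x (nnum (nlookup (nsnd s) (field 3 (k - 1)))))})"
      unfolding Q_def qset_def next_instr_config_decode s5(4) k_def x_def
      by (auto simp: queried_config_decode)
    have "\<exists>\<sigma>6. runs X A (While (r + 3) (?q r)) \<sigma>5 Q \<sigma>6 \<and> (\<forall>i\<le>r+1. \<sigma>6 i = \<sigma>5 i) \<and>
        (k \<noteq> 0 \<longrightarrow> (\<forall>e' m'. queried (decoded_instr (k - 1)) (config_decode s) = Some (e', m') \<longrightarrow>
          \<sigma>6 (r + 2) = A' e' m'))"
    proof (cases "\<sigma>5 (r + 3) = 0")
      case True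
      then have "runs X A (While (r + 3) (?q r)) \<sigma>5 Q \<sigma>5"
        by (simp add: Q runs.While_exit)
      with True s5(4) show ?thesis by (auto simp: queried_config_decode)
    next
      case False
      then have one: "\<sigma>5 (r + 3) = 1" using s5(4) by simp
      define \<tau>1 where "\<tau>1 = \<sigma>5(r + 3 := \<sigma>5 (r + 3) - 1)"
      define \<tau>2 where "\<tau>2 = \<tau>1(r + 4 := \<tau>1 r, Suc (r + 4) := 0)"
      have t1: "does (Dec (r + 3)) \<sigma>5 \<tau>1" unfolding \<tau>1_def by (rule does_Dec)
      have t2: "does (Copy r (r + 4)) \<tau>1 \<tau>2" unfolding \<tau>2_def by (rule does_Copy) simp
      obtain \<tau>3 where t3: "does (cu (r + 4)) \<tau>2 \<tau>3" "\<tau>3 (r + 4) = nfst (\<tau>2 (r + 4))"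
        "\<forall>i<r+4. \<tau>3 i = \<tau>2 i"
        using cu by blast
      define \<tau>4 where "\<tau>4 = \<tau>3(r + 5 := \<tau>3 r, Suc (r + 5) := 0)"
      have t4: "does (Copy r (r + 5)) \<tau>3 \<tau>4" unfolding \<tau>4_def by (rule does_Copy) simp
      obtain \<tau>5 where t5: "does (carg (r + 5)) \<tau>4 \<tau>5" "\<tau>5 (r + 5) = ?arg (\<tau>4 (r + 5))"
        "\<forall>i<r+5. \<tau>5 i = \<tau>4 i"
        using carg by blast
      have s: "\<tau>5 (r + 4) = u" "\<tau>5 (r + 3) = 0" "\<forall>i\<le>r+1. \<tau>5 i = \<sigma>5 i"
        "\<tau>5 (r + 5) = sim u x (nnum (nlookup (nsnd s) (field 3 (k - 1))))"
        using s5(1) one t3 t5 by (simp_all add: \<tau>1_def \<tau>2_def \<tau>4_def k_def x_def)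
      define \<tau>6 where "\<tau>6 = \<tau>5(r + 2 := A (\<tau>5 (r + 4)) (\<tau>5 (r + 5)))"
      have t6: "runs X A (Qry (r + 4) (r + 5) (r + 2)) \<tau>5 Q \<tau>6"
        using runs.Qry[of X A "r + 4" "r + 5" "r + 2" \<tau>5] False s by (simp add: Q \<tau>6_def)
      have "runs X A (?q r) \<sigma>5 Q \<tau>6"
        by (rule runs_Seq_quiet t1 t2 t3(1) t4 t5(1) t6)+
      moreover have "runs X A (While (r + 3) (?q r)) \<tau>6 {} \<tau>6"
        using s(2) by (intro runs.While_exit) (simp add: \<tau>6_def)
      ultimately have "runs X A (While (r + 3) (?q r)) \<sigma>5 (Q \<union> {}) \<tau>6"
        using False by (blast intro: runs.While_iter)
      moreover have "\<forall>i\<le>r+1. \<tau>6 i = \<sigma>5 i" using s(3) by (simp add: \<tau>6_def)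
      moreover have "\<tau>6 (r + 2) = A' x (nnum (nlookup (nsnd s) (field 3 (k - 1))))"
        using s by (simp add: \<tau>6_def A'_def)
      ultimately show ?thesis
        by (auto simp: queried_config_decode x_def split: if_splits)
    qed
    then obtain \<sigma>6 where 6: "runs X A (While (r + 3) (?q r)) \<sigma>5 Q \<sigma>6" "\<forall>i\<le>r+1. \<sigma>6 i = \<sigma>5 i"
      "k \<noteq> 0 \<Longrightarrow> queried (decoded_instr (k - 1)) (config_decode s) = Some (e', m') \<Longrightarrow>
          \<sigma>6 (r + 2) = A' e' m'" for e' m'
      by blast
    obtain \<sigma>7 where 7: "does (Pair_up (r + 1)) \<sigma>6 \<sigma>7"
      "\<sigma>7 (r + 1) = npair (\<sigma>6 (r + 1)) (\<sigma>6 (r + 1 + 1))" "\<forall>i<r+1. \<sigma>7 i = \<sigma>6 i"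
      using does_Pair_up by blast
    obtain \<sigma>8 where 8: "does (Pair_up r) \<sigma>7 \<sigma>8"
      "\<sigma>8 r = npair (\<sigma>7 r) (\<sigma>7 (r + 1))" "\<forall>i<r. \<sigma>8 i = \<sigma>7 i"
      using does_Pair_up by blast
    obtain \<sigma>9 where 9: "does (cnext r) \<sigma>8 \<sigma>9" "\<sigma>9 r = ?next (\<sigma>8 r)" "\<forall>i<r. \<sigma>9 i = \<sigma>8 i"
      using cnext by blast
    have "runs X A (Pair_up (r + 1) ;; Pair_up r ;; cnext r) \<sigma>6 {} \<sigma>9"
      using 7(1) 8(1) 9(1) by (blast intro: runs_does does_Seq)
    from runs.Seq[OF 6(1) this]
    have "runs X A (While (r + 3) (?q r) ;; Pair_up (r + 1) ;; Pair_up r ;; cnext r) \<sigma>5 Q \<sigma>9"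
      by simp
    from runs.Seq[OF 3 runs_Seq_quiet[OF 4 runs_Seq_quiet[OF 5(1) this]]]
    have "runs X A (?c r) \<sigma> Q \<sigma>9"
      using 1 2(1) by (simp add: runs_Seq_quiet)
    moreover define s' where "s' = (if k = 0 then s else nexec (k - 1) (X x) (\<sigma>6 (r + 2)) s)"
    have "\<sigma>9 r = sim u e s'"
      using 6(2) 7 8 9(2) s5 by (simp add: s'_def k_def)
    moreover have "config_decode s' = step X A' (program_of e) (config_decode s)"
    proof (cases "k = 0")
      case False
      with exec_config_decode[of "X x" X s "k - 1" "\<sigma>6 (r + 2)" A'] 6(3)[OF False] show ?thesis
        by (simp add: step_def next_instr_config_decode s'_def k_def[symmetric] x_def)
    qed (simp add: step_def next_instr_config_decode s'_def k_def)
    moreover have "\<forall>i<r. \<sigma>9 i = \<sigma> i" using s5 6 7 8 9 by simp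
    ultimately show "\<exists>\<sigma>' s'. runs X A (?c r) \<sigma>
        ((\<lambda>(e', m'). (u, sim u e' m')) ` qset (program_of e) (config_decode s)) \<sigma>' \<and>
      \<sigma>' r = sim u e s' \<and>
      config_decode s' = step X (\<lambda>e' m'. A u (sim u e' m')) (program_of e) (config_decode s) \<and>
      (\<forall>i<r. \<sigma>' i = \<sigma> i)"
      unfolding Q_def A'_def by blast
  qed
qed

section \<open>Clocked and unclocked simulation\<close>

definition redirect :: "nat \<Rightarrow> nat \<times> nat \<Rightarrow> nat \<times> nat" where
  "redirect u = (\<lambda>(e, m). (u, sim u e m))"

text \<open>The answer function that the simulated program experiences when its queries are passed
  on in redirected form and A answers them.\<close>

definition redirected :: "nat \<Rightarrow> (nat \<Rightarrow> nat \<Rightarrow> nat) \<Rightarrow> nat \<Rightarrow> nat \<Rightarrow> nat" where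
  "redirected u A = (\<lambda>e m. A u (sim u e m))"

definition halted_at :: "(nat \<Rightarrow> nat) \<Rightarrow> (nat \<Rightarrow> nat \<Rightarrow> nat) \<Rightarrow> program \<Rightarrow> nat \<Rightarrow> nat \<Rightarrow> bool" where
  "halted_at X A P m t \<longleftrightarrow> next_instr P (config_at X A P m t) = None"

definition queries_before ::
    "(nat \<Rightarrow> nat) \<Rightarrow> (nat \<Rightarrow> nat \<Rightarrow> nat) \<Rightarrow> program \<Rightarrow> nat \<Rightarrow> nat \<Rightarrow> (nat \<times> nat) set" where
  "queries_before X A P m k = (\<Union>t<k. qset P (config_at X A P m t))"

lemma queries_eq: "queries X A P m = (\<Union>k. queries_before X A P m k)"
  unfolding queries_def queries_before_def qset_def by auto

lemma config_at_Suc: "config_at X A P m (Suc t) = step X A P (config_at X A P m t)"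
  by (simp add: config_at_def)

text \<open>This is \<open>simulate_step\<close> anchored at time t of the genuine run, the form in
  which the simulation loops can repeat it.\<close>

lemma simulation_step:
  obtains c where "\<And>r X A \<sigma> u e m s t. \<sigma> r = sim u e s \<Longrightarrow>
      config_decode s = config_at X (redirected u A) (program_of e) m t \<Longrightarrow>
      \<exists>\<sigma>' s'. runs X A (c r) \<sigma>
          (redirect u ` qset (program_of e) (config_at X (redirected u A) (program_of e) m t)) \<sigma>' \<and>
        \<sigma>' r = sim u e s' \<and>
        config_decode s' = config_at X (redirected u A) (program_of e) m (Suc t) \<and>
        (\<forall>i<r. \<sigma>' i = \<sigma> i)"
proof -
  obtain c where c: "\<forall>r X A \<sigma> u e s. \<sigma> r = sim u e s \<longrightarrow>
     (\<exists>\<sigma>' s'. runs X A (c r) \<sigma>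
        ((\<lambda>(e', m'). (u, sim u e' m')) ` qset (program_of e) (config_decode s)) \<sigma>' \<and>
      \<sigma>' r = sim u e s' \<and>
      config_decode s' =
        step X (\<lambda>e' m'. A u (sim u e' m')) (program_of e) (config_decode s) \<and>
      (\<forall>i<r. \<sigma>' i = \<sigma> i))"
    using simulate_step by blast
  show ?thesis
  proof (rule that[of c])
    fix r X A and \<sigma> :: "nat \<Rightarrow> nat" and u e m s t
    assume "\<sigma> r = sim u e s"
      and s: "config_decode s = config_at X (redirected u A) (program_of e) m t"
    with c show "\<exists>\<sigma>' s'. runs X A (c r) \<sigma>
          (redirect u ` qset (program_of e) (config_at X (redirected u A) (program_of e) m t)) \<sigma>' \<and>
        \<sigma>' r = sim u e s' \<and>
        config_decode s' = config_at X (redirected u A) (program_of e) m (Suc t) \<and>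
        (\<forall>i<r. \<sigma>' i = \<sigma> i)"
      unfolding config_at_Suc redirect_def s[symmetric] by (simp only: redirected_def)
  qed
qed

lemma computable_not_halted:
  "computable (\<lambda>z. of_bool (ncurrent (nfst (nsnd z)) (nsnd (nsnd z)) \<noteq> 0))"
proof -
  have "decidable (\<lambda>z. ncurrent (nfst (nsnd z)) (nsnd (nsnd z)) \<noteq> 0)"
    by (intro computable_ncurrent computable_intros)
  then show ?thesis by (simp only: decidable_def)
qed

text \<open>The clock in register 1 alone controls the loop, so the command terminates whatever e
  does. Steps simulated after halting change nothing and issue no query. The input has the form in
  which an E-query presents its k-th computation, and u is so far an arbitrary number read from
  it.\<close>

lemma bounded_simulation:
  obtains c where "\<And>X A u e m k \<sigma>. \<sigma> 0 = list_encode [sim u e m, k] \<Longrightarrow>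
    \<exists>\<sigma>'. runs X A c \<sigma>
        (redirect u ` queries_before X (redirected u A) (program_of e) m k) \<sigma>' \<and>
      \<sigma>' 0 = of_bool (\<not> halted_at X (redirected u A) (program_of e) m k)"
proof -
  let ?z = "\<lambda>x. sim (nfst (nhd x)) (nfst (nsnd (nhd x))) (ninit (nsnd (nsnd (nhd x))))"
  let ?h = "\<lambda>z. of_bool (ncurrent (nfst (nsnd z)) (nsnd (nsnd z)) \<noteq> 0) :: nat"
  have k: "computable (\<lambda>x. nhd (ntl x))" and z: "computable ?z"
    by (intro computable_ninit computable_intros)+
  obtain ck where
    ck: "\<forall>r \<sigma>. \<exists>\<sigma>'. does (ck r) \<sigma> \<sigma>' \<and> \<sigma>' r = nhd (ntl (\<sigma> r)) \<and> (\<forall>i<r. \<sigma>' i = \<sigma> i)"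
    using computableD[OF k] by blast
  obtain cz where
    cz: "\<forall>r \<sigma>. \<exists>\<sigma>'. does (cz r) \<sigma> \<sigma>' \<and> \<sigma>' r = ?z (\<sigma> r) \<and> (\<forall>i<r. \<sigma>' i = \<sigma> i)"
    using computableD[OF z] by blast
  obtain ch where
    ch: "\<forall>r \<sigma>. \<exists>\<sigma>'. does (ch r) \<sigma> \<sigma>' \<and> \<sigma>' r = ?h (\<sigma> r) \<and> (\<forall>i<r. \<sigma>' i = \<sigma> i)"
    using computableD[OF computable_not_halted] by blast
  obtain b where
    b: "\<And>r X A \<sigma> u e m s t. \<sigma> r = sim u e s \<Longrightarrow>
      config_decode s = config_at X (redirected u A) (program_of e) m t \<Longrightarrow>
      \<exists>\<sigma>' s'. runs X A (b r) \<sigma>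
          (redirect u ` qset (program_of e) (config_at X (redirected u A) (program_of e) m t)) \<sigma>' \<and>
        \<sigma>' r = sim u e s' \<and>
        config_decode s' = config_at X (redirected u A) (program_of e) m (Suc t) \<and>
        (\<forall>i<r. \<sigma>' i = \<sigma> i)"
    using simulation_step by metis
  let ?w = "While 1 (Dec 1 ;; b 2)"
  \<comment> \<open>The starting time i is arbitrary because it moves up by one as the clock j is
    counted down.\<close>
  have loop: "\<exists>\<sigma>' s'. runs X A ?w \<sigma>
      (redirect u ` (\<Union>t\<in>{i..<i+j}. qset (program_of e)
        (config_at X (redirected u A) (program_of e) m t))) \<sigma>' \<and> \<sigma>' 2 = sim u e s' \<and>
      config_decode s' = config_at X (redirected u A) (program_of e) m (i + j)"
    if "\<sigma> 1 = j" "\<sigma> 2 = sim u e s"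
      "config_decode s = config_at X (redirected u A) (program_of e) m i"
    for X A u e m s i j \<sigma>
    using that
  proof (induction j arbitrary: i \<sigma> s)
    case 0
    then show ?case by (intro exI[of _ \<sigma>] exI[of _ s]) (simp add: runs.While_exit)
  next
    case (Suc j)
    let ?q = "\<lambda>t. qset (program_of e) (config_at X (redirected u A) (program_of e) m t)"
    define \<sigma>1 where "\<sigma>1 = \<sigma>(1 := \<sigma> 1 - 1)"
    have 1: "does (Dec 1) \<sigma> \<sigma>1" unfolding \<sigma>1_def by (rule does_Dec)
    have "\<sigma>1 2 = sim u e s" using Suc.prems by (simp add: \<sigma>1_def)
    from b[where \<sigma> = \<sigma>1 and r = 2, OF this Suc.prems(3)] obtain \<sigma>2 s' where 2: "runs X A (b 2) \<sigma>1 (redirect u ` ?q i) \<sigma>2"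
      "\<sigma>2 2 = sim u e s'" "config_decode s' = config_at X (redirected u A) (program_of e) m (Suc i)"
      "\<forall>i<2. \<sigma>2 i = \<sigma>1 i"
      by blast
    have "\<sigma>2 1 = j" using 2(4) Suc.prems by (simp add: \<sigma>1_def)
    from Suc.IH[OF this 2(2,3)] obtain \<sigma>3 s'' where
      3: "runs X A ?w \<sigma>2 (redirect u ` (\<Union>t\<in>{Suc i..<Suc i+j}. ?q t)) \<sigma>3" "\<sigma>3 2 = sim u e s''"
      "config_decode s'' = config_at X (redirected u A) (program_of e) m (Suc i + j)"
      by blast
    have "{i..<i + Suc j} = insert i {Suc i..<Suc i + j}" by auto
    then have "redirect u ` (\<Union>t\<in>{i..<i + Suc j}. ?q t) =
        redirect u ` ?q i \<union> redirect u ` (\<Union>t\<in>{Suc i..<Suc i+j}. ?q t)"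
      by (simp add: image_Un)
    moreover have "\<sigma> 1 \<noteq> 0" using Suc.prems by simp
    ultimately have "runs X A ?w \<sigma> (redirect u ` (\<Union>t\<in>{i..<i + Suc j}. ?q t)) \<sigma>3"
      using runs.While_iter[OF _ runs_Seq_quiet[OF 1 2(1)] 3(1)] by simp
    with 3 show ?case by auto
  qed
  let ?c = "Copy 0 1 ;; ck 1 ;; Copy 0 2 ;; cz 2 ;; ?w ;; ch 2 ;; Clear 0 ;; Add 2 0"
  show ?thesis
  proof (rule that[of ?c])
    fix X A u e m k and \<sigma> :: "nat \<Rightarrow> nat"
    assume "\<sigma> 0 = list_encode [sim u e m, k]"
    then have x: "\<sigma> 0 = ncons (sim u e m) (ncons k 0)" by (simp add: ncons_def)
    define \<sigma>1 where "\<sigma>1 = \<sigma>(1 := \<sigma> 0, Suc 1 := 0)"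
    have 1: "does (Copy 0 1) \<sigma> \<sigma>1" unfolding \<sigma>1_def by (rule does_Copy) simp
    obtain \<sigma>2 where 2: "does (ck 1) \<sigma>1 \<sigma>2" "\<sigma>2 1 = nhd (ntl (\<sigma>1 1))" "\<forall>i<1. \<sigma>2 i = \<sigma>1 i"
      using ck by blast
    define \<sigma>3 where "\<sigma>3 = \<sigma>2(2 := \<sigma>2 0, Suc 2 := 0)"
    have 3: "does (Copy 0 2) \<sigma>2 \<sigma>3" unfolding \<sigma>3_def by (rule does_Copy) simp
    obtain \<sigma>4 where 4: "does (cz 2) \<sigma>3 \<sigma>4" "\<sigma>4 2 = ?z (\<sigma>3 2)" "\<forall>i<2. \<sigma>4 i = \<sigma>3 i"
      using cz by blast
    have "\<sigma>4 1 = k" "\<sigma>4 2 = sim u e (ninit m)"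
      using 2 4 x by (simp_all add: \<sigma>1_def \<sigma>3_def)
    moreover have "config_decode (ninit m) = config_at X (redirected u A) (program_of e) m 0"
      by (simp add: config_decode_ninit config_at_def)
    ultimately obtain \<sigma>5 s where 5: "runs X A ?w \<sigma>4
        (redirect u ` queries_before X (redirected u A) (program_of e) m k) \<sigma>5"
      "\<sigma>5 2 = sim u e s" "config_decode s = config_at X (redirected u A) (program_of e) m k"
      using loop[of \<sigma>4 k u e "ninit m" X A m 0]
      unfolding queries_before_def atLeast0LessThan add_0 by blast
    obtain \<sigma>6 where 6: "does (ch 2) \<sigma>5 \<sigma>6" "\<sigma>6 2 = ?h (\<sigma>5 2)" using ch by blast
    define \<sigma>7 where "\<sigma>7 = \<sigma>6(0 := 0)"
    define \<sigma>8 where "\<sigma>8 = \<sigma>7(2 := 0, 0 := \<sigma>7 0 + \<sigma>7 2)"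
    have "does (Clear 0) \<sigma>6 \<sigma>7" "does (Add 2 0) \<sigma>7 \<sigma>8"
      unfolding \<sigma>7_def \<sigma>8_def by (rule does_Clear does_Add | simp)+
    with 6 have "runs X A (ch 2 ;; Clear 0 ;; Add 2 0) \<sigma>5 {} \<sigma>8"
      by (intro runs_does) (blast intro: does_Seq)
    from runs.Seq[OF 5(1) this] 1 2(1) 3 4(1) have "runs X A ?c \<sigma>
        (redirect u ` queries_before X (redirected u A) (program_of e) m k) \<sigma>8"
      by (simp add: runs_Seq_quiet)
    moreover have "\<sigma>8 0 = of_bool (\<not> halted_at X (redirected u A) (program_of e) m k)"
      using 6(2) 5(2) next_instr_config_decode[of e s] 5(3)
      by (simp add: \<sigma>7_def \<sigma>8_def halted_at_def)
    ultimately show "\<exists>\<sigma>'. runs X A ?c \<sigma>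
        (redirect u ` queries_before X (redirected u A) (program_of e) m k) \<sigma>' \<and>
      \<sigma>' 0 = of_bool (\<not> halted_at X (redirected u A) (program_of e) m k)"
      by blast
  qed
qed

text \<open>The command was built for every u. Only now is u taken to be an index of its
  compilation, and the redirected queries become calls of the program to itself.\<close>

lemma bounded_simulation_program:
  obtains u where
    "\<And>X A e m k n. halts_with X A (program_of u) (list_encode [sim u e m, k]) n \<longleftrightarrow>
       n = of_bool (\<not> halted_at X (redirected u A) (program_of e) m k)"
    "\<And>X A e m k. queries X A (program_of u) (list_encode [sim u e m, k]) =
       redirect u ` queries_before X (redirected u A) (program_of e) m k"
proof -
  obtain c where c: "\<And>X A u e m k \<sigma>. \<sigma> 0 = list_encode [sim u e m, k] \<Longrightarrow>
    \<exists>\<sigma>'. runs X A c \<sigma>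
        (redirect u ` queries_before X (redirected u A) (program_of e) m k) \<sigma>' \<and>
      \<sigma>' 0 = of_bool (\<not> halted_at X (redirected u A) (program_of e) m k)"
    using bounded_simulation by metis
  obtain u where u: "program_of u = compile c 0" using program_of_surj by blast
  have "\<exists>d. steps X A (program_of u) (init_config (list_encode [sim u e m, k]))
        (redirect u ` queries_before X (redirected u A) (program_of e) m k) d \<and>
      next_instr (program_of u) d = None \<and>
      num_of (snd d 0) = of_bool (\<not> halted_at X (redirected u A) (program_of e) m k)"
    for X A e m k
  proof -
    let ?x = "list_encode [sim u e m, k]"
    obtain \<sigma>' where \<sigma>': "runs X A c ((\<lambda>_. 0)(0 := ?x))
        (redirect u ` queries_before X (redirected u A) (program_of e) m k) \<sigma>'"
      "\<sigma>' 0 = of_bool (\<not> halted_at X (redirected u A) (program_of e) m k)"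
      using c[of "(\<lambda>_. 0)(0 := ?x)"] by fastforce
    obtain T' where T': "steps X A (compile c 0) (0, snd (init_config ?x))
        (redirect u ` queries_before X (redirected u A) (program_of e) m k) (0 + len c, T')"
      "represents_all T' \<sigma>'"
      using compile_correct[OF \<sigma>'(1) loaded_compile represents_all_init] by blast
    have "init_config ?x = (0, snd (init_config ?x))" by (simp add: init_config_def)
    moreover have "num_of (T' 0) = \<sigma>' 0"
      using T'(2) by (simp add: represents_all_def represents_num_of)
    ultimately show ?thesis
      using T'(1) \<sigma>'(2) next_instr_compile_exit[of c 0 T'] unfolding u
      by (intro exI[of _ "(0 + len c, T')"]) simp
  qed
  then show ?thesis
    using halts_with_steps by (intro that[of u]) metis+
qed

text \<open>Here u is a constant of the program, since the input holds only m, and e is expected in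
  register 1. The command is cut where the answer to the opening query sits in register 1, in front
  of the \<open>Stall\<close>. What follows is described for answer 0 and halting runs, where
  big-step derivations exist.\<close>

lemma unbounded_simulation:
  "\<exists>c d. \<forall>X A e m \<sigma>. \<sigma> 0 = m \<longrightarrow> \<sigma> 1 = e \<longrightarrow>
     (\<exists>\<sigma>'. runs X A c \<sigma> {(u, sim u e m)} \<sigma>' \<and> \<sigma>' 1 = A u (sim u e m)) \<and>
     (\<forall>n. A u (sim u e m) = 0 \<longrightarrow> halts_with X (redirected u A) (program_of e) m n \<longrightarrow>
       (\<exists>\<sigma>' Q. runs X A (c ;; Stall 1 ;; d) \<sigma> Q \<sigma>' \<and> \<sigma>' 0 = n \<and>
         Q \<subseteq> insert (u, sim u e m)
           (redirect u ` queries X (redirected u A) (program_of e) m)))"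
proof -
  \<comment> \<open>\<open>Pair_up 0\<close> joins the registers in the order m, e, so e is the
    second component here.\<close>
  let ?q = "\<lambda>y. sim u (nsnd y) (nfst y)"
  let ?i = "\<lambda>y. sim u (nsnd y) (ninit (nfst y))"
  let ?h = "\<lambda>z. of_bool (ncurrent (nfst (nsnd z)) (nsnd (nsnd z)) \<noteq> 0) :: nat"
  let ?o = "\<lambda>z. nnum (nlookup (nsnd (nsnd (nsnd z))) 0)"
  have q: "computable ?q" and i: "computable ?i" and o: "computable ?o"
    by (intro computable_ninit computable_tape_intros)+
  obtain cq where
    cq: "\<forall>r \<sigma>. \<exists>\<sigma>'. does (cq r) \<sigma> \<sigma>' \<and> \<sigma>' r = ?q (\<sigma> r) \<and> (\<forall>i<r. \<sigma>' i = \<sigma> i)"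
    using computableD[OF q] by blast
  obtain cu where
    cu: "\<forall>r \<sigma>. \<exists>\<sigma>'. does (cu r) \<sigma> \<sigma>' \<and> \<sigma>' r = u \<and> (\<forall>i<r. \<sigma>' i = \<sigma> i)"
    using computableD[OF computable_const] by blast
  obtain ci where
    ci: "\<forall>r \<sigma>. \<exists>\<sigma>'. does (ci r) \<sigma> \<sigma>' \<and> \<sigma>' r = ?i (\<sigma> r) \<and> (\<forall>i<r. \<sigma>' i = \<sigma> i)"
    using computableD[OF i] by blast
  obtain ch where
    ch: "\<forall>r \<sigma>. \<exists>\<sigma>'. does (ch r) \<sigma> \<sigma>' \<and> \<sigma>' r = ?h (\<sigma> r) \<and> (\<forall>i<r. \<sigma>' i = \<sigma> i)"
    using computableD[OF computable_not_halted] by blast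
  obtain co where
    co: "\<forall>r \<sigma>. \<exists>\<sigma>'. does (co r) \<sigma> \<sigma>' \<and> \<sigma>' r = ?o (\<sigma> r) \<and> (\<forall>i<r. \<sigma>' i = \<sigma> i)"
    using computableD[OF o] by blast
  obtain b where
    b: "\<And>r X A \<sigma> u e m s t. \<sigma> r = sim u e s \<Longrightarrow>
      config_decode s = config_at X (redirected u A) (program_of e) m t \<Longrightarrow>
      \<exists>\<sigma>' s'. runs X A (b r) \<sigma>
          (redirect u ` qset (program_of e) (config_at X (redirected u A) (program_of e) m t)) \<sigma>' \<and>
        \<sigma>' r = sim u e s' \<and>
        config_decode s' = config_at X (redirected u A) (program_of e) m (Suc t) \<and>
        (\<forall>i<r. \<sigma>' i = \<sigma> i)"
    using simulation_step by metis
  have test: "\<exists>\<sigma>'. does (Copy 1 2 ;; ch 2) \<sigma> \<sigma>' \<and> (\<forall>i<2. \<sigma>' i = \<sigma> i) \<and> \<sigma>' 2 = ?h (\<sigma> 1)" for \<sigma>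
  proof -
    define \<sigma>1 where "\<sigma>1 = \<sigma>(2 := \<sigma> 1, Suc 2 := 0)"
    have 1: "does (Copy 1 2) \<sigma> \<sigma>1" unfolding \<sigma>1_def by (rule does_Copy) simp
    obtain \<sigma>2 where 2: "does (ch 2) \<sigma>1 \<sigma>2" "\<sigma>2 2 = ?h (\<sigma>1 2)" "\<forall>i<2. \<sigma>2 i = \<sigma>1 i"
      using ch by blast
    show ?thesis
      using does_Seq[OF 1 2(1)] 2 by (intro exI[of _ \<sigma>2]) (simp add: \<sigma>1_def)
  qed
  let ?w = "While 2 (b 1 ;; Copy 1 2 ;; ch 2)"
  \<comment> \<open>Induction on the distance j to a known halting time. The loop tests for halting
    after every step and may stop at an earlier time t, which is therefore existential.\<close>
  have loop: "\<exists>\<sigma>' s' t. runs X A ?w \<sigma>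
      (redirect u ` (\<Union>t\<in>{i..<t}. qset (program_of e)
        (config_at X (redirected u A) (program_of e) m t))) \<sigma>' \<and> \<sigma>' 1 = sim u e s' \<and>
      config_decode s' = config_at X (redirected u A) (program_of e) m t \<and>
      halted_at X (redirected u A) (program_of e) m t"
    if "\<sigma> 1 = sim u e s" "config_decode s = config_at X (redirected u A) (program_of e) m i"
      "\<sigma> 2 = ?h (\<sigma> 1)" "halted_at X (redirected u A) (program_of e) m (i + j)"
    for X A e m s i j \<sigma>
    using that
  proof (induction j arbitrary: i \<sigma> s)
    case 0
    then have "\<sigma> 2 = 0"
      using next_instr_config_decode[of e s] by (simp add: halted_at_def split: if_splits)
    with 0 show ?case
      by (intro exI[of _ \<sigma>] exI[of _ s] exI[of _ i]) (simp add: runs.While_exit)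
  next
    case (Suc j)
    let ?Q = "\<lambda>t. qset (program_of e) (config_at X (redirected u A) (program_of e) m t)"
    show ?case
    proof (cases "\<sigma> 2 = 0")
      case True
      then have "halted_at X (redirected u A) (program_of e) m i"
        using Suc.prems(1-3) next_instr_config_decode[of e s] by (simp add: halted_at_def)
      with True Suc.prems(1,2) show ?thesis
        by (intro exI[of _ \<sigma>] exI[of _ s] exI[of _ i]) (simp add: runs.While_exit)
    next
      case False
      from b[where \<sigma> = \<sigma> and r = 1, OF Suc.prems(1,2)] obtain \<sigma>1 s' where
        1: "runs X A (b 1) \<sigma> (redirect u ` ?Q i) \<sigma>1" "\<sigma>1 1 = sim u e s'"
        "config_decode s' = config_at X (redirected u A) (program_of e) m (Suc i)"
        by blast
      obtain \<sigma>2 where 2: "does (Copy 1 2 ;; ch 2) \<sigma>1 \<sigma>2" "\<forall>i<2. \<sigma>2 i = \<sigma>1 i"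
        "\<sigma>2 2 = ?h (\<sigma>1 1)"
        using test by blast
      have "\<sigma>2 1 = sim u e s'" "\<sigma>2 2 = ?h (\<sigma>2 1)"
        "halted_at X (redirected u A) (program_of e) m (Suc i + j)"
        using 1(2) 2(2,3) Suc.prems(4) by simp_all
      from Suc.IH[OF this(1) 1(3) this(2,3)] obtain \<sigma>3 s'' t where
        3: "runs X A ?w \<sigma>2 (redirect u ` (\<Union>t\<in>{Suc i..<t}. ?Q t)) \<sigma>3" "\<sigma>3 1 = sim u e s''"
        "config_decode s'' = config_at X (redirected u A) (program_of e) m t"
        "halted_at X (redirected u A) (program_of e) m t"
        by blast
      have not_halted: "\<not> halted_at X (redirected u A) (program_of e) m i"
        using False Suc.prems(1-3) next_instr_config_decode[of e s] by (simp add: halted_at_def)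
      have r: "runs X A ?w \<sigma> (redirect u ` ?Q i \<union> redirect u ` (\<Union>t\<in>{Suc i..<t}. ?Q t)) \<sigma>3"
        using runs.While_iter[of \<sigma> 2, OF False runs.Seq[OF 1(1) runs_does[OF 2(1)]] 3(1)] by simp
      show ?thesis
      proof (cases "i < t")
        case True
        then have "{i..<t} = insert i {Suc i..<t}" by auto
        then have "redirect u ` (\<Union>t\<in>{i..<t}. ?Q t) =
            redirect u ` ?Q i \<union> redirect u ` (\<Union>t\<in>{Suc i..<t}. ?Q t)"
          by (simp add: image_Un)
        with r have "runs X A ?w \<sigma> (redirect u ` (\<Union>t\<in>{i..<t}. ?Q t)) \<sigma>3" by (simp only:)
        with 3 show ?thesis by blast
      next
        case False
        \<comment> \<open>A halting time t at or before i would make the run halted at i as well,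
          contrary to the nonzero flag.\<close>
        with 3(4) config_at_halted[of "program_of e" X "redirected u A" m t "i - t"] not_halted
        show ?thesis by (simp add: halted_at_def)
      qed
    qed
  qed
  let ?c = "Pair_up 0 ;; Copy 0 1 ;; cq 1 ;; Copy 0 2 ;; cu 2 ;; Qry 2 1 1"
  let ?d = "(Copy 0 1 ;; ci 1) ;; (Copy 1 2 ;; ch 2) ;; ?w ;; co 1 ;; Clear 0 ;; Add 1 0"
  have first: "\<exists>\<sigma>'. runs X A ?c \<sigma> {(u, sim u e m)} \<sigma>' \<and> \<sigma>' 0 = npair m e \<and>
      \<sigma>' 1 = A u (sim u e m)"
    if input: "\<sigma> 0 = m" "\<sigma> 1 = e" for X A e m \<sigma>
  proof -
    obtain \<sigma>1 where 1: "does (Pair_up 0) \<sigma> \<sigma>1" "\<sigma>1 0 = npair m e"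
      using does_Pair_up[of 0 \<sigma>] unfolding add_0 input by blast
    define \<sigma>2 where "\<sigma>2 = \<sigma>1(1 := \<sigma>1 0, Suc 1 := 0)"
    have 2: "does (Copy 0 1) \<sigma>1 \<sigma>2" unfolding \<sigma>2_def by (rule does_Copy) simp
    obtain \<sigma>3 where 3: "does (cq 1) \<sigma>2 \<sigma>3" "\<sigma>3 1 = ?q (\<sigma>2 1)" "\<forall>i<1. \<sigma>3 i = \<sigma>2 i"
      using cq by blast
    define \<sigma>4 where "\<sigma>4 = \<sigma>3(2 := \<sigma>3 0, Suc 2 := 0)"
    have 4: "does (Copy 0 2) \<sigma>3 \<sigma>4" unfolding \<sigma>4_def by (rule does_Copy) simp
    obtain \<sigma>5 where 5: "does (cu 2) \<sigma>4 \<sigma>5" "\<sigma>5 2 = u" "\<forall>i<2. \<sigma>5 i = \<sigma>4 i"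
      using cu by blast
    have s: "\<sigma>5 0 = npair m e" "\<sigma>5 1 = sim u e m"
      using 1 3 5 by (simp_all add: \<sigma>2_def \<sigma>4_def)
    have "runs X A ?c \<sigma> {(\<sigma>5 2, \<sigma>5 1)} (\<sigma>5(1 := A (\<sigma>5 2) (\<sigma>5 1)))"
      by (rule runs_Seq_quiet 1(1) 2 3(1) 4 5(1) runs.Qry)+
    with s 5 show ?thesis by (intro exI[of _ "\<sigma>5(1 := A (\<sigma>5 2) (\<sigma>5 1))"]) simp
  qed
  show ?thesis
  proof (rule exI[of _ ?c], rule exI[of _ ?d], intro allI impI conjI)
    fix X A e m and \<sigma> :: "nat \<Rightarrow> nat"
    assume "\<sigma> 0 = m" "\<sigma> 1 = e"
    then show "\<exists>\<sigma>'. runs X A ?c \<sigma> {(u, sim u e m)} \<sigma>' \<and> \<sigma>' 1 = A u (sim u e m)"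
      using first by blast
  next
    fix X A e m n and \<sigma> :: "nat \<Rightarrow> nat"
    assume "\<sigma> 0 = m" "\<sigma> 1 = e" and A: "A u (sim u e m) = 0"
      and n: "halts_with X (redirected u A) (program_of e) m n"
    obtain \<sigma>1 where 1: "runs X A ?c \<sigma> {(u, sim u e m)} \<sigma>1" "\<sigma>1 0 = npair m e" "\<sigma>1 1 = 0"
      using first[OF \<open>\<sigma> 0 = m\<close> \<open>\<sigma> 1 = e\<close>] A by metis
    have st: "runs X A (Stall 1) \<sigma>1 {} \<sigma>1" using 1(3) by (rule runs.Stall)
    define \<sigma>2 where "\<sigma>2 = \<sigma>1(1 := \<sigma>1 0, Suc 1 := 0)"
    have 2: "does (Copy 0 1) \<sigma>1 \<sigma>2" unfolding \<sigma>2_def by (rule does_Copy) simp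
    obtain \<sigma>3 where 3: "does (ci 1) \<sigma>2 \<sigma>3" "\<sigma>3 1 = ?i (\<sigma>2 1)"
      using ci by blast
    have "\<sigma>3 1 = sim u e (ninit m)" using 3 1 by (simp add: \<sigma>2_def)
    moreover obtain \<sigma>4 where 4: "does (Copy 1 2 ;; ch 2) \<sigma>3 \<sigma>4" "\<forall>i<2. \<sigma>4 i = \<sigma>3 i"
      "\<sigma>4 2 = ?h (\<sigma>3 1)"
      using test by blast
    ultimately have s4: "\<sigma>4 1 = sim u e (ninit m)" "\<sigma>4 2 = ?h (\<sigma>4 1)" by simp_all
    have init: "config_decode (ninit m) = config_at X (redirected u A) (program_of e) m 0"
      by (simp add: config_decode_ninit config_at_def)
    obtain j where j: "halted_at X (redirected u A) (program_of e) m (0 + j)"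
      using n unfolding halts_with_def halted_at_def by auto
    let ?Q = "\<lambda>t. qset (program_of e) (config_at X (redirected u A) (program_of e) m t)"
    obtain \<sigma>5 s t where 5: "runs X A ?w \<sigma>4 (redirect u ` (\<Union>t\<in>{0..<t}. ?Q t)) \<sigma>5"
      "\<sigma>5 1 = sim u e s" "config_decode s = config_at X (redirected u A) (program_of e) m t"
      "halted_at X (redirected u A) (program_of e) m t"
      using loop[OF s4(1) init s4(2) j] by blast
    obtain \<sigma>6 where 6: "does (co 1) \<sigma>5 \<sigma>6" "\<sigma>6 1 = ?o (\<sigma>5 1)" using co by blast
    define \<sigma>7 where "\<sigma>7 = \<sigma>6(0 := 0)"
    define \<sigma>8 where "\<sigma>8 = \<sigma>7(1 := 0, 0 := \<sigma>7 0 + \<sigma>7 1)"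
    have "does (Clear 0) \<sigma>6 \<sigma>7" "does (Add 1 0) \<sigma>7 \<sigma>8"
      unfolding \<sigma>7_def \<sigma>8_def by (rule does_Clear does_Add | simp)+
    with 6 have "runs X A (co 1 ;; Clear 0 ;; Add 1 0) \<sigma>5 {} \<sigma>8"
      by (intro runs_does) (blast intro: does_Seq)
    from runs.Seq[OF 5(1) this] have
      "runs X A (?w ;; co 1 ;; Clear 0 ;; Add 1 0) \<sigma>4 (redirect u ` (\<Union>t\<in>{0..<t}. ?Q t)) \<sigma>8"
      by simp
    from runs.Seq[OF 1(1) runs.Seq[OF st runs_Seq_quiet[OF does_Seq[OF 2 3(1)]
      runs_Seq_quiet[OF 4(1) this]]]]
    have "runs X A (?c ;; Stall 1 ;; ?d) \<sigma>
        ({(u, sim u e m)} \<union> ({} \<union> redirect u ` (\<Union>t\<in>{0..<t}. ?Q t))) \<sigma>8" .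
    moreover have "(\<Union>t\<in>{0..<t}. ?Q t) \<subseteq> queries X (redirected u A) (program_of e) m"
      unfolding queries_def qset_def by blast
    moreover have "\<sigma>8 0 = n"
    proof -
      have "num_of (snd (config_decode s) 0) = n"
        using 5(3,4) n halts_with_unique unfolding halted_at_def halts_with_def by metis
      then show ?thesis
        using 5(2) 6(2) by (simp add: \<sigma>7_def \<sigma>8_def config_decode_def num_of_tape_decode)
    qed
    ultimately show "\<exists>\<sigma>' Q. runs X A (?c ;; Stall 1 ;; ?d) \<sigma> Q \<sigma>' \<and> \<sigma>' 0 = n \<and>
        Q \<subseteq> insert (u, sim u e m)
          (redirect u ` queries X (redirected u A) (program_of e) m)"
      by blast
  qed
qed

section \<open>Primitive recursive indices\<close>

text \<open>\<open>primrec_fun\<close> generates functions on all lists, although only one length is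
  meaningful. Closing it under agreement on that length allows ordinary terms to be recognised as
  primitive recursive.\<close>

definition primrec_eq :: "nat \<Rightarrow> (nat list \<Rightarrow> nat) \<Rightarrow> bool" where
  "primrec_eq n F \<longleftrightarrow> (\<exists>f. primrec_fun n f \<and> (\<forall>xs. length xs = n \<longrightarrow> F xs = f xs))"

lemma primrec_eq_cong:
  "primrec_eq n F \<Longrightarrow> (\<And>xs. length xs = n \<Longrightarrow> G xs = F xs) \<Longrightarrow> primrec_eq n G"
  unfolding primrec_eq_def by auto

lemma primrec_eq_proj: "i < n \<Longrightarrow> primrec_eq n (\<lambda>xs. xs ! i)"
  unfolding primrec_eq_def using pr_proj by blast

lemma primrec_eq_comp1:
  assumes "primrec_eq 1 F" "primrec_eq n g"
  shows "primrec_eq n (\<lambda>xs. F [g xs])"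
proof -
  obtain f g' where "primrec_fun 1 f" "\<forall>xs. length xs = 1 \<longrightarrow> F xs = f xs"
    and "primrec_fun n g'" "\<forall>xs. length xs = n \<longrightarrow> g xs = g' xs"
    using assms unfolding primrec_eq_def by blast
  then show ?thesis
    using pr_comp[of "[g']" f n] unfolding primrec_eq_def
    by (intro exI[of _ "\<lambda>xs. f [g' xs]"]) simp
qed

lemma primrec_eq_comp2:
  assumes "primrec_eq 2 F" "primrec_eq n g" "primrec_eq n h"
  shows "primrec_eq n (\<lambda>xs. F [g xs, h xs])"
proof -
  obtain f g' h' where "primrec_fun 2 f" "\<forall>xs. length xs = 2 \<longrightarrow> F xs = f xs"
    and "primrec_fun n g'" "\<forall>xs. length xs = n \<longrightarrow> g xs = g' xs"
    and "primrec_fun n h'" "\<forall>xs. length xs = n \<longrightarrow> h xs = h' xs"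
    using assms unfolding primrec_eq_def by blast
  then show ?thesis
    using pr_comp[of "[g', h']" f n] unfolding primrec_eq_def
    by (intro exI[of _ "\<lambda>xs. f [g' xs, h' xs]"]) (simp add: numeral_2_eq_2)
qed

lemma primrec_eq_rec:
  assumes "primrec_eq n F" "primrec_eq (Suc (Suc n)) G"
  shows "primrec_eq (Suc n) (\<lambda>xs. rec_nat (F (tl xs)) (\<lambda>y r. G (y # r # tl xs)) (hd xs))"
proof -
  obtain f g where f: "primrec_fun n f" "\<forall>xs. length xs = n \<longrightarrow> F xs = f xs"
    and g: "primrec_fun (Suc (Suc n)) g" "\<forall>xs. length xs = Suc (Suc n) \<longrightarrow> G xs = g xs"
    using assms unfolding primrec_eq_def by blast
  have "rec_nat (F (tl xs)) (\<lambda>y r. G (y # r # tl xs)) k =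
      rec_nat (f (tl xs)) (\<lambda>y r. g (y # r # tl xs)) k" if "length xs = Suc n" for xs k
    by (induction k) (use f g that in simp_all)
  then show ?thesis
    using pr_rec[OF f(1) g(1)] unfolding primrec_eq_def by blast
qed

lemma primrec_eq_Suc: "primrec_eq n g \<Longrightarrow> primrec_eq n (\<lambda>xs. Suc (g xs))"
  using primrec_eq_comp1[of "\<lambda>xs. Suc (xs ! 0)" n g] pr_suc unfolding primrec_eq_def by auto

lemma primrec_eq_const: "primrec_eq n (\<lambda>_. c)"
proof (induction c)
  case 0
  then show ?case unfolding primrec_eq_def using pr_zero by blast
qed (rule primrec_eq_Suc)

lemma primrec_eq_add:
  assumes "primrec_eq n g" "primrec_eq n h"
  shows "primrec_eq n (\<lambda>xs. g xs + h xs)"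
proof -
  have "primrec_eq 2 (\<lambda>xs. rec_nat (tl xs ! 0) (\<lambda>y r. Suc ((y # r # tl xs) ! 1)) (hd xs))"
    using primrec_eq_rec[OF primrec_eq_proj[of 0 1]
      primrec_eq_Suc[OF primrec_eq_proj[of 1 "Suc (Suc 1)"]]]
    by (simp add: numeral_2_eq_2)
  moreover have "rec_nat b (\<lambda>y r. Suc r) a = a + b" for a b by (induction a) simp_all
  ultimately have "primrec_eq 2 (\<lambda>xs. xs ! 0 + xs ! 1)"
    by (elim primrec_eq_cong) (auto simp: numeral_2_eq_2 length_Suc_conv)
  from primrec_eq_comp2[OF this assms] show ?thesis by simp
qed

text \<open>Pairing is a triangular number plus a summand, so together with successor and addition
  this covers \<open>ncons\<close>, out of which the index function is built.\<close>

lemma primrec_eq_triangle: "primrec_eq n g \<Longrightarrow> primrec_eq n (\<lambda>xs. triangle (g xs))"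
proof -
  have "primrec_eq 1 (\<lambda>xs. rec_nat 0
      (\<lambda>y r. (y # r # tl xs) ! 1 + Suc ((y # r # tl xs) ! 0)) (hd xs))"
    using primrec_eq_rec[of 0 "\<lambda>_. 0" "\<lambda>xs. xs ! 1 + Suc (xs ! 0)"]
    by (simp add: primrec_eq_const primrec_eq_add primrec_eq_Suc primrec_eq_proj)
  moreover have "rec_nat 0 (\<lambda>y r. r + Suc y) a = triangle a" for a by (induction a) simp_all
  ultimately have "primrec_eq 1 (\<lambda>xs. triangle (xs ! 0))"
    by (elim primrec_eq_cong) (auto simp: length_Suc_conv)
  from primrec_eq_comp1[OF this] show "primrec_eq n g \<Longrightarrow> ?thesis" by simp
qed

lemma primrec_eq_ncons:
  "primrec_eq n g \<Longrightarrow> primrec_eq n h \<Longrightarrow> primrec_eq n (\<lambda>xs. ncons (g xs) (h xs))"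
  unfolding ncons_def prod_encode_def
  by (simp add: primrec_eq_Suc primrec_eq_add primrec_eq_triangle)

lemmas primrec_eq_intros = primrec_eq_const primrec_eq_proj primrec_eq_ncons primrec_eq_add

section \<open>Loading e onto a tape\<close>

fun load_program :: "nat \<Rightarrow> program \<Rightarrow> nat \<Rightarrow> program" where
  "load_program p P 0 = Act p 1 0 0 MoveR 1 # P"
| "load_program p P (Suc i) = Act (p + Suc i) 1 0 1 MoveL (p + i) # load_program p P i"

text \<open>The loading states lie above the fixed code P, one for each mark of e, so neither P nor
  its states depend on e and the index arises from that of P by primitive recursion. Execution
  starts in state 0, whence the entry jump to p + e.\<close>

definition start_program :: "nat \<Rightarrow> program \<Rightarrow> nat \<Rightarrow> program" where
  "start_program p P e = Act 0 1 0 0 Stay (p + e) # load_program p P e"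

lemma list_encode_Cons_ncons: "list_encode (x # xs) = ncons x (list_encode xs)"
  by (simp add: ncons_def)

lemma program_of_ncons:
  "instr_of c = Some i \<Longrightarrow> program_of (ncons c l) = i # program_of l"
  by (simp add: program_of_def List.map_filter_simps)

lemma start_program_primitive_recursive:
  "\<exists>k. primitive_recursive k \<and> (\<forall>e. program_of (k e) = start_program p P e)"
proof -
  obtain w where w: "program_of w = Act p 1 0 0 MoveR 1 # P" using program_of_surj by blast
  \<comment> \<open>Code of the instruction for the loading state p + Suc i. Direction 0 stands for
    \<open>MoveL\<close>; in the entry instruction of \<open>k\<close>, direction 2 stands for
    \<open>Stay\<close>.\<close>
  let ?f = "\<lambda>i r. ncons (list_encode [0, Suc i + p, 1, 0, 1, 0, i + p]) r"
  define l where "l = rec_nat w ?f"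
  define k where "k e = ncons (list_encode [0, 0, 1, 0, 0, 2, e + p]) (l e)" for e
  have instr: "instr_of (list_encode [0, q, t, s, s', d, q']) = Some (Act q t s s' (dir_of d) q')"
    for q t s s' d q'
    by (simp add: instr_of_def)
  have "program_of (l e) = load_program p P e" for e
    by (induction e)
      (simp_all add: l_def w program_of_ncons instr dir_of_def add.commute del: list_encode.simps)
  then have "program_of (k e) = start_program p P e" for e
    by (simp add: k_def start_program_def program_of_ncons instr dir_of_def add.commute
        del: list_encode.simps)
  moreover have "primitive_recursive k"
  proof -
    have "primrec_eq (Suc 0) (\<lambda>xs. rec_nat w
        (\<lambda>y r. (\<lambda>xs. ?f (xs ! 0) (xs ! 1)) (y # r # tl xs)) (hd xs))"
      unfolding list_encode_Cons_ncons list_encode.simps(1)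
      by (rule primrec_eq_rec; intro primrec_eq_intros primrec_eq_Suc; simp)
    then have "primrec_eq 1 (\<lambda>xs. l (xs ! 0))"
      unfolding l_def by (auto elim!: primrec_eq_cong simp: length_Suc_conv)
    then have "primrec_eq 1 (\<lambda>xs. k (xs ! 0))"
      unfolding k_def list_encode_Cons_ncons list_encode.simps(1)
      by (intro primrec_eq_intros; simp)
    then obtain f where "primrec_fun 1 f" "\<forall>xs. length xs = 1 \<longrightarrow> k (xs ! 0) = f xs"
      unfolding primrec_eq_def by blast
    then show ?thesis
      unfolding primitive_recursive_def by (intro exI[of _ f]) (simp flip: One_nat_def, metis
        One_nat_def length_Cons list.size(3) nth_Cons_0)
  qed
  ultimately show ?thesis by blast
qed

lemma filter_load_program:
  "q \<noteq> p \<Longrightarrow> q \<le> p \<Longrightarrow> filter (\<lambda>i. src i = q) (load_program p P e) = filter (\<lambda>i. src i = q) P"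
  by (induction e) auto

lemma next_instr_Cons: "next_instr (i # P) c = (if applicable c i then Some i else next_instr P c)"
  by (simp add: next_instr_def)

lemma next_instr_load_program:
  assumes "scanned (T 1) = 0"
  shows "i < e \<Longrightarrow> next_instr (load_program p P e) (p + Suc i, T) =
      Some (Act (p + Suc i) 1 0 1 MoveL (p + i))"
    "next_instr (load_program p P e) (p, T) = Some (Act p 1 0 0 MoveR 1)"
  using assms by (induction e) (auto simp: next_instr_Cons less_Suc_eq)

text \<open>The compiled command fills the states 1 to \<open>len c\<close> and exits at
  \<open>len c + 1\<close>. The value \<open>len c + 2\<close> of p keeps the loader clear of this
  exit, so that the machine halts there.\<close>

lemma steps_load:
  fixes e :: nat
  assumes p: "p = len c + 2"
  defines "P \<equiv> start_program p (compile c 1) e"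
  shows "loaded P 1 c" "next_instr P (1 + len c, T) = None"
    "\<exists>T. steps X A P (init_config m) {} (1, T) \<and> represents_all T ((\<lambda>_. 0)(0 := m, 1 := e))"
proof -
  have f: "filter (\<lambda>i. src i = q) P = filter (\<lambda>i. src i = q) (compile c 1)"
    if "0 < q" "q < p" for q
    using that unfolding P_def start_program_def by (auto simp: filter_load_program)
  then show "loaded P 1 c" by (simp add: loaded_def p)
  show "next_instr P (1 + len c, T) = None"
    using f[of "1 + len c"] by (simp add: next_instr_filter p filter_compile_outside)
  have P: "next_instr P (q, T) = next_instr (load_program p (compile c 1) e) (q, T)" if "q > 0" for q T
    using that by (simp add: P_def start_program_def next_instr_Cons)
  define T0 where "T0 = snd (init_config m)"
  \<comment> \<open>The marks are written from right to left: after j of them the head is on the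
    blank to their left. The last loading instruction steps right onto the number and leaves this
    blank behind.\<close>
  define T where "T j = T0(1 := ([], 0 # replicate j 1))" for j
  have "steps X A P (init_config m) {} (p + (e - j), T j)" if "j \<le> e" for j
    using that
  proof (induction j)
    case 0
    have "next_instr P (init_config m) = Some (Act 0 1 0 0 Stay (p + e))"
      by (simp add: P_def start_program_def next_instr_Cons init_config_def scanned_def tape_of_def)
    moreover have "exec X A (Act 0 1 0 0 Stay (p + e)) (init_config m) = (p + (e - 0), T 0)"
      by (simp add: T_def T0_def init_config_def write_sym_def tape_of_def)
    ultimately show ?case
      using steps_step[of P "init_config m" "Act 0 1 0 0 Stay (p + e)" X A]
      by (simp only:) (simp add: init_config_def)
  next
    case (Suc j)
    then obtain i where i: "e - j = Suc i" "e - Suc j = i" "i < e"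
      by (metis Suc_diff_Suc Suc_le_lessD diff_less_Suc Suc_diff_le diff_Suc_Suc less_Suc_eq_le not_less_eq)
    have "scanned (T j 1) = 0" by (simp add: T_def scanned_def)
    from next_instr_load_program(1)[of "T j", OF this i(3), of p "compile c 1"]
    have "next_instr P (p + Suc i, T j) = Some (Act (p + Suc i) 1 0 1 MoveL (p + i))"
      by (simp add: P)
    from steps_step[OF this, of X A] have "steps X A P (p + Suc i, T j) {} (p + i, T (Suc j))"
      by (simp add: T_def write_sym_def)
    from steps_trans[OF Suc.IH[unfolded i(1)] this] Suc.prems i show ?case by simp
  qed
  from this[of e] have 1: "steps X A P (init_config m) {} (p, T e)" by simp
  have "scanned (T e 1) = 0" by (simp add: T_def scanned_def)
  from next_instr_load_program(2)[of "T e", OF this, of p "compile c 1" e]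
  have "next_instr P (p, T e) = Some (Act p 1 0 0 MoveR 1)"
    by (simp add: P p)
  from steps_step[OF this, of X A]
  have "steps X A P (p, T e) {} (1, T0(1 := ([0], replicate e 1)))"
    by (simp add: T_def write_sym_def)
  from steps_trans[OF 1 this]
  have "steps X A P (init_config m) {} (1, T0(1 := ([0], replicate e 1)))" by simp
  moreover have "represents_all (T0(1 := ([0], replicate e 1))) ((\<lambda>_. 0)(0 := m, 1 := e))"
    unfolding T0_def by (intro represents_all_upd represents_all_init) (simp add: represents_def)
  ultimately show
    "\<exists>T. steps X A P (init_config m) {} (1, T) \<and> represents_all T ((\<lambda>_. 0)(0 := m, 1 := e))"
    by blast
qed

text \<open>All clauses hold for arbitrary A: one direction uses them with the canonical answers,
  the other with the unknown A that \<open>Gamma\<close> provides. In particular the opening query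
  is issued whatever the answers are.\<close>

definition simulating :: "nat \<Rightarrow> nat \<Rightarrow> nat \<Rightarrow> bool" where
  "simulating u e p \<longleftrightarrow> (\<forall>X A m.
     (u, sim u e m) \<in> queries X A (program_of p) m \<and>
     (\<forall>n. A u (sim u e m) \<noteq> 0 \<longrightarrow> \<not> halts_with X A (program_of p) m n) \<and>
     (\<forall>n. A u (sim u e m) = 0 \<longrightarrow> halts_with X (redirected u A) (program_of e) m n \<longrightarrow>
       halts_with X A (program_of p) m n \<and>
       queries X A (program_of p) m \<subseteq>
         insert (u, sim u e m) (redirect u ` queries X (redirected u A) (program_of e) m)))"

lemma simulating_program: "\<exists>k. primitive_recursive k \<and> (\<forall>e. simulating u e (k e))"
proof -
  obtain c d where *: "\<forall>X A e m \<sigma>. \<sigma> 0 = m \<longrightarrow> \<sigma> 1 = e \<longrightarrow>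
     (\<exists>\<sigma>'. runs X A c \<sigma> {(u, sim u e m)} \<sigma>' \<and> \<sigma>' 1 = A u (sim u e m)) \<and>
     (\<forall>n. A u (sim u e m) = 0 \<longrightarrow> halts_with X (redirected u A) (program_of e) m n \<longrightarrow>
       (\<exists>\<sigma>' Q. runs X A (c ;; Stall 1 ;; d) \<sigma> Q \<sigma>' \<and> \<sigma>' 0 = n \<and>
         Q \<subseteq> insert (u, sim u e m)
           (redirect u ` queries X (redirected u A) (program_of e) m)))"
    using unbounded_simulation by blast
  have
    c: "\<exists>\<sigma>'. runs X A c ((\<lambda>_. 0)(0 := m, 1 := e)) {(u, sim u e m)} \<sigma>' \<and>
        \<sigma>' 1 = A u (sim u e m)" and
    d: "A u (sim u e m) = 0 \<Longrightarrow> halts_with X (redirected u A) (program_of e) m n \<Longrightarrow>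
       \<exists>\<sigma>' Q. runs X A (c ;; Stall 1 ;; d) ((\<lambda>_. 0)(0 := m, 1 := e)) Q \<sigma>' \<and> \<sigma>' 0 = n \<and>
         Q \<subseteq> insert (u, sim u e m)
           (redirect u ` queries X (redirected u A) (program_of e) m)" for X A e m n
  proof -
    have "((\<lambda>_. 0)(0 := m, 1 := e)) (0 :: nat) = m" "((\<lambda>_. 0)(0 := m, 1 := e)) (1 :: nat) = e"
      by simp_all
    with * show "\<exists>\<sigma>'. runs X A c ((\<lambda>_. 0)(0 := m, 1 := e)) {(u, sim u e m)} \<sigma>' \<and>
        \<sigma>' 1 = A u (sim u e m)"
      "A u (sim u e m) = 0 \<Longrightarrow> halts_with X (redirected u A) (program_of e) m n \<Longrightarrow>
       \<exists>\<sigma>' Q. runs X A (c ;; Stall 1 ;; d) ((\<lambda>_. 0)(0 := m, 1 := e)) Q \<sigma>' \<and> \<sigma>' 0 = n \<and>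
         Q \<subseteq> insert (u, sim u e m)
           (redirect u ` queries X (redirected u A) (program_of e) m)"
      by blast+
  qed
  define com where "com = (c ;; Stall 1 ;; d)"
  define p where "p = len com + 2"
  obtain k where k: "primitive_recursive k"
    "\<And>e. program_of (k e) = start_program p (compile com 1) e"
    using start_program_primitive_recursive by blast
  have load: "\<exists>T. steps X A (program_of (k e)) (init_config m) {} (1, T) \<and>
      represents_all T ((\<lambda>_. 0)(0 := m, 1 := e))" for X A e m
    unfolding k(2) by (rule steps_load(3)[OF p_def])
  have loaded: "loaded (program_of (k e)) 1 com" for e
    unfolding k(2) by (rule steps_load(1)[OF p_def])
  have exit: "next_instr (program_of (k e)) (1 + len com, T) = None" for e T
    unfolding k(2) by (rule steps_load(2)[OF p_def])
  have first: "\<exists>T. steps X A (program_of (k e)) (init_config m) {(u, sim u e m)} (1 + len c, T) \<and>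
      represents (T 1) (A u (sim u e m))" for X A e m
  proof -
    obtain T where T: "steps X A (program_of (k e)) (init_config m) {} (1, T)"
      "represents_all T ((\<lambda>_. 0)(0 := m, 1 := e))"
      using load by blast
    obtain \<sigma> where \<sigma>: "runs X A c ((\<lambda>_. 0)(0 := m, 1 := e)) {(u, sim u e m)} \<sigma>"
      "\<sigma> 1 = A u (sim u e m)"
      using c by blast
    obtain T' where "steps X A (program_of (k e)) (1, T) {(u, sim u e m)} (1 + len c, T')"
      "represents_all T' \<sigma>"
      using compile_correct[OF \<sigma>(1) loaded_Seq(1)[OF loaded[unfolded com_def]] T(2)] by blast
    with steps_trans[OF T(1)] \<sigma>(2) show ?thesis
      unfolding represents_all_def Un_empty_left by metis
  qed
  show ?thesis
    unfolding simulating_def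
  proof (intro exI[of _ k] conjI k(1) allI impI)
    fix X A e m
    show "(u, sim u e m) \<in> queries X A (program_of (k e)) m"
      using first steps_queries by blast
  next
    fix X and A :: "nat \<Rightarrow> nat \<Rightarrow> nat" and e m n
    assume "A u (sim u e m) \<noteq> 0"
    then obtain y where y: "A u (sim u e m) = Suc y" using not0_implies_Suc by blast
    obtain T where T: "steps X A (program_of (k e)) (init_config m) {(u, sim u e m)} (1 + len c, T)"
      "represents (T 1) (Suc y)"
      using first[of X A e m] y by auto
    have "loaded (program_of (k e)) (1 + len c) (Stall 1)"
      using loaded_Seq(1)[OF loaded_Seq(2)[OF loaded[unfolded com_def]]] .
    from stalled[where T = T, OF this T(2)] show "\<not> halts_with X A (program_of (k e)) m n"
      using not_halts_with_stationary[OF T(1)] by blast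
  next
    fix X and A :: "nat \<Rightarrow> nat \<Rightarrow> nat" and e m n
    assume A: "A u (sim u e m) = 0" and n: "halts_with X (redirected u A) (program_of e) m n"
    obtain T where T: "steps X A (program_of (k e)) (init_config m) {} (1, T)"
      "represents_all T ((\<lambda>_. 0)(0 := m, 1 := e))"
      using load by blast
    obtain \<sigma> Q where \<sigma>: "runs X A com ((\<lambda>_. 0)(0 := m, 1 := e)) Q \<sigma>" "\<sigma> 0 = n"
      "Q \<subseteq> insert (u, sim u e m) (redirect u ` queries X (redirected u A) (program_of e) m)"
      using d[of A e m X n] A n unfolding com_def by blast
    obtain T' where T': "steps X A (program_of (k e)) (1, T) Q (1 + len com, T')"
      "represents_all T' \<sigma>"
      using compile_correct[OF \<sigma>(1) loaded T(2)] by blast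
    have s: "steps X A (program_of (k e)) (init_config m) Q (1 + len com, T')"
      using steps_trans[OF T(1) T'(1)] by simp
    have "num_of (T' 0) = n"
      using T'(2) \<sigma>(2) represents_num_of unfolding represents_all_def by metis
    with halts_with_steps[OF s exit] \<sigma>(3)
    show "halts_with X A (program_of (k e)) m n" "queries X A (program_of (k e)) m \<subseteq>
         insert (u, sim u e m) (redirect u ` queries X (redirected u A) (program_of e) m)"
      by simp_all
  qed
qed

section \<open>Comparison of the fixed points\<close>

text \<open>Agreement is required only on queries issued before time k, because a single clocked
  computation yields information on no others.\<close>

lemma config_at_cong_before:
  assumes "\<And>e m. (e, m) \<in> queries_before X A P n k \<Longrightarrow> A e m = B e m" "t \<le> k"
  shows "config_at X A P n t = config_at X B P n t"
  using assms(2)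
proof (induction t)
  case 0
  show ?case by (simp add: config_at_def)
next
  case (Suc t)
  let ?c = "config_at X A P n t"
  have "exec X A i ?c = exec X B i ?c" if i: "next_instr P ?c = Some i" for i
  proof (rule exec_cong)
    fix e m
    assume "queried i ?c = Some (e, m)"
    with i Suc.prems have "(e, m) \<in> queries_before X A P n k"
      unfolding queries_before_def qset_def by auto
    then show "A e m = B e m" by (rule assms(1))
  qed
  then have "step X A P ?c = step X B P ?c"
    by (simp add: step_def split: option.split)
  with Suc show ?case by (simp add: config_at_Suc)
qed

lemma queries_cong:
  assumes "\<And>e m. (e, m) \<in> queries X A P n \<Longrightarrow> A e m = B e m"
  shows "queries X A P n = queries X B P n" "halts_with X A P n = halts_with X B P n"
proof -
  have *: "config_at X A P n t = config_at X B P n t" for t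
    by (rule config_at_cong) (rule assms)
  show "queries X A P n = queries X B P n" unfolding queries_def * ..
  show "halts_with X A P n = halts_with X B P n" unfolding halts_with_def * by (rule refl)
qed

section \<open>Canonical feedback answers\<close>

definition feedback_answer :: "(nat \<Rightarrow> nat) \<Rightarrow> nat \<Rightarrow> nat \<Rightarrow> nat" where
  "feedback_answer X e m = (if \<exists>k. ((e, m, X), (Conv, k)) \<in> Feedback_inf then 0 else 1)"

definition feedback_defined :: "(nat \<Rightarrow> nat) \<Rightarrow> (nat \<times> nat) set" where
  "feedback_defined X = {(e, m). \<exists>v. ((e, m, X), v) \<in> Feedback_inf}"

lemma feedback_answer_eq:
  assumes "((e, m, X), (j, k)) \<in> Feedback_inf"
  shows "feedback_answer X e m = answer_code j"
proof (cases j)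
  case Conv
  with assms show ?thesis by (auto simp: feedback_answer_def)
next
  case Div
  have "((e, m, X), (Conv, k')) \<notin> Feedback_inf" for k'
    using Feedback_inf_unique[OF assms, of "(Conv, k')"] Div by auto
  with Div show ?thesis by (simp add: feedback_answer_def)
qed

text \<open>An A that is right on its own queries agrees with \<open>feedback_answer\<close> there
  and hence produces the same run, so the existential A of \<open>Feedback\<close> gives way to one
  total function for each X. Its default 1 at freezing arguments is not met in a run whose queries
  are all defined.\<close>

lemma Feedback_inf_iff:
  "((e, m, X), (j, k)) \<in> Feedback_inf \<longleftrightarrow>
     queries X (feedback_answer X) (program_of e) m \<subseteq> feedback_defined X \<and>
     ((\<exists>n. halts_with X (feedback_answer X) (program_of e) m n \<and> j = Conv \<and> k = enat n) \<or>
      ((\<nexists>n. halts_with X (feedback_answer X) (program_of e) m n) \<and> j = Div \<and> k = \<infinity>))"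
  (is "_ \<longleftrightarrow> ?R")
proof
  assume "((e, m, X), (j, k)) \<in> Feedback_inf"
  then have "((e, m, X), (j, k)) \<in> Feedback Feedback_inf" by (subst (asm) Feedback_inf_unfold)
  then obtain A where
    A: "\<And>e' m'. (e', m') \<in> queries X A (program_of e) m \<Longrightarrow>
          \<exists>j' k'. ((e', m', X), (j', k')) \<in> Feedback_inf \<and> A e' m' = answer_code j'"
    and h: "(\<exists>n. halts_with X A (program_of e) m n \<and> j = Conv \<and> k = enat n) \<or>
            ((\<nexists>n. halts_with X A (program_of e) m n) \<and> j = Div \<and> k = \<infinity>)"
    unfolding Feedback_def by fast
  have "A e' m' = feedback_answer X e' m'" if "(e', m') \<in> queries X A (program_of e) m" for e' m'
    using A[OF that] feedback_answer_eq by metis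
  then have "queries X A (program_of e) m = queries X (feedback_answer X) (program_of e) m"
    "halts_with X A (program_of e) m = halts_with X (feedback_answer X) (program_of e) m"
    using queries_cong by blast+
  moreover have "queries X A (program_of e) m \<subseteq> feedback_defined X"
    using A unfolding feedback_defined_def by blast
  ultimately show ?R using h by simp
next
  assume R: ?R
  have "\<exists>j' k'. ((e', m', X), (j', k')) \<in> Feedback_inf \<and> feedback_answer X e' m' = answer_code j'"
    if "(e', m') \<in> queries X (feedback_answer X) (program_of e) m" for e' m'
    using R that feedback_answer_eq unfolding feedback_defined_def by fast
  with R have "((e, m, X), (j, k)) \<in> Feedback Feedback_inf"
    unfolding Feedback_def by blast
  then show "((e, m, X), (j, k)) \<in> Feedback_inf" by (subst Feedback_inf_unfold)
qed

text \<open>The canonical run either halts or not, and each case is an outcome; freezing has no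
  cause other than an undefined query.\<close>

lemma feedback_definedI:
  assumes "queries X (feedback_answer X) (program_of e) m \<subseteq> feedback_defined X"
  shows "(e, m) \<in> feedback_defined X"
    "feedback_answer X e m = 0 \<longleftrightarrow> (\<exists>n. halts_with X (feedback_answer X) (program_of e) m n)"
proof -
  let ?h = "\<exists>n. halts_with X (feedback_answer X) (program_of e) m n"
  have "?h \<Longrightarrow> \<exists>k. ((e, m, X), (Conv, k)) \<in> Feedback_inf"
    "\<not> ?h \<Longrightarrow> ((e, m, X), (Div, \<infinity>)) \<in> Feedback_inf"
    using assms unfolding Feedback_inf_iff by blast+
  then show "(e, m) \<in> feedback_defined X"
    unfolding feedback_defined_def by blast
  have "?h \<Longrightarrow> feedback_answer X e m = 0" "\<not> ?h \<Longrightarrow> feedback_answer X e m = 1"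
    using feedback_answer_eq[of e m X] \<open>?h \<Longrightarrow> _\<close> \<open>\<not> ?h \<Longrightarrow> _\<close> by fastforce+
  then show "feedback_answer X e m = 0 \<longleftrightarrow> ?h" by force
qed

text \<open>\<open>E2\<close> gives 0 iff some entry is 0, that is, iff the run has halted at some
  time k. Here the codes fit: 0 for \<open>Conv\<close>, 0 for halted, and 0 for an existing
  zero.\<close>

lemma feedback_answer_E2:
  assumes "(e, m) \<in> feedback_defined X"
  shows "feedback_answer X e m =
    E2 (\<lambda>k. of_bool (\<not> halted_at X (feedback_answer X) (program_of e) m k))"
proof -
  have "queries X (feedback_answer X) (program_of e) m \<subseteq> feedback_defined X"
  proof -
    obtain j k where "((e, m, X), (j, k)) \<in> Feedback_inf"
      using assms unfolding feedback_defined_def by auto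
    then show ?thesis by (simp only: Feedback_inf_iff)
  qed
  from feedback_definedI(2)[OF this] show ?thesis
    unfolding halts_with_def halted_at_def E2_def
    by (auto simp: feedback_answer_def split: if_splits)
qed

section \<open>Transfer between the two fixed points\<close>

definition bounded_simulator :: "nat \<Rightarrow> bool" where
  "bounded_simulator u \<longleftrightarrow> (\<forall>X A e m k.
     (\<forall>n. halts_with X A (program_of u) (list_encode [sim u e m, k]) n \<longleftrightarrow>
       n = of_bool (\<not> halted_at X (redirected u A) (program_of e) m k)) \<and>
     queries X A (program_of u) (list_encode [sim u e m, k]) =
       redirect u ` queries_before X (redirected u A) (program_of e) m k)"

text \<open>The answers given to the simulators on the way from feedback to E. The pair (e, m) is
  read off from the coded triple, so that the simulated program sees the canonical feedback
  answers.\<close>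

definition sim_answer :: "(nat \<Rightarrow> nat) \<Rightarrow> nat \<Rightarrow> nat \<Rightarrow> nat" where
  "sim_answer X _ z = feedback_answer X (nfst (nsnd z)) (nsnd (nsnd z))"

lemma redirected_sim_answer [simp]: "redirected u (sim_answer X) = feedback_answer X"
  by (simp add: redirected_def sim_answer_def fun_eq_iff)

text \<open>Every defined feedback computation is covered, divergent or not, and all clock values at
  once, since an E-query on it needs the whole sequence. The queries of the clocked run are
  redirected queries of e, and for those the induction hypothesis supplies their sequences.\<close>

lemma bounded_simulator_converges:
  assumes u: "bounded_simulator u" and "((e, m, X), v) \<in> Feedback_inf"
  shows "((u, list_encode [sim u e m, k], X),
    of_bool (\<not> halted_at X (feedback_answer X) (program_of e) m k)) \<in> Gamma_inf"
proof -
  let ?y = "\<lambda>X e m k. of_bool (\<not> halted_at X (feedback_answer X) (program_of e) m k) :: nat"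
  let ?S = "{((e, m, X), v) | e m X v. \<forall>k. ((u, list_encode [sim u e m, k], X), ?y X e m k) \<in> Gamma_inf}"
  \<comment> \<open>The intersection keeps the information that the queried computations are
    defined; this identifies A with \<open>feedback_answer\<close> and makes
    \<open>feedback_answer_E2\<close> applicable to them.\<close>
  have "Feedback (Feedback_inf \<inter> ?S) \<subseteq> ?S"
  proof
    fix z
    assume "z \<in> Feedback (Feedback_inf \<inter> ?S)"
    then obtain e m X v A where z: "z = ((e, m, X), v)" and
      A: "\<And>e' m'. (e', m') \<in> queries X A (program_of e) m \<Longrightarrow>
        \<exists>j' k'. ((e', m', X), (j', k')) \<in> Feedback_inf \<inter> ?S \<and> A e' m' = answer_code j'"
      unfolding Feedback_def by fast
    have "A e' m' = feedback_answer X e' m'" if "(e', m') \<in> queries X A (program_of e) m" for e' m'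
      using A[OF that] feedback_answer_eq by auto
    then have "queries X A (program_of e) m = queries X (feedback_answer X) (program_of e) m"
      using queries_cong by blast
    then have q: "(e', m') \<in> feedback_defined X"
      "((u, list_encode [sim u e' m', k], X), ?y X e' m' k) \<in> Gamma_inf"
      if "(e', m') \<in> queries X (feedback_answer X) (program_of e) m" for e' m' k
      using A[of e' m'] that unfolding feedback_defined_def by blast+
    have "((u, list_encode [sim u e m, k], X), ?y X e m k) \<in> Gamma Gamma_inf" for k
    proof -
      have "\<exists>y. (\<forall>k. ((e0, list_encode [m0, k], X), y k) \<in> Gamma_inf) \<and> sim_answer X e0 m0 = E2 y"
        if "(e0, m0) \<in> queries X (sim_answer X) (program_of u) (list_encode [sim u e m, k])"
        for e0 m0
      proof -
        have "(e0, m0) \<in> redirect u ` queries_before X (feedback_answer X) (program_of e) m k"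
          using that u unfolding bounded_simulator_def by simp
        then obtain e' m' where e0: "e0 = u" "m0 = sim u e' m'"
          and "(e', m') \<in> queries_before X (feedback_answer X) (program_of e) m k"
          by (auto simp: redirect_def)
        then have "(e', m') \<in> queries X (feedback_answer X) (program_of e) m"
          unfolding queries_eq by blast
        from q[OF this] feedback_answer_E2 e0 show ?thesis
          by (intro exI[of _ "?y X e' m'"]) (simp add: sim_answer_def del: list_encode.simps)
      qed
      moreover have "halts_with X (sim_answer X) (program_of u) (list_encode [sim u e m, k])
          (?y X e m k)"
        using u unfolding bounded_simulator_def by simp
      ultimately show ?thesis unfolding Gamma_def by blast
    qed
    then show "z \<in> ?S" unfolding z Gamma_inf_unfold[symmetric] by blast
  qed
  then have "Feedback_inf \<subseteq> ?S"
    unfolding Feedback_inf_def by (rule lfp_induct[OF mono_Feedback])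
  with assms(2) show ?thesis by blast
qed

text \<open>An invariant for induction on the fixed point of \<open>Gamma\<close>: it constrains
  only computations of u on proper inputs and holds trivially elsewhere. At clock value k it can
  vouch only for the queries of the first k steps.\<close>

definition sound_values :: "nat \<Rightarrow> (input \<times> nat) set" where
  "sound_values u = {((e0, m0, X), n) | e0 m0 X n. \<forall>e m k.
     e0 = u \<longrightarrow> m0 = list_encode [sim u e m, k] \<longrightarrow>
       queries_before X (feedback_answer X) (program_of e) m k \<subseteq> feedback_defined X \<and>
       n = of_bool (\<not> halted_at X (feedback_answer X) (program_of e) m k)}"

text \<open>Every query of e is issued before some time k, so the entries of the sequence together
  vouch for all of them, and (e, m) is defined.\<close>

lemma sound_answer:
  assumes "\<And>k. ((u, list_encode [sim u e m, k], X), y k) \<in> sound_values u"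
  shows "(e, m) \<in> feedback_defined X" "feedback_answer X e m = E2 y"
proof -
  have *: "queries_before X (feedback_answer X) (program_of e) m k \<subseteq> feedback_defined X"
    "y k = of_bool (\<not> halted_at X (feedback_answer X) (program_of e) m k)" for k
    using assms[of k] unfolding sound_values_def by blast+
  then show "(e, m) \<in> feedback_defined X"
    unfolding queries_eq by (intro feedback_definedI(1)) (auto simp: queries_eq)
  from feedback_answer_E2[OF this] show "feedback_answer X e m = E2 y"
    using *(2) by presburger
qed

lemma Gamma_inf_sound:
  assumes u: "bounded_simulator u"
  shows "Gamma_inf \<subseteq> sound_values u"
proof -
  have "Gamma (sound_values u) \<subseteq> sound_values u"
  proof
    fix z
    assume "z \<in> Gamma (sound_values u)"
    then obtain e0 m0 X n A where z: "z = ((e0, m0, X), n)" and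
      A: "\<And>e' m'. (e', m') \<in> queries X A (program_of e0) m0 \<Longrightarrow>
        \<exists>y. (\<forall>k. ((e', list_encode [m', k], X), y k) \<in> sound_values u) \<and> A e' m' = E2 y"
      and n: "halts_with X A (program_of e0) m0 n"
      unfolding Gamma_def by fast
    have "queries_before X (feedback_answer X) (program_of e) m k \<subseteq> feedback_defined X \<and>
       n = of_bool (\<not> halted_at X (feedback_answer X) (program_of e) m k)"
      if e0: "e0 = u" "m0 = list_encode [sim u e m, k]" for e m k
    proof -
      \<comment> \<open>Each query of the simulated run reappears, redirected, among the queries of
        u. The invariant thus applies to the sequence that A used to answer it, and shows that the
        answer is the feedback answer.\<close>
      have q: "(e', m') \<in> feedback_defined X" "redirected u A e' m' = feedback_answer X e' m'"
        if "(e', m') \<in> queries_before X (redirected u A) (program_of e) m k" for e' m'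
      proof -
        have "(u, sim u e' m') \<in> redirect u ` queries_before X (redirected u A) (program_of e) m k"
          using that by (force simp: redirect_def)
        then have "(u, sim u e' m') \<in> queries X A (program_of e0) m0"
          using u e0 unfolding bounded_simulator_def by simp
        from A[OF this] obtain y where
          "\<And>k. ((u, list_encode [sim u e' m', k], X), y k) \<in> sound_values u" "A u (sim u e' m') = E2 y"
          by blast
        with sound_answer[OF this(1)]
        show "(e', m') \<in> feedback_defined X" "redirected u A e' m' = feedback_answer X e' m'"
          by (simp_all add: redirected_def)
      qed
      have c: "config_at X (redirected u A) (program_of e) m t =
          config_at X (feedback_answer X) (program_of e) m t" if "t \<le> k" for t
        using config_at_cong_before[OF q(2) that] by simp
      have "queries_before X (redirected u A) (program_of e) m k =
          queries_before X (feedback_answer X) (program_of e) m k"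
        unfolding queries_before_def by (intro SUP_cong) (simp_all add: c)
      moreover have "n = of_bool (\<not> halted_at X (redirected u A) (program_of e) m k)"
        using u n unfolding bounded_simulator_def e0 by blast
      ultimately show ?thesis using q(1) c[of k] by (auto simp: halted_at_def)
    qed
    then show "z \<in> sound_values u" unfolding z sound_values_def by blast
  qed
  then show ?thesis unfolding Gamma_inf_def by (rule lfp_lowerbound)
qed

theorem theorem1p2:
  shows "\<exists>k1 :: nat \<Rightarrow> nat. primitive_recursive k1 \<and>
    (\<forall>(e :: nat) (m :: nat) (X :: nat \<Rightarrow> nat).
       feedback_converges e m X \<simeq> E_converges (k1 e) m X)"
proof -
  obtain u where u: "bounded_simulator u"
    using bounded_simulation_program unfolding bounded_simulator_def by metis
  obtain k where k: "primitive_recursive k" "\<And>e. simulating u e (k e)"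
    using simulating_program by blast
  have 1: "E_converges (k e) m X n" if "feedback_converges e m X n" for e m X n
  proof -
    have conv: "((e, m, X), (Conv, enat n)) \<in> Feedback_inf"
      using that by (simp add: feedback_converges_def)
    then have q: "queries X (feedback_answer X) (program_of e) m \<subseteq> feedback_defined X"
      and h: "halts_with X (feedback_answer X) (program_of e) m n"
      by (auto simp: Feedback_inf_iff)
    have "sim_answer X u (sim u e m) = 0"
      using feedback_answer_eq[OF conv] by (simp add: sim_answer_def)
    with k(2)[of e] h
    have *: "halts_with X (sim_answer X) (program_of (k e)) m n"
      "queries X (sim_answer X) (program_of (k e)) m \<subseteq>
         insert (u, sim u e m) (redirect u ` queries X (feedback_answer X) (program_of e) m)"
      unfolding simulating_def redirected_sim_answer[of u X, symmetric] by blast+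
    have "\<exists>y. (\<forall>i. ((e0, list_encode [m0, i], X), y i) \<in> Gamma_inf) \<and> sim_answer X e0 m0 = E2 y"
      if query: "(e0, m0) \<in> queries X (sim_answer X) (program_of (k e)) m" for e0 m0
    proof -
      \<comment> \<open>The opening query is the redirection of (e, m) itself and can be treated
        together with the queries of e.\<close>
      have "(e0, m0) \<in> redirect u ` insert (e, m) (queries X (feedback_answer X) (program_of e) m)"
        using subsetD[OF *(2) query] by (simp add: redirect_def)
      then obtain z where "(e0, m0) = redirect u z"
        "z \<in> insert (e, m) (queries X (feedback_answer X) (program_of e) m)"
        by (rule imageE)
      then obtain e' m' where e0: "e0 = u" "m0 = sim u e' m'"
        and "(e', m') \<in> insert (e, m) (queries X (feedback_answer X) (program_of e) m)"
        by (cases z) (simp add: redirect_def)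
      then have d: "(e', m') \<in> feedback_defined X"
        using q feedback_definedI(1)[OF q] by blast
      then obtain v where "((e', m', X), v) \<in> Feedback_inf"
        unfolding feedback_defined_def by blast
      from bounded_simulator_converges[OF u this] feedback_answer_E2[OF d] show ?thesis
        unfolding e0 sim_answer_def nsnd_npair nfst_npair by metis
    qed
    with *(1) have "((k e, m, X), n) \<in> Gamma Gamma_inf" unfolding Gamma_def by blast
    then show ?thesis by (simp add: E_converges_def Gamma_inf_unfold[symmetric])
  qed
  have 2: "\<exists>n. feedback_converges e m X n" if "E_converges (k e) m X n" for e m X n
  proof -
    have "((k e, m, X), n) \<in> Gamma Gamma_inf"
      using that by (simp add: E_converges_def Gamma_inf_unfold[symmetric])
    then obtain A where
      A: "\<And>e' m'. (e', m') \<in> queries X A (program_of (k e)) m \<Longrightarrow>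
        \<exists>y. (\<forall>i. ((e', list_encode [m', i], X), y i) \<in> Gamma_inf) \<and> A e' m' = E2 y"
      and h: "halts_with X A (program_of (k e)) m n"
      unfolding Gamma_def by fast
    have "(u, sim u e m) \<in> queries X A (program_of (k e)) m"
      using k(2) unfolding simulating_def by blast
    from A[OF this] obtain y where y:
      "\<And>i. ((u, list_encode [sim u e m, i], X), y i) \<in> sound_values u" "A u (sim u e m) = E2 y"
      using Gamma_inf_sound[OF u] by blast
    \<comment> \<open>A nonzero answer to the opening query would lead into the infinite loop, so
      halting forces 0; soundness identifies this answer with the feedback answer.\<close>
    have "feedback_answer X e m = 0"
      using sound_answer(2)[OF y(1)] y(2) k(2)[of e] h unfolding simulating_def by metis
    then show ?thesis
      unfolding feedback_answer_def feedback_converges_def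
      by (auto simp: Feedback_inf_iff split: if_splits)
  qed
  \<comment> \<open>One common value is enough: \<open>2\<close> turns convergence in E into some
    feedback value, and \<open>1\<close> carries that value over to E.\<close>
  have "feedback_converges e m X \<simeq> E_converges (k e) m X" for e m X
    using 1 2 unfolding kleene_eq_def by blast
  with k(1) show ?thesis by blast
qed

end
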